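(* Let $\mathcal{C}$ be the collection of all tilings of the plane by direct isometries of the decorated monotile $P_0$ that satisfy R1 and R2. Every tiling in the continuous hull of $\mathcal{C}$ is nonperiodic and satisfies R1. Moreover, in any tiling in the continuous hull of $\mathcal{C}$, the union of the R2-trees of all tiles has at most three connected components, and each of these components crosses an infinite number of tiles.
   Context: The monotile $P_0$. Let $H\subset\mathbb{R}^2$ be the closed regular hexagon centred at the origin with apothem $1/2$ whose edges $E_0,\dots,E_5$ have midpoints $m_k=\tfrac12(\cos\tfrac{k\pi}{3},\sin\tfrac{k\pi}{3})$, and let $t_k=(-\sin\tfrac{k\pi}{3},\cos\tfrac{k\pi}{3})$ be the counterclockwise unit tangent direction along $E_k$. Fix $0<\delta<\tfrac{1}{2\sqrt3}$ and signs $(\varepsilon_0,\dots,\varepsilon_5)=(-1,-1,+1,-1,+1,+1)$, and put $p_k=m_k+\varepsilon_k\delta t_k\in E_k$ (an off-centre point of $E_k$). The monotile $P_0$ is $H$ carrying the following decorations. (i) Three pairwise disjoint R1-curves: the straight segment from $p_1$ to $p_4$ (the straight R1-segment), and two corner curves (R1-corners), one joining $p_2$ to $p_3$ and one joining $p_5$ to $p_0$. Each R1-corner turns with interior angle $\pi/3$; for definiteness, the corner through $p_2,p_3$ consists of the two segments joining $p_2$ and $p_3$ to the point $2\delta(\cos\tfrac{5\pi}{6},\sin\tfrac{5\pi}{6})$, and the corner through $p_5,p_0$ consists of the two segments joining $p_5$ and $p_0$ to the point $2\delta(\cos\tfrac{11\pi}{6},\sin\tfrac{11\pi}{6})$. (ii)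 The R2-tree: the union of the four segments from the origin to $m_0,m_1,m_3,m_4$. Tilings. A tile is the image of $P_0$, together with its decorations, under a direct (orientation-preserving) isometry of $\mathbb{R}^2$; reflections are not allowed. A tiling is a collection of tiles covering the plane and intersecting only on their boundaries. A tiling $T$ is nonperiodic if no nonzero $v\in\mathbb{R}^2$ satisfies $T+v=T$ (as decorated tilings). Rules. $T$ satisfies R1 if the R1-curves are continuous across tiles: whenever two tiles share an edge, the endpoints of their R1-curves on that edge coincide. $T$ satisfies R2 if the union of the R2-trees of all tiles of $T$ is a connected subset of the plane (equivalently, every patch of $T$, i.e. every finite connected collection of tiles of $T$, is contained in a patch of $T$ that can be built one tile at a time so that the R2-tree of each added tile connects continuously, through the midpoint of a common edge, with the R2-tree of at least one adjacent tile already placed). Continuous hull. The continuous hull of a collection $\Lambda$ of tilings of $\mathbb{R}^2$ is the completion of $\{T+x : T\in\Lambda,\ x\in\mathbb{R}^2\}$ in the usual tiling metric, in which two tilings are close (within $\epsilon$) if, after translating each by a vector of length at most $\epsilon$, they agree on the ball of radius $1/\epsilon$ about the origin. Elements of the completion are regarded as tilings (limits of Cauchy sequences). *)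

theory Defs
  imports "HOL-Analysis.Analysis"
begin

text \<open>The plane is the type \<^typ>\<open>complex\<close>, with \<open>(x, y)\<close> written \<open>Complex x y\<close>.\<close>

subsection \<open>The monotile\<close>

definition edge_normal :: "nat \<Rightarrow> complex" where
  "edge_normal k = Complex (cos (real k * pi / 3)) (sin (real k * pi / 3))"

definition edge_mid :: "nat \<Rightarrow> complex" where
  "edge_mid k = (1 / 2) *\<^sub>R edge_normal k"

definition edge_tangent :: "nat \<Rightarrow> complex" where
  "edge_tangent k = Complex (- sin (real k * pi / 3)) (cos (real k * pi / 3))"

definition edge_sign :: "nat \<Rightarrow> real" where
  "edge_sign k = [- 1, - 1, 1, - 1, 1, 1] ! k"

definition r1_point :: "real \<Rightarrow> nat \<Rightarrow> complex" where
  "r1_point \<delta> k = edge_mid k + (edge_sign k * \<delta>) *\<^sub>R edge_tangent k"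

text \<open>The regular hexagon of apothem \<open>1/2\<close>, as an intersection of half-planes.\<close>

definition regular_hexagon :: "complex set" where
  "regular_hexagon = {z. \<forall>k<6. z \<bullet> edge_normal k \<le> 1 / 2}"

text \<open>
  A decorated tile. The R1-curves are kept as parametrised paths so that their endpoints are
  \<^const>\<open>pathstart\<close> and \<^const>\<open>pathfinish\<close>. The parametrisation carries no extra information:
  the supports of the decorations already admit no nontrivial direct symmetry, so a copy of the
  monotile determines the direct isometry that produces it.
\<close>

record tile =
  support :: "complex set"
  r1_curves :: "(real \<Rightarrow> complex) set"
  r2_tree :: "complex set"

definition monotile :: "real \<Rightarrow> tile" where
  "monotile \<delta> =
    \<lparr>support = regular_hexagon,
     r1_curves =
       {linepath (r1_point \<delta> 1) (r1_point \<delta> 4),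
        (let c = (2 * \<delta>) *\<^sub>R Complex (cos (5 * pi / 6)) (sin (5 * pi / 6))
         in linepath (r1_point \<delta> 2) c +++ linepath c (r1_point \<delta> 3)),
        (let c = (2 * \<delta>) *\<^sub>R Complex (cos (11 * pi / 6)) (sin (11 * pi / 6))
         in linepath (r1_point \<delta> 5) c +++ linepath c (r1_point \<delta> 0))},
     r2_tree = (\<Union>k\<in>{0, 1, 3, 4}. closed_segment 0 (edge_mid k))\<rparr>"

definition map_tile :: "(complex \<Rightarrow> complex) \<Rightarrow> tile \<Rightarrow> tile" where
  "map_tile f t =
    \<lparr>support = f ` support t,
     r1_curves = (\<lambda>\<gamma>. f \<circ> \<gamma>) ` r1_curves t,
     r2_tree = f ` r2_tree t\<rparr>"

text \<open>
  Multiplication by a unit complex number is a rotation about the origin; the orientation-reversing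
  isometries, which are excluded, are the maps \<open>\<lambda>z. a * cnj z + b\<close>.
\<close>

definition direct_isometry :: "(complex \<Rightarrow> complex) \<Rightarrow> bool" where
  "direct_isometry f \<longleftrightarrow> (\<exists>a b. norm a = 1 \<and> f = (\<lambda>z. a * z + b))"

subsection \<open>Tilings and rules\<close>

definition is_tile :: "real \<Rightarrow> tile \<Rightarrow> bool" where
  "is_tile \<delta> t \<longleftrightarrow> (\<exists>f. direct_isometry f \<and> t = map_tile f (monotile \<delta>))"

definition is_tiling :: "real \<Rightarrow> tile set \<Rightarrow> bool" where
  "is_tiling \<delta> T \<longleftrightarrow>
     (\<forall>t\<in>T. is_tile \<delta> t) \<and>
     (\<Union>t\<in>T. support t) = UNIV \<and>
     (\<forall>s\<in>T. \<forall>t\<in>T. s \<noteq> t \<longrightarrow>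
        support s \<inter> support t \<subseteq> frontier (support s) \<inter> frontier (support t))"

definition translate :: "complex \<Rightarrow> tile set \<Rightarrow> tile set" where
  "translate v T = map_tile (\<lambda>z. z + v) ` T"

definition nonperiodic :: "tile set \<Rightarrow> bool" where
  "nonperiodic T \<longleftrightarrow> \<not> (\<exists>v. v \<noteq> 0 \<and> translate v T = T)"

definition r1_endpoints :: "tile \<Rightarrow> complex set" where
  "r1_endpoints t = (\<Union>\<gamma>\<in>r1_curves t. {pathstart \<gamma>, pathfinish \<gamma>})"

definition R1 :: "tile set \<Rightarrow> bool" where
  "R1 T \<longleftrightarrow>
     (\<forall>s\<in>T. \<forall>t\<in>T. \<forall>e. e edge_of support s \<and> e edge_of support t \<longrightarrow>
        r1_endpoints s \<inter> e = r1_endpoints t \<inter> e)"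

definition R2_union :: "tile set \<Rightarrow> complex set" where
  "R2_union T = (\<Union>t\<in>T. r2_tree t)"

definition R2 :: "tile set \<Rightarrow> bool" where
  "R2 T \<longleftrightarrow> connected (R2_union T)"

subsection \<open>Continuous hull\<close>

definition agree_on :: "complex set \<Rightarrow> tile set \<Rightarrow> tile set \<Rightarrow> bool" where
  "agree_on B S T \<longleftrightarrow>
     {t \<in> S. support t \<inter> B \<noteq> {}} = {t \<in> T. support t \<inter> B \<noteq> {}}"

definition tiling_close :: "real \<Rightarrow> tile set \<Rightarrow> tile set \<Rightarrow> bool" where
  "tiling_close \<epsilon> S T \<longleftrightarrow>
     (\<exists>x y. norm x \<le> \<epsilon> \<and> norm y \<le> \<epsilon> \<and>
        agree_on (ball 0 (1 / \<epsilon>)) (translate x S) (translate y T))"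

definition tiling_tendsto :: "(nat \<Rightarrow> tile set) \<Rightarrow> tile set \<Rightarrow> bool" where
  "tiling_tendsto X S \<longleftrightarrow> (\<forall>\<epsilon>>0. \<forall>\<^sub>F n in sequentially. tiling_close \<epsilon> (X n) S)"

text \<open>
  The space of all tilings by copies of the monotile is complete in the tiling metric (nearby
  tilings differ locally by a small translation, and hexagons abut in finitely many ways up to
  isometry), so the completion of the set of translates is realised by the tilings that are limits
  of sequences of translates.
\<close>

definition continuous_hull :: "real \<Rightarrow> tile set set \<Rightarrow> tile set set" where
  "continuous_hull \<delta> \<Lambda> =
     {S. is_tiling \<delta> S \<and>
         (\<exists>X. (\<forall>n. X n \<in> {translate x T | x T. T \<in> \<Lambda>}) \<and> tiling_tendsto X S)}"

end

theory Submission
  imports Defs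
begin

text \<open>
  Equal regular hexagons cover the plane without overlap only as the honeycomb, so a tiling is
  a base tile together with a map \<open>s\<close> from the triangular lattice to the integers modulo 6: the
  tile at site \<open>x\<close> has its straight R1-segment, traversed from \<open>p\<^sub>1\<close> to \<open>p\<^sub>4\<close>, pointing in
  direction \<open>s x\<close> (unit vectors at multiples of 60 degrees). R1 says that across each edge the two
  tiles displace their R1-endpoint to the same side (\<open>valid\<close>). Call \<open>s x mod 3\<close> the colour of \<open>x\<close>;
  it is the axis of the straight segment and determines the R2-tree.

  The observation that makes R2 tractable: under R1, two neighbouring trees meet across their common
  edge exactly when one of the two sites is the successor of the other under
  \<open>step s x = x + dir (s x)\<close> (\<open>trees_meet\<close>, \<open>trees_touch\<close>). The R2-graph is thus the graph of a
  function, and R2 says that any two orbits of \<open>step s\<close> merge (\<open>R2_conn\<close>). In particular there is at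
  most one cycle, and two orbits that are disjoint for ever are impossible.

  Each tile has two R1-corners, and the triangle at a corner has side 1 or a larger side. A site is
  mixed if one of its triangles has side 1 and the other does not. From a mixed site the orbit either
  runs straight for ever through mixed sites or ends in a 3-cycle around a lattice triangle, and the
  site behind a run of mixed sites of one heading is again mixed. Playing these facts against the
  merging of orbits shows that a mixed site lies on a bi-infinite line of constant heading
  (\<open>mixed_constant_line\<close>); there is at most one such line since orbits on it never leave it.

  If no site is mixed, the sites with two larger triangles form a coset of twice the lattice and every
  other site is coloured by its direction from that coset (\<open>level_one\<close>). Restricting to the coset
  gives another solution with merging orbits, and iterating yields the full hierarchy. If there is
  a constant line, each half plane is doubled by a half turn about the line; the double has no mixed
  site, so each half plane separately carries the hierarchy, possibly with a relative shift
  (\<open>connected_structure\<close>).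

  A tiling of the hull coincides on every ball with a tiling of one of these two kinds. The hierarchy
  forbids periods (\<open>local_limit_nonperiodic\<close>). All sites in a hexagon of radius \<open>2\<^sup>n\<close> around a
  level \<open>n\<close> site flow to its centre and six corners, and those seven sites fall into at most
  three classes of the R2-graph; along a constant line the two half hexagons contribute the class
  of the line and one more each. So every ball meets at most three classes
  (\<open>local_limit_three_classes\<close>). Finally a finite class would already be visible in a tiling
  satisfying R2, where it would be everything (\<open>local_limit_infinite\<close>).
\<close>

section \<open>Heading maps on the triangular lattice\<close>

type_synonym site = "int \<times> int"

\<comment> \<open>Sites stay atomic variables; splitting them into coordinates only obscures the goals.\<close>
declare split_paired_All [simp del] split_paired_Ex [simp del]

definition scl :: "int \<Rightarrow> site \<Rightarrow> site" where
  "scl k x = (k * fst x, k * snd x)"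

text \<open>
  A site \<open>(i, j)\<close> stands for the point \<open>i + j e\<^sup>i\<^sup>\<pi>\<^sup>/\<^sup>3\<close>; the six unit steps are indexed
  counterclockwise modulo 6.
\<close>

definition dir :: "int \<Rightarrow> site" where
  "dir d = (if d mod 6 = 0 then (1, 0) else if d mod 6 = 1 then (0, 1) else
            if d mod 6 = 2 then (-1, 1) else if d mod 6 = 3 then (-1, 0) else
            if d mod 6 = 4 then (0, -1) else (1, -1))"

text \<open>
  The rotation of the lattice by \<open>d\<close> times 60 degrees: it takes \<^term>\<open>dir e\<close> to \<^term>\<open>dir (d + e)\<close>.
\<close>

definition rot :: "int \<Rightarrow> site \<Rightarrow> site" where
  "rot d x = scl (fst x) (dir d) + scl (snd x) (dir (d + 1))"

text \<open>
  Directions relative to the heading of a tile: \<open>out k\<close> means that the R1-endpoint on the edge in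
  relative direction \<open>k\<close> is displaced counterclockwise, and \<open>inn k\<close> that the one on the opposite edge
  (relative direction \<open>k + 3\<close>) is displaced clockwise. The straight segment uses 0 and 3. Hence
  \<open>inn\<close> and \<open>out\<close> agree on multiples of 3 and are complementary elsewhere.
\<close>

definition out :: "int \<Rightarrow> bool" where "out k \<longleftrightarrow> k mod 6 \<in> {0, 1, 4}"
definition inn :: "int \<Rightarrow> bool" where "inn k \<longleftrightarrow> k mod 6 \<in> {0, 2, 5}"

text \<open>
  R1 across the edge in direction \<open>d\<close>: displaced counterclockwise for one tile is clockwise for the other.
\<close>

definition valid :: "(site \<Rightarrow> int) \<Rightarrow> bool" where
  "valid s \<longleftrightarrow> (\<forall>x d. out (d - s x) = inn (d - s (x + dir d)))"

definition step :: "(site \<Rightarrow> int) \<Rightarrow> site \<Rightarrow> site" where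
  "step s x = x + dir (s x)"

text \<open>
  Two sites are in the same component of the functional graph of \<^term>\<open>step s\<close> iff their forward
  orbits merge.
\<close>

definition link :: "(site \<Rightarrow> int) \<Rightarrow> site \<Rightarrow> site \<Rightarrow> bool" where
  "link s x y \<longleftrightarrow> (\<exists>i j. (step s ^^ i) x = (step s ^^ j) y)"

definition conn :: "(site \<Rightarrow> int) \<Rightarrow> bool" where
  "conn s \<longleftrightarrow> (\<forall>x y. link s x y)"

text \<open>
  The heading map seen from site \<open>p\<close> with direction \<open>d\<close> taken as direction 0. All notions below are
  equivariant under a change of view, so local arguments can be made at the origin with heading 0.
\<close>

definition view :: "(site \<Rightarrow> int) \<Rightarrow> site \<Rightarrow> int \<Rightarrow> site \<Rightarrow> int" where
  "view s p d x = s (p + rot d x) - d"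

text \<open>
  The colour \<open>c = s x mod 3\<close> is the axis of the straight segment. The two R1-corners of the tile lie
  between the directions \<open>c + 1\<close> and \<open>c + 2\<close> and opposite to them; the triangle at a corner has side
  greater than 1 iff the neighbour in its first direction continues the curve straight, that is, has
  colour \<open>c + 1\<close>. So this says that exactly one of the two triangles has side 1.
\<close>

definition mixed :: "(site \<Rightarrow> int) \<Rightarrow> site \<Rightarrow> bool" where
  "mixed s x \<longleftrightarrow> s (x + dir (s x + 1)) mod 3 \<noteq> s (x - dir (s x + 1)) mod 3"

lemma mod6_cases:
  fixes d :: int
  obtains "d mod 6 = 0" | "d mod 6 = 1" | "d mod 6 = 2" | "d mod 6 = 3" | "d mod 6 = 4" | "d mod 6 = 5"
  by atomize_elim presburger

lemma scl_simps [simp]: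
  "scl k (i, j) = (k * i, k * j)" "scl 0 x = 0" "scl 1 x = x" "scl (-1) x = - x" "scl k 0 = 0"
  by (auto simp: scl_def prod_eq_iff)

lemma scl_fst_snd [simp]: "fst (scl k x) = k * fst x" "snd (scl k x) = k * snd x"
  by (auto simp: scl_def)

lemma scl_add: "scl k (x + y) = scl k x + scl k y"
  and scl_add_left: "scl (k + l) x = scl k x + scl l x"
  and scl_minus: "scl k (- x) = - scl k x"
  and scl_minus_left: "scl (- k) x = - scl k x"
  and scl_diff: "scl k (x - y) = scl k x - scl k y"
  and scl_diff_left: "scl (k - l) x = scl k x - scl l x"
  and scl_scl: "scl k (scl l x) = scl (k * l) x"
  by (auto simp: scl_def prod_eq_iff algebra_simps)

lemma dir_cong: "d mod 6 = e mod 6 \<Longrightarrow> dir d = dir e"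
  by (simp add: dir_def)

lemma dir_mod [simp]: "dir (d mod 6) = dir d"
  by (rule dir_cong) simp

lemma dir_opp: "dir (d + 3) = - dir d"
  by (cases d rule: mod6_cases) (simp_all add: dir_def mod_add_left_eq [of d 6 3, symmetric])

lemma dir_turn: "dir (d + 2) = dir (d + 1) - dir d"
  by (cases d rule: mod6_cases)
    (simp_all add: dir_def mod_add_left_eq [of d 6 2, symmetric] mod_add_left_eq [of d 6 1, symmetric])

lemma dir_0 [simp]: "dir 0 = (1, 0)" "dir 1 = (0, 1)" "dir 2 = (-1, 1)" "dir 3 = (-1, 0)"
  "dir 4 = (0, -1)" "dir 5 = (1, -1)"
  by (simp_all add: dir_def)

lemma rot_dir: "rot d (dir e) = dir (d + e)"
proof -
  have "dir (d + e) = dir (d + e mod 6)" by (rule dir_cong) (simp add: mod_add_right_eq)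
  moreover have "dir e = dir (e mod 6)" by simp
  moreover have "dir (d + 2) = dir (d + 1) - dir d" "dir (d + 3) = - dir d"
    "dir (d + 4) = - dir (d + 1)" "dir (d + 5) = dir d - dir (d + 1)"
    using dir_turn [of d] dir_opp [of d] dir_opp [of "d + 1"] dir_opp [of "d + 2"] by (simp_all add: algebra_simps)
  ultimately show ?thesis
    by (cases e rule: mod6_cases) (simp_all add: rot_def scl_minus)
qed

lemma rot_add: "rot d (x + y) = rot d x + rot d y"
  by (simp add: rot_def scl_add_left)

lemma rot_scl: "rot d (scl k x) = scl k (rot d x)"
  by (simp add: rot_def scl_add scl_scl)

lemma rot_0 [simp]: "rot d 0 = 0"
  by (simp add: rot_def)

lemma rot_minus: "rot d (- x) = - rot d x"
  by (simp add: rot_def scl_minus_left)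

lemma rot_diff: "rot d (x - y) = rot d x - rot d y"
  by (simp add: rot_def scl_diff_left)

lemma rot_rot: "rot d (rot e x) = rot (d + e) x"
proof -
  have "rot e x = scl (fst x) (dir e) + scl (snd x) (dir (e + 1))" by (simp add: rot_def)
  then show ?thesis by (simp only: rot_add rot_scl rot_dir) (simp add: rot_def add.assoc)
qed

lemma rot_zero [simp]: "rot 0 x = x"
  by (simp add: rot_def prod_eq_iff)

lemma rot_inverse: "rot d (rot (- d) x) = x" "rot (- d) (rot d x) = x"
  by (simp_all add: rot_rot)

lemma out_cong: "a mod 6 = b mod 6 \<Longrightarrow> out a = out b" by (simp add: out_def)
lemma inn_cong: "a mod 6 = b mod 6 \<Longrightarrow> inn a = inn b" by (simp add: inn_def)

lemma validD: "valid s \<Longrightarrow> out (d - s x) = inn (d - s (x + dir d))"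
  by (simp add: valid_def)

lemma valid_mod: "valid s \<Longrightarrow> y = x + dir d \<Longrightarrow> out (d - s x mod 6) = inn (d - s y mod 6)"
  using validD [of s d x] out_cong [of "d - s x mod 6" "d - s x"] inn_cong [of "d - s y mod 6" "d - s y"]
  by (simp add: mod_diff_right_eq)

lemma valid_view: assumes "valid s" shows "valid (view s p d)"
  unfolding valid_def
proof (intro allI)
  fix x e
  show "out (e - view s p d x) = inn (e - view s p d (x + dir e))"
    using validD [OF assms, of "d + e" "p + rot d x"]
    by (simp add: view_def rot_add rot_dir algebra_simps)
qed

lemma step_view: "p + rot d (step (view s p d) x) = step s (p + rot d x)"
  by (simp add: step_def view_def rot_add rot_dir)

lemma steps_view: "p + rot d ((step (view s p d) ^^ n) x) = (step s ^^ n) (p + rot d x)"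
  by (induction n) (simp_all add: step_view)

lemma link_view: "link (view s p d) x y \<longleftrightarrow> link s (p + rot d x) (p + rot d y)"
proof -
  have "rot d u = rot d v \<longleftrightarrow> u = v" for u v by (metis rot_inverse(2))
  then show ?thesis unfolding link_def steps_view [symmetric] by simp
qed

lemma conn_view: "conn s \<Longrightarrow> conn (view s p d)"
  by (simp add: conn_def link_view)

lemma mixed_view: "mixed (view s p d) x \<longleftrightarrow> mixed s (p + rot d x)"
proof -
  have "dir (s (p + rot d x) + 1) = rot d (dir (s (p + rot d x) - d + 1))"
    by (simp add: rot_dir)
  moreover have "(a - d) mod 3 = (b - d) mod 3 \<longleftrightarrow> a mod 3 = b mod 3" for a b :: int
    by (simp add: mod_eq_dvd_iff)
  ultimately show ?thesis
    by (simp add: mixed_def view_def rot_add rot_diff rot_dir algebra_simps)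
qed

lemma view_view: "view (view s p d) q e = view s (p + rot d q) (d + e)"
  by (rule ext) (simp add: view_def rot_add rot_rot algebra_simps)

lemma link_refl [simp]: "link s x x" unfolding link_def by blast
lemma link_sym: "link s x y \<Longrightarrow> link s y x" unfolding link_def by metis
lemma link_trans: assumes "link s x y" "link s y z" shows "link s x z"
proof -
  obtain i j k l where *: "(step s ^^ i) x = (step s ^^ j) y" "(step s ^^ k) y = (step s ^^ l) z"
    using assms unfolding link_def by blast
  have "(step s ^^ (k + i)) x = (step s ^^ k) ((step s ^^ j) y)" by (simp add: funpow_add *(1))
  also have "\<dots> = (step s ^^ j) ((step s ^^ k) y)" by (metis add.commute comp_apply funpow_add)
  also have "\<dots> = (step s ^^ (j + l)) z" by (simp add: funpow_add *(2))
  finally show ?thesis unfolding link_def by blast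
qed
lemma link_steps: "link s x ((step s ^^ n) x)"
  unfolding link_def by (rule exI [of _ n], rule exI [of _ 0]) simp
lemma link_step: "link s x (step s x)" using link_steps [of s x 1] by simp

lemma col_cases:
  fixes k :: int
  shows "k mod 3 = 1 \<Longrightarrow> out k \<and> \<not> inn k" "k mod 3 = 2 \<Longrightarrow> \<not> out k \<and> inn k"
    "k mod 3 = 0 \<Longrightarrow> inn k = out k"
proof -
  have m: "k mod 3 = (k mod 6) mod 3" by (simp add: mod_mod_cancel)
  show "k mod 3 = 1 \<Longrightarrow> out k \<and> \<not> inn k" "k mod 3 = 2 \<Longrightarrow> \<not> out k \<and> inn k"
    "k mod 3 = 0 \<Longrightarrow> inn k = out k"
    unfolding out_def inn_def m by (cases k rule: mod6_cases; simp)+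
qed

lemma inn_straight: "inn k \<Longrightarrow> k mod 3 = 0 \<Longrightarrow> k mod 6 = 0"
proof -
  have m: "k mod 3 = (k mod 6) mod 3" by (simp add: mod_mod_cancel)
  show "inn k \<Longrightarrow> k mod 3 = 0 \<Longrightarrow> k mod 6 = 0"
    unfolding inn_def m by (cases k rule: mod6_cases; simp)
qed

lemma col_eq_iff: "a mod 3 = b mod 3 \<longleftrightarrow> (d - a) mod 3 = (d - b) mod (3::int)"
  by (simp add: mod_eq_dvd_iff dvd_diff_commute)
lemma col_0_iff: "a mod 3 = d mod 3 \<longleftrightarrow> (d - a) mod 3 = (0::int)"
  by (auto simp: mod_eq_dvd_iff dvd_diff_commute mod_0_imp_dvd dvd_imp_mod_0)
lemma mod6_0_iff: "a mod 6 = d mod 6 \<longleftrightarrow> (d - a) mod 6 = (0::int)"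
  by (auto simp: mod_eq_dvd_iff dvd_diff_commute mod_0_imp_dvd dvd_imp_mod_0)
lemma mod3_cases:
  fixes d :: int
  obtains "d mod 3 = 0" | "d mod 3 = 1" | "d mod 3 = 2"
  by atomize_elim presburger

text \<open>
  If the common colour were another axis, the R1-endpoints along direction \<open>d\<close> would have to change
  sides in the same sense at two consecutive tiles.
\<close>

lemma equal_colour_axis:
  assumes "valid s" "s x mod 3 = s (x + dir d) mod 3" shows "s x mod 3 = d mod 3"
proof -
  have "out (d - s x) = inn (d - s (x + dir d))" using assms(1) by (rule validD)
  moreover have "(d - s x) mod 3 = (d - s (x + dir d)) mod 3" using assms(2) col_eq_iff by blast
  ultimately have "(d - s x) mod 3 = 0"
    by (cases "d - s x" rule: mod3_cases) (use col_cases in metis)+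
  then show ?thesis using col_0_iff [of "s x" d] by simp
qed

text \<open>
  Along a run of tiles whose straight segments lie on one line the displacement of the R1-endpoints
  is constant, so R1 acts between the two ends of the run as it does between neighbours.
\<close>

lemma straight_edge:
  assumes "valid s" "0 < m" "\<And>i. 0 < i \<Longrightarrow> i < m \<Longrightarrow> s (x + scl (int i) (dir d)) mod 3 = d mod 3"
  shows "out (d - s x) = inn (d - s (x + scl (int m) (dir d)))"
  using assms(2,3)
proof (induction m)
  case (Suc m)
  show ?case
  proof (cases "m = 0")
    case True then show ?thesis using validD [OF assms(1), of d x] by simp
  next
    case False
    have IH: "out (d - s x) = inn (d - s (x + scl (int m) (dir d)))" using Suc False by simp
    have c: "s (x + scl (int m) (dir d)) mod 3 = d mod 3" using Suc.prems(2) [of m] False by simp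
    then have "inn (d - s (x + scl (int m) (dir d))) = out (d - s (x + scl (int m) (dir d)))"
      using col_cases(3) [of "d - s (x + scl (int m) (dir d))"]
        col_0_iff [of "s (x + scl (int m) (dir d))" d] by simp
    also have "\<dots> = inn (d - s (x + scl (int m) (dir d) + dir d))" by (rule validD [OF assms(1)])
    also have "x + scl (int m) (dir d) + dir d = x + scl (int (Suc m)) (dir d)"
      by (simp add: scl_add_left add_ac)
    finally show ?thesis using IH by simp
  qed
qed simp

lemma straight_orbit:
  assumes "valid s" "s x mod 6 = d mod 6"
    "\<And>i. 0 < i \<Longrightarrow> i < m \<Longrightarrow> s (x + scl (int i) (dir d)) mod 3 = d mod 3" "i \<le> m"
  shows "(step s ^^ i) x = x + scl (int i) (dir d) \<and> (i < m \<longrightarrow> s (x + scl (int i) (dir d)) mod 6 = d mod 6)"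
  using assms(4)
proof (induction i)
  case 0 then show ?case using assms(2) by simp
next
  case (Suc i)
  then have IH: "(step s ^^ i) x = x + scl (int i) (dir d)" "s (x + scl (int i) (dir d)) mod 6 = d mod 6" by auto
  have e: "x + scl (int (Suc i)) (dir d) = x + scl (int i) (dir d) + dir d"
    by (simp add: scl_add_left add_ac)
  have 1: "(step s ^^ Suc i) x = x + scl (int (Suc i)) (dir d)"
    using IH dir_cong [OF IH(2)] e by (simp add: step_def)
  have "s (x + scl (int (Suc i)) (dir d)) mod 6 = d mod 6" if "Suc i < m"
  proof -
    have "out (d - s (x + scl (int i) (dir d))) = inn (d - s (x + scl (int (Suc i)) (dir d)))"
      unfolding e by (rule validD [OF assms(1)])
    moreover have "s (x + scl (int (Suc i)) (dir d)) mod 3 = d mod 3" using assms(3) that by blast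
    moreover have "out (d - s (x + scl (int i) (dir d)))" 
      using IH(2) mod6_0_iff [of "s (x + scl (int i) (dir d))" d] unfolding out_def by simp
    ultimately show ?thesis
      using inn_straight [of "d - s (x + scl (int (Suc i)) (dir d))"]
        col_0_iff [of "s (x + scl (int (Suc i)) (dir d))" d]
        mod6_0_iff [of "s (x + scl (int (Suc i)) (dir d))" d] by metis
  qed
  then show ?case using 1 by simp
qed

lemma straight_link:
  assumes "valid s" "0 < m" "\<And>i. 0 < i \<Longrightarrow> i < m \<Longrightarrow> s (x + scl (int i) (dir d)) mod 3 = d mod 3"
    "s x mod 6 = d mod 6"
  shows "link s x (x + scl (int m) (dir d))"
  using straight_orbit [OF assms(1,4,3), where m = m and i = m] link_steps [of s x m] by simp

section \<open>Mixed sites\<close>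

lemma mod3_of_mod6:
  fixes k :: int
  shows "k mod 6 = 0 \<Longrightarrow> k mod 3 = 0" "k mod 6 = 1 \<Longrightarrow> k mod 3 = 1" "k mod 6 = 2 \<Longrightarrow> k mod 3 = 2"
    "k mod 6 = 3 \<Longrightarrow> k mod 3 = 0" "k mod 6 = 4 \<Longrightarrow> k mod 3 = 1" "k mod 6 = 5 \<Longrightarrow> k mod 3 = 2"
proof -
  have m: "k mod 3 = (k mod 6) mod 3" by (simp add: mod_mod_cancel)
  show "k mod 6 = 0 \<Longrightarrow> k mod 3 = 0" "k mod 6 = 1 \<Longrightarrow> k mod 3 = 1" "k mod 6 = 2 \<Longrightarrow> k mod 3 = 2"
    "k mod 6 = 3 \<Longrightarrow> k mod 3 = 0" "k mod 6 = 4 \<Longrightarrow> k mod 3 = 1" "k mod 6 = 5 \<Longrightarrow> k mod 3 = 2"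
    unfolding m by simp_all
qed

lemma mod6_of_mod3:
  fixes k :: int
  shows "k mod 3 = 0 \<Longrightarrow> k mod 6 = 0 \<or> k mod 6 = 3" "k mod 3 = 1 \<Longrightarrow> k mod 6 = 1 \<or> k mod 6 = 4"
    "k mod 3 = 2 \<Longrightarrow> k mod 6 = 2 \<or> k mod 6 = 5"
  using mod3_of_mod6 [of k] by (cases k rule: mod6_cases; simp)+

lemma out_inn_values [simp]:
  "out 0" "out 1" "\<not> out 2" "\<not> out 3" "out 4" "\<not> out 5"
  "\<not> out (-1)" "out (-2)" "\<not> out (-3)" "\<not> out (-4)" "out (-5)"
  "inn 0" "\<not> inn 1" "inn 2" "\<not> inn 3" "\<not> inn 4" "inn 5"
  "inn (-1)" "\<not> inn (-2)" "\<not> inn (-3)" "inn (-4)" "\<not> inn (-5)"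
  by (simp_all add: out_def inn_def)

lemma neighbours_of_origin:
  assumes "valid v" "v (0,0) mod 6 = 0"
  shows "v (1,0) mod 6 \<in> {0,1,4}" "v (0,1) mod 6 \<in> {1,2,5}" "v (-1,1) mod 6 \<in> {1,4,5}"
    "v (-1,0) mod 6 \<in> {0,2,5}" "v (0,-1) mod 6 \<in> {2,4,5}" "v (1,-1) mod 6 \<in> {1,2,4}"
proof -
  note e = valid_mod [OF assms(1), where x = "(0,0)"]
  show "v (1,0) mod 6 \<in> {0,1,4}" using e [of "(1,0)" 0] assms(2)
    by (cases "v (1,0)" rule: mod6_cases) (simp_all)
  show "v (0,1) mod 6 \<in> {1,2,5}" using e [of "(0,1)" 1] assms(2)
    by (cases "v (0,1)" rule: mod6_cases) (simp_all)
  show "v (-1,1) mod 6 \<in> {1,4,5}" using e [of "(-1,1)" 2] assms(2)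
    by (cases "v (-1,1)" rule: mod6_cases) (simp_all)
  show "v (-1,0) mod 6 \<in> {0,2,5}" using e [of "(-1,0)" 3] assms(2)
    by (cases "v (-1,0)" rule: mod6_cases) (simp_all)
  show "v (0,-1) mod 6 \<in> {2,4,5}" using e [of "(0,-1)" 4] assms(2)
    by (cases "v (0,-1)" rule: mod6_cases) (simp_all)
  show "v (1,-1) mod 6 \<in> {1,2,4}" using e [of "(1,-1)" 5] assms(2)
    by (cases "v (1,-1)" rule: mod6_cases) (simp_all)
qed

lemma colour_12: "k mod 3 \<noteq> 0 \<Longrightarrow> k mod 3 = 1 \<or> k mod 3 = (2::int)"
  by (cases k rule: mod3_cases) auto

lemma equal_colour_row: "valid v \<Longrightarrow> v (i,j) mod 3 = v (i+1,j) mod 3 \<Longrightarrow> v (i,j) mod 3 = 0"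
  using equal_colour_axis [of v "(i,j)" 0] by simp

lemma colours_beside_0:
  assumes "valid v" "v (i,j) mod 3 = 0"
  shows "v (i,j+1) mod 3 = 1 \<or> v (i,j+1) mod 3 = 2" "v (i-1,j+1) mod 3 = 1 \<or> v (i-1,j+1) mod 3 = 2"
    "v (i,j-1) mod 3 = 1 \<or> v (i,j-1) mod 3 = 2" "v (i+1,j-1) mod 3 = 1 \<or> v (i+1,j-1) mod 3 = 2"
  using equal_colour_axis [OF assms(1), of "(i,j)" 1] equal_colour_axis [OF assms(1), of "(i,j)" 2]
    equal_colour_axis [OF assms(1), of "(i,j)" 4] equal_colour_axis [OF assms(1), of "(i,j)" 5] assms(2)
  by (auto intro!: colour_12)

lemma row_flip:
  assumes "valid v" "v (i,j) mod 3 = 0" "v (i+1,j) mod 3 = 0"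
  shows "v (i+1,j+1) mod 3 = 3 - v (i,j+1) mod 3" "v (i+1,j-1) mod 3 = 3 - v (i,j-1) mod 3"
proof -
  have *: "b = 3 - a" if "a = 1 \<or> a = 2" "b = 1 \<or> b = 2" "a = b \<Longrightarrow> a = 0" for a b :: int
    using that by auto
  show "v (i+1,j+1) mod 3 = 3 - v (i,j+1) mod 3"
    by (rule *; rule colours_beside_0 [OF assms(1,2)] colours_beside_0 [OF assms(1,3)] equal_colour_row [OF assms(1)])
  show "v (i+1,j-1) mod 3 = 3 - v (i,j-1) mod 3"
    by (rule *; rule colours_beside_0 [OF assms(1,2)] colours_beside_0 [OF assms(1,3)] equal_colour_row [OF assms(1)])
qed

text \<open>
  A mixed site with heading 0 has either the triangle of side 1 on its left and the larger one on its
  right, or conversely; each is recorded by the values that R1 leaves for the four sites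
  involved.
\<close>

definition typeA :: "(site \<Rightarrow> int) \<Rightarrow> bool" where
  "typeA v \<longleftrightarrow> v (0,1) mod 3 = 2 \<and> v (-1,1) mod 3 = 1 \<and> v (0,-1) mod 6 = 4 \<and> v (1,-1) mod 6 = 2"
definition typeB :: "(site \<Rightarrow> int) \<Rightarrow> bool" where
  "typeB v \<longleftrightarrow> v (0,1) mod 6 = 1 \<and> v (-1,1) mod 6 = 5 \<and> v (0,-1) mod 3 = 2 \<and> v (1,-1) mod 3 = 1"

lemma mixed_origin:
  assumes "v (0,0) mod 6 = 0"
  shows "mixed v (0,0) \<longleftrightarrow> v (0,1) mod 3 \<noteq> v (0,-1) mod 3"
proof -
  have "(v (0,0) + 1) mod 6 = 1 mod 6" using assms by (simp add: mod_add_left_eq [of "v (0,0)" 6 1, symmetric])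
  from dir_cong [OF this] have "dir (v (0,0) + 1) = (0,1)" by simp
  then show ?thesis by (simp add: mixed_def)
qed

lemma mixed_type:
  assumes "valid v" "v (0,0) mod 6 = 0" "mixed v (0,0)"
  shows "typeA v \<or> typeB v"
proof -
  note n = neighbours_of_origin [OF assms(1,2)]
  note e = valid_mod [OF assms(1)]
  have m: "v (0,1) mod 3 \<noteq> v (0,-1) mod 3" using assms(3) mixed_origin [of v, OF assms(2)] by simp
  have up: "(v (0,1) mod 6 = 1 \<and> v (-1,1) mod 6 = 5) \<or> (v (0,1) mod 3 = 2 \<and> v (-1,1) mod 3 = 1)"
    using n(2,3) e [of "(-1,1)" "(0,1)" 3] by (auto simp: mod3_of_mod6)
  have down: "(v (0,-1) mod 6 = 4 \<and> v (1,-1) mod 6 = 2) \<or> (v (0,-1) mod 3 = 2 \<and> v (1,-1) mod 3 = 1)"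
    using n(5,6) e [of "(1,-1)" "(0,-1)" 0] by (auto simp: mod3_of_mod6)
  show ?thesis using up down m unfolding typeA_def typeB_def by (auto simp: mod3_of_mod6)
qed

text \<open>
  Ahead of a mixed site of the second type R1 permits only heading 0 again; ahead of the first type
  the next site either has heading 0 or turns right, and then the orbit closes up around a lattice
  triangle. The types alternate because the colours in the adjacent rows alternate.
\<close>

lemma mixed_next:
  assumes "valid v" "v (0,0) mod 6 = 0" "mixed v (0,0)"
  shows "(v (1,0) mod 6 = 0 \<and> mixed v (1,0)) \<or>
         (v (1,0) mod 6 = 4 \<and> v (1,-1) mod 6 = 2 \<and> v (0,1) mod 6 = 2)"
proof -
  note n = neighbours_of_origin [OF assms(1,2)]
  note e = valid_mod [OF assms(1)]
  have mx: "mixed v (1,0)" if *: "v (1,0) mod 6 = 0" and **: "v (0,1) mod 3 \<noteq> v (0,-1) mod 3"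
  proof -
    define w where "w = view v (1,0) 0"
    have w: "valid w" "w (0,0) mod 6 = 0" using valid_view [OF assms(1)] * by (auto simp: w_def view_def)
    have "mixed w (0,0)" unfolding mixed_origin [of w, OF w(2)]
      using row_flip [OF assms(1), of 0 0] ** mod3_of_mod6(1) [OF *] mod3_of_mod6(1) [OF assms(2)]
      by (simp add: w_def view_def)
    then show ?thesis unfolding w_def mixed_view by simp
  qed
  from mixed_type [OF assms] show ?thesis
  proof
    assume "typeB v"
    then have "v (1,0) mod 6 = 0" using n(1) e [of "(0,1)" "(1,0)" 2]
      by (auto simp: typeB_def)
    then show ?thesis using mx assms(3) mixed_origin [of v, OF assms(2)] by simp
  next
    assume A: "typeA v"
    show ?thesis
    proof (cases "v (1,0) mod 6 = 0")
      case True
      then show ?thesis using mx assms(3) mixed_origin [of v, OF assms(2)] by simp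
    next
      case False
      then have "v (1,0) mod 6 = 4" using A n(1) e [of "(1,0)" "(1,-1)" 1]
        by (auto simp: typeA_def)
      moreover have "v (0,1) mod 6 = 2" using A n(2) e [of "(0,1)" "(1,0)" 2] \<open>v (1,0) mod 6 = 4\<close>
        by (auto simp: typeA_def mod3_of_mod6)
      ultimately show ?thesis using A by (simp add: typeA_def)
    qed
  qed
qed

text \<open>
  If the heading changes behind a mixed site, R1 in the row below fixes the colour of the site one
  further back, and it differs from that of the given site; so the site in between is mixed.
\<close>

lemma mixed_prev:
  assumes "valid v" "v (0,0) mod 6 = 0" "mixed v (0,0)"
  shows "mixed v (-1,0) \<and> v (-1,0) mod 6 \<in> {0, 2, 5}"
proof -
  note n = neighbours_of_origin [OF assms(1,2)]
  note e = valid_mod [OF assms(1)]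
  have m: "v (0,1) mod 3 \<noteq> v (0,-1) mod 3" using assms(3) mixed_origin [of v, OF assms(2)] by simp
  have "mixed v (-1,0)"
  proof (cases "v (-1,0) mod 6 = 0")
    case True
    define w where "w = view v (-1,0) 0"
    have w: "valid w" "w (0,0) mod 6 = 0" using valid_view [OF assms(1)] True by (auto simp: w_def view_def)
    have "mixed w (0,0)" unfolding mixed_origin [of w, OF w(2)]
      using row_flip [OF assms(1), of "-1" 0] m mod3_of_mod6(1) [OF True] mod3_of_mod6(1) [OF assms(2)]
      by (simp add: w_def view_def)
    then show ?thesis unfolding w_def mixed_view by simp
  next
    case False
    then have c: "v (-1,0) mod 6 = 2 \<or> v (-1,0) mod 6 = 5" using n by auto
    then have c': "v (-1,0) mod 3 = 2" by (auto simp: mod3_of_mod6)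
    have "\<not> typeB v"
      using equal_colour_axis [OF assms(1), of "(-1,0)" 1] c' by (auto simp: typeB_def mod3_of_mod6)
    then have A: "typeA v" using mixed_type [OF assms] by blast
    then have d: "v (0,-1) mod 3 = 1" by (simp add: typeA_def mod3_of_mod6)
    have c1: "v (-1,-1) mod 3 = 0"
      using equal_colour_row [OF assms(1), of "-1" "-1"] d
        equal_colour_axis [OF assms(1), of "(-1,0)" 4] c'
      by (cases "v (-1,-1)" rule: mod3_cases) simp_all
    have c2: "v (-2,0) mod 3 = 1"
      using equal_colour_row [OF assms(1), of "-2" 0] c'
        equal_colour_axis [OF assms(1), of "(-2,0)" 5] c1
      by (cases "v (-2,0)" rule: mod3_cases) simp_all
    have "dir (v (-1,0) + 1) = (-1,0) \<or> dir (v (-1,0) + 1) = (1,0)"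
    proof -
      have "(v (-1,0) + 1) mod 6 = 3 mod 6 \<or> (v (-1,0) + 1) mod 6 = 0 mod 6"
        using c by (auto simp: mod_add_left_eq [of "v (-1,0)" 6 1, symmetric])
      then show ?thesis using dir_cong [of "v (-1,0) + 1" 3] dir_cong [of "v (-1,0) + 1" 0] by auto
    qed
    then show ?thesis using c2 mod3_of_mod6(1) [OF assms(2)] by (auto simp: mixed_def zero_prod_def)
  qed
  then show ?thesis using n by simp
qed

lemma rot_unit: "rot d (1,0) = dir d" "rot d (0,1) = dir (d+1)" "rot d (-1,1) = dir (d+2)"
  "rot d (-1,0) = - dir d" "rot d (0,-1) = - dir (d+1)" "rot d (1,-1) = dir (d+5)"
  using rot_dir [of d 0] rot_dir [of d 1] rot_dir [of d 2] rot_dir [of d 3] rot_dir [of d 4] rot_dir [of d 5]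
    dir_opp [of d] dir_opp [of "d+1"] by (simp_all add: algebra_simps)

lemma sub_mod6_iff: "(a - d) mod 6 = k mod 6 \<longleftrightarrow> a mod 6 = (d + k) mod (6::int)"
  by (simp add: mod_eq_dvd_iff algebra_simps)
lemma sub_mod3_iff: "(a - d) mod 3 = k mod 3 \<longleftrightarrow> a mod 3 = (d + k) mod (3::int)"
  by (simp add: mod_eq_dvd_iff algebra_simps)

section \<open>Orbits of mixed sites\<close>

text \<open>
  The sites \<open>y\<close>, \<open>y + dir d\<close>, \<open>y + dir (d + 5)\<close> form a cycle of \<^term>\<open>step s\<close>. The last conjunct
  says that the larger triangle at \<open>y + dir d\<close> continues along its other side.
\<close>

definition three_cycle :: "(site \<Rightarrow> int) \<Rightarrow> site \<Rightarrow> int \<Rightarrow> bool" where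
  "three_cycle s y d \<longleftrightarrow> s y mod 6 = d mod 6 \<and> s (y + dir d) mod 6 = (d+4) mod 6 \<and>
     s (y + dir (d+5)) mod 6 = (d+2) mod 6 \<and> s (y + dir (d+1)) mod 6 = (d+2) mod 6"

lemma mixed_next':
  assumes "valid s" "mixed s x" "s x mod 6 = d mod 6"
  shows "(s (x + dir d) mod 6 = d mod 6 \<and> mixed s (x + dir d)) \<or> three_cycle s x d"
proof -
  let ?v = "view s x d"
  have v: "valid ?v" "?v (0,0) mod 6 = 0" "mixed ?v (0,0)"
    using assms valid_view [of s x d] sub_mod6_iff [of "s x" d 0] by (simp_all add: mixed_view) (auto simp: view_def zero_prod_def [symmetric])
  show ?thesis using mixed_next [OF v] assms(3)
      sub_mod6_iff [of "s (x + dir d)" d 0] sub_mod6_iff [of "s (x + dir d)" d 4]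
      sub_mod6_iff [of "s (x + dir (d+5))" d 2] sub_mod6_iff [of "s (x + dir (d+1))" d 2]
    unfolding mixed_view by (auto simp: view_def rot_unit three_cycle_def)
qed

lemma mixed_prev':
  assumes "valid s" "mixed s x" "s x mod 6 = d mod 6"
  shows "mixed s (x - dir d) \<and>
    (s (x - dir d) mod 6 = d mod 6 \<or> s (x - dir d) mod 6 = (d+2) mod 6 \<or> s (x - dir d) mod 6 = (d+5) mod 6)"
proof -
  let ?v = "view s x d"
  have v: "valid ?v" "?v (0,0) mod 6 = 0" "mixed ?v (0,0)"
    using assms valid_view [of s x d] sub_mod6_iff [of "s x" d 0] by (simp_all add: mixed_view) (auto simp: view_def zero_prod_def [symmetric])
  show ?thesis using mixed_prev [OF v]
      sub_mod6_iff [of "s (x - dir d)" d 0] sub_mod6_iff [of "s (x - dir d)" d 2] sub_mod6_iff [of "s (x - dir d)" d 5]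
    unfolding mixed_view by (auto simp: view_def rot_unit)
qed

definition ray :: "(site \<Rightarrow> int) \<Rightarrow> site \<Rightarrow> int \<Rightarrow> bool" where
  "ray s x d \<longleftrightarrow> (\<forall>n. s (x + scl (int n) (dir d)) mod 6 = d mod 6)"

lemma ray_orbit:
  assumes "ray s x d" shows "(step s ^^ n) x = x + scl (int n) (dir d)"
proof (induction n)
  case (Suc n)
  have "s (x + scl (int n) (dir d)) mod 6 = d mod 6" using assms by (simp add: ray_def)
  from dir_cong [OF this] show ?case using Suc by (simp add: step_def scl_add_left add_ac)
qed simp

lemma ray_or_three_cycle:
  assumes "valid s" "mixed s x" "s x mod 6 = d mod 6"
  shows "ray s x d \<or> (\<exists>n. three_cycle s (x + scl (int n) (dir d)) d \<and> mixed s (x + scl (int n) (dir d)) \<and>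
     (step s ^^ n) x = x + scl (int n) (dir d))"
proof (rule disjCI)
  assume no: "\<not> (\<exists>n. three_cycle s (x + scl (int n) (dir d)) d \<and> mixed s (x + scl (int n) (dir d)) \<and>
     (step s ^^ n) x = x + scl (int n) (dir d))"
  have "s (x + scl (int n) (dir d)) mod 6 = d mod 6 \<and> mixed s (x + scl (int n) (dir d)) \<and>
     (step s ^^ n) x = x + scl (int n) (dir d)" for n
  proof (induction n)
    case 0 then show ?case using assms by simp
  next
    case (Suc n)
    have e: "x + scl (int (Suc n)) (dir d) = x + scl (int n) (dir d) + dir d"
      by (simp add: scl_add_left add_ac)
    have "\<not> three_cycle s (x + scl (int n) (dir d)) d" using Suc no by blast
    then have "s (x + scl (int n) (dir d) + dir d) mod 6 = d mod 6 \<and> mixed s (x + scl (int n) (dir d) + dir d)"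
      using mixed_next' [OF assms(1), of "x + scl (int n) (dir d)" d] Suc by blast
    moreover have "step s (x + scl (int n) (dir d)) = x + scl (int n) (dir d) + dir d"
      using dir_cong [of "s (x + scl (int n) (dir d))" d] Suc by (simp add: step_def)
    ultimately show ?case using Suc unfolding e by simp
  qed
  then show "ray s x d" by (simp add: ray_def)
qed

lemma three_cycle_step:
  assumes "three_cycle s y d"
  shows "step s y = y + dir d" "step s (y + dir d) = y + dir (d+5)" "step s (y + dir (d+5)) = y"
proof -
  have t: "dir (d+4) = - dir (d+1)" "dir (d+5) = dir d - dir (d+1)" "dir (d+2) = dir (d+1) - dir d"
    using dir_turn [of d] dir_opp [of "d+1"] dir_opp [of "d+2"] by (simp_all add: algebra_simps)
  show "step s y = y + dir d" "step s (y + dir d) = y + dir (d+5)" "step s (y + dir (d+5)) = y"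
    using assms dir_cong [of "s y" d] dir_cong [of "s (y + dir d)" "d+4"] dir_cong [of "s (y + dir (d+5))" "d+2"]
    unfolding three_cycle_def step_def t by (auto simp: algebra_simps)
qed

lemma three_cycle_orbit:
  assumes "three_cycle s y d" shows "(step s ^^ n) y \<in> {y, y + dir d, y + dir (d+5)}"
  by (induction n) (use three_cycle_step [OF assms] in auto)

lemma three_cycle_period:
  assumes "three_cycle s y d" shows "(step s ^^ (3 * n)) y = y"
proof (induction n)
  case (Suc n)
  have "(step s ^^ (3 * Suc n)) y = (step s ^^ (3 * n)) (step s (step s (step s y)))"
    by (metis (no_types, lifting) comp_apply funpow_Suc_right mult_Suc_right add_2_eq_Suc numeral_3_eq_3 plus_nat.simps add.commute)
  then show ?case using Suc three_cycle_step [OF assms] by simp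
qed simp

lemma scl_inj: "scl a (dir d) = scl b (dir d) \<longleftrightarrow> a = b"
  by (cases d rule: mod6_cases) (simp_all add: dir_def)

lemma ray_not_link_three_cycle:
  assumes "ray s x d" "three_cycle s y e" shows "\<not> link s x y"
proof
  assume "link s x y"
  then obtain i j where ij: "(step s ^^ i) x = (step s ^^ j) y" unfolding link_def by blast
  have "(step s ^^ (3 + i)) x = (step s ^^ 3) ((step s ^^ j) y)" by (simp only: funpow_add comp_apply ij)
  also have "\<dots> = (step s ^^ j) ((step s ^^ (3 * 1)) y)" by (metis add.commute comp_apply funpow_add mult.right_neutral)
  also have "\<dots> = (step s ^^ i) x" by (simp only: three_cycle_period [OF assms(2)] ij)
  finally show False unfolding ray_orbit [OF assms(1)] by (simp add: scl_inj)
qed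

lemma rays_not_link:
  assumes "ray s x d" "ray s y e" "d mod 6 \<noteq> e mod 6" shows "\<not> link s x y"
proof
  assume "link s x y"
  then obtain i j where ij: "(step s ^^ i) x = (step s ^^ j) y" unfolding link_def by blast
  have "s ((step s ^^ i) x) mod 6 = d mod 6" "s ((step s ^^ j) y) mod 6 = e mod 6"
    unfolding ray_orbit [OF assms(1)] ray_orbit [OF assms(2)] using assms by (auto simp: ray_def)
  then show False using ij assms(3) by simp
qed

text \<open>
  An R1-curve cannot spiral inwards. Starting at a corner of colour 0 (coming along the side of
  colour 2), the next side runs towards a site that is again of colour 0; corners of colours 0 and 2
  alternate along it, so it must turn before, at a site of colour 2. Turning the picture by 120
  degrees gives the same situation with a strictly shorter side.
\<close>

lemma spiral_trap:
  fixes n :: nat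
  shows "valid v \<Longrightarrow> 0 < n \<Longrightarrow> v (0,0) mod 3 = 0 \<Longrightarrow> v (0, - int n) mod 3 = 0 \<Longrightarrow>
    (\<And>i. 0 < i \<Longrightarrow> i < n \<Longrightarrow> v (int i, - int i) mod 3 = 2) \<Longrightarrow> False"
proof (induction n arbitrary: v rule: less_induct)
  case (less n)
  define j where "j = (LEAST j. 0 < j \<and> v (0, - int j) mod 3 \<noteq> 1)"
  have ex: "0 < n \<and> v (0, - int n) mod 3 \<noteq> 1" using less.prems by simp
  have j: "0 < j" "v (0, - int j) mod 3 \<noteq> 1" "j \<le> n"
    using LeastI [of "\<lambda>j. 0 < j \<and> v (0, - int j) mod 3 \<noteq> 1", OF ex] Least_le [of "\<lambda>j. 0 < j \<and> v (0, - int j) mod 3 \<noteq> 1", OF ex]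
    unfolding j_def by auto
  have st: "v (0, - int i) mod 3 = 1" if "0 < i" "i < j" for i
    using not_less_Least [of i "\<lambda>j. 0 < j \<and> v (0, - int j) mod 3 \<noteq> 1"] that unfolding j_def by auto
  have ed: "out (4 - v (0,0)) = inn (4 - v (0, - int j))"
    using straight_edge [OF less.prems(1) j(1), of "(0,0)" 4] st by simp
  have "(4 - v (0,0)) mod 3 = 1"
    using less.prems(3) by (simp add: mod_diff_right_eq [of 4 "v (0,0)" 3, symmetric])
  then have "inn (4 - v (0, - int j))" using ed col_cases(1) by blast
  moreover have "v (0, - int j) mod 3 = 0 \<Longrightarrow> (4 - v (0, - int j)) mod 3 = 1"
    by (simp add: mod_diff_right_eq [of 4 "v (0, - int j)" 3, symmetric])
  ultimately have c2: "v (0, - int j) mod 3 = 2" using j(2) col_cases(1) by (cases "v (0, - int j)" rule: mod3_cases) blast+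
  then have jn: "j < n" using less.prems(4) j(3) by (cases "j = n") auto
  define w where "w = view v (0, - int j) 2"
  have em: "rot 2 (0, - int j) = (int j, 0)" "rot 2 (int i, - int i) = (0, int i)" for i
    by (simp_all add: rot_def)
  have m3: "k mod 3 = 2 \<Longrightarrow> (k - 2) mod 3 = 0" "k mod 3 = 1 \<Longrightarrow> (k - 2) mod 3 = 2" for k :: int
    by (simp_all add: mod_diff_left_eq [of k 3 2, symmetric])
  show False
  proof (rule less.IH [OF jn])
    show "valid w" using less.prems(1) valid_view w_def by blast
    show "0 < j" by fact
    show "w (0,0) mod 3 = 0" using m3 c2 by (simp add: w_def view_def zero_prod_def [symmetric])
    show "w (0, - int j) mod 3 = 0" using m3 less.prems(5) [OF j(1) jn] by (simp add: w_def view_def em)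
    show "w (int i, - int i) mod 3 = 2" if "0 < i" "i < j" for i
      using m3(2) [of "v (0, - int (j - i))"] st [of "j - i"] that by (simp add: w_def view_def em of_nat_diff)
  qed
qed

section \<open>Mixed sites lie on constant lines\<close>

text \<open>
  Suppose there is a cycle. It attracts every orbit. The mixed sites behind the first site of
  the cycle must continue for ever: where the heading changes, the site is mixed, so its
  orbit is straight until it enters a cycle, but its heading and position do not let it enter the
  given one. The resulting infinite side, together with \<open>spiral_trap\<close>, makes the other
  side of the same R1-corner infinite as well, and along it the orbit escapes straight to
  infinity.
\<close>

lemma no_three_cycle_at_origin:
  assumes v: "valid v" "conn v" and m: "mixed v (0,0)" and y: "three_cycle v (0,0) 0"
  shows False
proof -
  have vals: "v (0,0) mod 6 = 0" "v (1,0) mod 6 = 4" "v (1,-1) mod 6 = 2" "v (0,1) mod 6 = 2"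
    using y unfolding three_cycle_def by simp_all
  have link: "link v x (0,0)" for x using v(2) by (simp add: conn_def)
  \<comment> \<open>The incoming chain of mixed sites never ends.\<close>
  have chain: "v (- int k, 0) mod 6 = 0 \<and> mixed v (- int k, 0)" for k
  proof (induction k)
    case 0 then show ?case using vals m by simp
  next
    case (Suc k)
    define q where "q = (- int (Suc k), 0 :: int)"
    have q: "(- int k, 0) - dir 0 = q" by (simp add: q_def)
    have mq: "mixed v q" and cq: "v q mod 6 = 0 \<or> v q mod 6 = 2 \<or> v q mod 6 = 5"
      using mixed_prev' [OF v(1), of "(- int k, 0)" 0] Suc unfolding q by auto
    show ?case
    proof (cases "v q mod 6 = 0")
      case True then show ?thesis using mq unfolding q_def by simp
    next
      case False
      then have cq: "v q mod 6 = 2 \<or> v q mod 6 = 5" using cq by blast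
      have "\<not> ray v q (v q)" using ray_not_link_three_cycle [OF _ y] link by blast
      then obtain n where n: "three_cycle v (q + scl (int n) (dir (v q))) (v q)"
        using ray_or_three_cycle [OF v(1) mq refl] by blast
      define z where "z = q + scl (int n) (dir (v q))"
      obtain i j where ij: "(step v ^^ i) z = (step v ^^ j) (0,0)" using link unfolding link_def by blast
      have "z = (step v ^^ (2 * i + i)) z" using three_cycle_period [OF n, of i] by (simp add: z_def)
      also have "\<dots> = (step v ^^ (2 * i)) ((step v ^^ j) (0,0))" by (simp only: funpow_add comp_apply ij)
      also have "\<dots> = (step v ^^ (2 * i + j)) (0,0)" by (simp add: funpow_add)
      finally have "z \<in> {(0,0), (1,0), (1,-1)}" using three_cycle_orbit [OF y, of "2 * i + j"] by simp
      moreover have "v z mod 6 = v q mod 6" using n unfolding three_cycle_def z_def by simp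
      ultimately have "v q mod 6 = 2" "z = (1,-1)" using cq vals by auto
      then show ?thesis using dir_cong [of "v q" 2] by (simp add: z_def q_def)
    qed
  qed
  \<comment> \<open>The other side of the R1-corner at \<open>(1, 0)\<close> never turns either.\<close>
  have side: "v (1 - int k, int k) mod 3 = 2" if "0 < k" for k
  proof (rule ccontr)
    assume no: "v (1 - int k, int k) mod 3 \<noteq> 2"
    let ?P = "\<lambda>k. 0 < k \<and> v (1 - int k, int k) mod 3 \<noteq> 2"
    define k0 where "k0 = (LEAST k. ?P k)"
    have ex: "?P k" using no that by simp
    have k0: "0 < k0" "v (1 - int k0, int k0) mod 3 \<noteq> 2" using LeastI [of ?P, OF ex] unfolding k0_def by auto
    have st: "v (1 - int i, int i) mod 3 = 2" if "0 < i" "i < k0" for i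
      using not_less_Least [of i ?P] that unfolding k0_def by auto
    have p: "(1,0) + scl (int i) (dir 2) = (1 - int i, int i)" for i by simp
    have "out (2 - v (1,0)) = inn (2 - v (1 - int k0, int k0))"
      using straight_edge [OF v(1) k0(1), of "(1,0)" 2] st unfolding p by simp
    moreover have "(2 - v (1,0)) mod 3 = 1" using mod3_of_mod6(5) [OF vals(2)]
      by (simp add: mod_diff_right_eq [of 2 "v (1,0)" 3, symmetric])
    ultimately have "inn (2 - v (1 - int k0, int k0))" using col_cases(1) by blast
    moreover have "v (1 - int k0, int k0) mod 3 = 1 \<Longrightarrow> (2 - v (1 - int k0, int k0)) mod 3 = 1"
      by (simp add: mod_diff_right_eq [of 2 "v (1 - int k0, int k0)" 3, symmetric])
    ultimately have c: "v (1 - int k0, int k0) mod 3 = 0" using k0(2) col_cases(1)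
      by (cases "v (1 - int k0, int k0)" rule: mod3_cases) blast+
    define w where "w = view v (1 - int k0, int k0) 0"
    show False
    proof (rule spiral_trap [of w k0])
      show "valid w" using valid_view v(1) w_def by blast
      show "w (0,0) mod 3 = 0" using c by (simp add: w_def view_def)
      show "w (0, - int k0) mod 3 = 0" using chain [of "k0 - 1"] k0(1)
        by (simp add: w_def view_def of_nat_diff mod3_of_mod6)
      show "w (int i, - int i) mod 3 = 2" if "0 < i" "i < k0" for i
        using st [of "k0 - i"] that by (simp add: w_def view_def of_nat_diff algebra_simps)
    qed (rule k0(1))
  qed
  have "ray v (0,1) 2"
  proof -
    have c: "v ((0,1) + scl (int i) (dir 2)) mod 3 = 2 mod 3" for i
      using side [of "Suc i"] by simp
    show ?thesis unfolding ray_def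
    proof
      fix n
      show "v ((0, 1) + scl (int n) (dir 2)) mod 6 = 2 mod 6"
        using straight_orbit [OF v(1), of "(0,1)" 2 "Suc n" n, OF _ c] vals(4) by simp
    qed
  qed
  then show False using ray_not_link_three_cycle [OF _ y] link by blast
qed

lemma no_three_cycle:
  assumes "valid s" "conn s" "mixed s x" shows "\<not> three_cycle s x d"
proof
  assume y: "three_cycle s x d"
  have "three_cycle (view s x d) (0,0) 0"
    using y sub_mod6_iff [of "s x" d 0] sub_mod6_iff [of "s (x + dir d)" d 4]
      sub_mod6_iff [of "s (x + dir (d+5))" d 2] sub_mod6_iff [of "s (x + dir (d+1))" d 2]
    by (simp add: three_cycle_def view_def rot_unit zero_prod_def [symmetric])
  moreover have "mixed (view s x d) (0,0)" using assms by (simp add: mixed_view zero_prod_def [symmetric])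
  ultimately show False using no_three_cycle_at_origin assms valid_view conn_view by blast
qed

definition constant_line :: "(site \<Rightarrow> int) \<Rightarrow> site \<Rightarrow> bool" where
  "constant_line s x \<longleftrightarrow> (\<forall>k. s (x + scl k (dir (s x))) mod 6 = s x mod 6)"

lemma mixed_ray: "valid s \<Longrightarrow> conn s \<Longrightarrow> mixed s x \<Longrightarrow> s x mod 6 = d mod 6 \<Longrightarrow> ray s x d"
  using ray_or_three_cycle no_three_cycle by blast

text \<open>
  Without 3-cycles the orbit of a mixed site is a straight ray. Going backwards, a change of heading
  would produce a second straight ray with a different heading, and two such rays never merge.
\<close>

lemma mixed_constant_line:
  assumes s: "valid s" "conn s" "mixed s x" shows "constant_line s x"
proof -
  define d where "d = s x"
  have bwd: "s (x - scl (int k) (dir d)) mod 6 = d mod 6 \<and> mixed s (x - scl (int k) (dir d))" for k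
  proof (induction k)
    case 0 then show ?case using s by (simp add: d_def)
  next
    case (Suc k)
    define q where "q = x - scl (int (Suc k)) (dir d)"
    have q: "x - scl (int k) (dir d) - dir d = q" by (simp add: q_def scl_add_left algebra_simps)
    have mq: "mixed s q" using mixed_prev' [OF s(1), of "x - scl (int k) (dir d)" d] Suc unfolding q by blast
    have "ray s q (s q)" "ray s x d" using mixed_ray s mq d_def by blast+
    then have "s q mod 6 = d mod 6" using rays_not_link s(2) unfolding conn_def by metis
    then show ?case using mq unfolding q_def by simp
  qed
  have fwd: "s (x + scl (int k) (dir d)) mod 6 = d mod 6" for k
    using mixed_ray [OF s] d_def unfolding ray_def by blast
  show ?thesis unfolding constant_line_def d_def [symmetric]
  proof
    fix k show "s (x + scl k (dir d)) mod 6 = d mod 6"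
      using fwd [of "nat k"] bwd [of "nat (- k)"] by (cases "0 \<le> k") (auto simp: scl_minus_left)
  qed
qed

lemma constant_line_ray: "constant_line s x \<Longrightarrow> ray s x (s x)"
  by (simp add: constant_line_def ray_def)

section \<open>The first level of the hierarchy\<close>

text \<open>
  The pattern around a vertex of the coarser lattice.
\<close>

definition axial :: "(site \<Rightarrow> int) \<Rightarrow> site \<Rightarrow> bool" where
  "axial s x \<longleftrightarrow> (\<forall>d. s (x + dir d) mod 3 = d mod 3)"

lemma axial_view: "axial (view s p d) x \<longleftrightarrow> axial s (p + rot d x)"
proof -
  have "(\<forall>e. s (p + rot d x + dir (d + e)) mod 3 = (d + e) mod 3) \<longleftrightarrow> (\<forall>e. s (p + rot d x + dir e) mod 3 = e mod 3)"
    by (metis add_diff_cancel_left' diff_add_cancel add.commute)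
  then show ?thesis unfolding axial_def view_def by (simp add: rot_add rot_dir sub_mod3_iff add.assoc)
qed

lemma axialI:
  assumes "v (1,0) mod 3 = 0" "v (0,1) mod 3 = 1" "v (-1,1) mod 3 = 2" "v (-1,0) mod 3 = 0"
    "v (0,-1) mod 3 = 1" "v (1,-1) mod 3 = 2"
  shows "axial v (0,0)"
  unfolding axial_def
proof
  fix d
  show "v ((0,0) + dir d) mod 3 = d mod 3"
  proof (cases d rule: mod6_cases)
    case 1 then have "dir d = (1,0)" "d mod 3 = 0" using mod3_of_mod6(1) [of d] by (simp_all add: dir_def)
    then show ?thesis using assms(1) by simp
  next
    case 2 then have "dir d = (0,1)" "d mod 3 = 1" using mod3_of_mod6(2) [of d] by (simp_all add: dir_def)
    then show ?thesis using assms(2) by simp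
  next
    case 3 then have "dir d = (-1,1)" "d mod 3 = 2" using mod3_of_mod6(3) [of d] by (simp_all add: dir_def)
    then show ?thesis using assms(3) by simp
  next
    case 4 then have "dir d = (-1,0)" "d mod 3 = 0" using mod3_of_mod6(4) [of d] by (simp_all add: dir_def)
    then show ?thesis using assms(4) by simp
  next
    case 5 then have "dir d = (0,-1)" "d mod 3 = 1" using mod3_of_mod6(5) [of d] by (simp_all add: dir_def)
    then show ?thesis using assms(5) by simp
  next
    case 6 then have "dir d = (1,-1)" "d mod 3 = 2" using mod3_of_mod6(6) [of d] by (simp_all add: dir_def)
    then show ?thesis using assms(6) by simp
  qed
qed

lemma mixed_colour:
  assumes "s x mod 3 = d mod 3"
  shows "mixed s x \<longleftrightarrow> s (x + dir (d+1)) mod 3 \<noteq> s (x - dir (d+1)) mod 3"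
proof -
  have "(s x - d) mod 3 = 0" using assms by (simp add: mod_eq_dvd_iff mod_0_imp_dvd)
  then have "(s x - d) mod 6 = 0 \<or> (s x - d) mod 6 = 3" by (rule mod6_of_mod3)
  then have "s x mod 6 = d mod 6 \<or> s x mod 6 = (d + 3) mod 6"
    using sub_mod6_iff [of "s x" d 0] sub_mod6_iff [of "s x" d 3] by simp
  then have "(s x + 1) mod 6 = (d + 1) mod 6 \<or> (s x + 1) mod 6 = (d + 1 + 3) mod 6"
    using mod_add_cong [of "s x" 6 d 1 1] mod_add_cong [of "s x" 6 "d + 3" 1 1]
    unfolding add.assoc add.commute [of 3 1] by blast
  then have "dir (s x + 1) = dir (d + 1) \<or> dir (s x + 1) = - dir (d + 1)"
    using dir_cong [of "s x + 1" "d + 1"] dir_cong [of "s x + 1" "d + 1 + 3"] dir_opp [of "d + 1"] by auto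
  then show ?thesis unfolding mixed_def by auto
qed

text \<open>
  A larger triangle at one corner forces, absence of mixed sites granted, the opposite one too,
  which fixes the colours in four directions. The neighbours so found have a triangle of side 1
  on one side, hence on both, and this fixes the remaining two.
\<close>

lemma axial_of_big_corner:
  assumes v: "valid v" and nm: "\<And>x. \<not> mixed v x" and c: "v (0,0) mod 3 = 0" "v (0,1) mod 3 = 1"
  shows "axial v (0,0)"
proof -
  note e = equal_colour_axis [OF v]
  have 1: "v (0,-1) mod 3 = 1" using nm [of "(0,0)"] mixed_colour [of v "(0,0)" 0] c by simp
  have 2: "v (-1,1) mod 3 = 2"
    using colours_beside_0(2) [OF v c(1)] equal_colour_row [OF v, of "-1" 1] c(2) by auto
  have 3: "v (1,-1) mod 3 = 2"
    using colours_beside_0(4) [OF v c(1)] equal_colour_row [OF v, of "0" "-1"] 1 by auto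
  have 4: "v (-1,2) mod 3 = 0"
    using e [of "(0,1)" 2] e [of "(-1,1)" 1] c(2) 2 by (cases "v (-1,2)" rule: mod3_cases) simp_all
  have 5: "v (1,-2) mod 3 = 0"
    using e [of "(0,-1)" 5] e [of "(1,-1)" 4] 1 3 by (cases "v (1,-2)" rule: mod3_cases) simp_all
  have 6: "v (1,0) mod 3 = 0" using nm [of "(0,1)"] mixed_colour [of v "(0,1)" 1] c(2) 4 by simp
  have 7: "v (-1,0) mod 3 = 0" using nm [of "(0,-1)"] mixed_colour [of v "(0,-1)" 1] 1 5 by simp
  show ?thesis by (rule axialI) (use c 1 2 3 6 7 in auto)
qed

text \<open>
  Whatever the colour of \<open>x\<close>, one of three consecutive directions is a first direction of a corner.
\<close>

lemma axial_of_three: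
  assumes s: "valid s" and nm: "\<And>x. \<not> mixed s x"
    and c: "s (x + dir (d+2)) mod 3 = (d+2) mod 3" "s (x + dir (d+3)) mod 3 = (d+3) mod 3" "s (x + dir (d+4)) mod 3 = (d+4) mod 3"
  shows "axial s x"
proof -
  have "\<exists>e\<in>{d+2,d+3,d+4}. s x mod 3 = (e - 1) mod 3"
  proof -
    have "(s x - d) mod 3 \<in> {0,1,2}" by (cases "s x - d" rule: mod3_cases) auto
    then have "s x mod 3 = (d + 0) mod 3 \<or> s x mod 3 = (d+1) mod 3 \<or> s x mod 3 = (d+2) mod 3"
      using sub_mod3_iff [of "s x" d 0] sub_mod3_iff [of "s x" d 1] sub_mod3_iff [of "s x" d 2] by auto
    moreover have "(d + 3) mod 3 = d mod 3" by simp
    ultimately show ?thesis by (auto simp: algebra_simps)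
  qed
  then obtain e where e: "e \<in> {d+2,d+3,d+4}" "s x mod 3 = (e - 1) mod 3" by blast
  have ce: "s (x + dir e) mod 3 = e mod 3" using e(1) c by auto
  let ?v = "view s x (e - 1)"
  have "axial ?v (0,0)"
  proof (rule axial_of_big_corner)
    show "?v (0,0) mod 3 = 0" using e(2) sub_mod3_iff [of "s x" "e - 1" 0] by (simp add: view_def zero_prod_def [symmetric])
    show "?v (0,1) mod 3 = 1" using ce sub_mod3_iff [of "s (x + dir e)" "e - 1" 1] by (simp add: view_def rot_unit)
  qed (use s nm valid_view mixed_view in auto)
  then show ?thesis by (simp add: axial_view zero_prod_def [symmetric])
qed

text \<open>
  If both triangles at the origin have side 1, then the next site ahead sees three neighbours
  coloured by direction.
\<close>

lemma axial_exists:
  assumes v: "valid v" and nm: "\<And>x. \<not> mixed v x" and c: "v (0,0) mod 3 = 0"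
  shows "\<exists>x. axial v x"
proof (cases "v (0,1) mod 3 = 1")
  case True then show ?thesis using axial_of_big_corner [OF v nm c] by blast
next
  case False
  have 1: "v (0,1) mod 3 = 2" using False colours_beside_0(1) [OF v c] by simp
  then have 2: "v (0,-1) mod 3 = 2" using nm [of "(0,0)"] mixed_colour [of v "(0,0)" 0] c by simp
  have 3: "v (1,-1) mod 3 = 1"
    using colours_beside_0(4) [OF v c] equal_colour_row [OF v, of "0" "-1"] 2 by auto
  have "axial v (1,0)" by (rule axial_of_three [OF v nm, of _ 0]) (use 1 3 c in simp_all)
  then show ?thesis by blast
qed

lemma axial_step2:
  assumes v: "valid v" and nm: "\<And>x. \<not> mixed v x" and a: "axial v (0,0)"
  shows "axial v (2,0)"
proof -
  note e = equal_colour_axis [OF v]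
  have a: "v (1,0) mod 3 = 0" "v (0,1) mod 3 = 1" "v (1,-1) mod 3 = 2"
    using a [unfolded axial_def, rule_format, of 0] a [unfolded axial_def, rule_format, of 1] a [unfolded axial_def, rule_format, of 5]
    by simp_all
  have 1: "v (1,1) mod 3 = 2"
    using e [of "(1,0)" 1] e [of "(0,1)" 0] a by (cases "v (1,1)" rule: mod3_cases) simp_all
  have 2: "v (2,-1) mod 3 = 1"
    using e [of "(1,0)" 5] e [of "(1,-1)" 0] a by (cases "v (2,-1)" rule: mod3_cases) simp_all
  show ?thesis by (rule axial_of_three [OF v nm, of _ 0]) (use 1 2 a in simp_all)
qed

lemma lattice_induct:
  assumes "P c" "\<And>x d. P x \<Longrightarrow> P (x + dir d)" shows "P (x :: site)"
proof -
  have constant_line: "P (y + scl k (dir d))" if "P y" for y k d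
  proof -
    have pos: "P (y + scl (int n) (dir d))" for n d
    proof (induction n)
      case 0 then show ?case using that by simp
    next
      case (Suc n) show ?case using assms(2) [OF Suc.IH, of d] by (simp add: scl_add_left add_ac)
    qed
    show ?thesis using pos [of "nat k" d] pos [of "nat (- k)" "d + 3"]
      by (cases "0 \<le> k") (auto simp: dir_opp scl_minus scl_minus_left)
  qed
  have "P (c + scl (fst (x - c)) (dir 0) + scl (snd (x - c)) (dir 1))"
    by (rule constant_line, rule constant_line, rule assms(1))
  moreover have "c + scl (fst (x - c)) (dir 0) + scl (snd (x - c)) (dir 1) = x" by (simp add: prod_eq_iff)
  ultimately show ?thesis by simp
qed

text \<open>
  Vertices of the coarse lattice propagate by twice a unit step, and there is at least one.
\<close>

lemma level_one:
  assumes s: "valid s" and nm: "\<And>x. \<not> mixed s x"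
  shows "\<exists>c. \<forall>x. axial s (c + scl 2 x)"
proof -
  have "\<exists>x. axial (view s 0 (s 0)) x"
    by (rule axial_exists) (use s nm valid_view mixed_view in \<open>auto simp: view_def zero_prod_def [symmetric]\<close>)
  then obtain c where c: "axial s c" using axial_view by blast
  have "axial s (x + scl 2 (dir d))" if "axial s x" for x d
  proof -
    have "axial (view s x d) (2,0)"
      by (rule axial_step2) (use s nm valid_view mixed_view that in \<open>auto simp: axial_view zero_prod_def [symmetric]\<close>)
    moreover have "rot d (2,0) = scl 2 (dir d)" by (simp add: rot_def)
    ultimately show ?thesis by (simp add: axial_view)
  qed
  then have "axial s (c + scl 2 x)" for x
    by (intro lattice_induct [of "\<lambda>x. axial s (c + scl 2 x)" 0 x]) (auto simp: c scl_add add.assoc [symmetric])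
  then show ?thesis by blast
qed

section \<open>The full hierarchy\<close>

definition deflate :: "(site \<Rightarrow> int) \<Rightarrow> site \<Rightarrow> site \<Rightarrow> int" where
  "deflate s c x = s (c + scl 2 x)"

text \<open>
  The first \<open>n\<close> levels of the hierarchy with vertex coset \<open>c + 2\<^sup>n L\<close>, as far as it concerns sites in
  \<open>E\<close>: the sites of level \<open>k\<close> are those of \<open>c + 2\<^sup>k L\<close> outside \<open>c + 2\<^sup>k\<^sup>+\<^sup>1 L\<close>.
\<close>

definition hier :: "site set \<Rightarrow> nat \<Rightarrow> site \<Rightarrow> (site \<Rightarrow> int) \<Rightarrow> bool" where
  "hier E n c s \<longleftrightarrow> (\<forall>k<n. \<forall>d x. c + scl (2 ^ k) (dir d) + scl (2 ^ Suc k) x \<in> E \<longrightarrow>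
     s (c + scl (2 ^ k) (dir d) + scl (2 ^ Suc k) x) mod 3 = d mod 3)"

lemma deflate_valid:
  assumes "valid s" "\<And>x. axial s (c + scl 2 x)" shows "valid (deflate s c)"
  unfolding valid_def
proof (intro allI)
  fix x d
  have "s (c + scl 2 x + scl (int i) (dir d)) mod 3 = d mod 3" if "0 < i" "i < 2" for i
    using assms(2) [of x] that unfolding axial_def by (cases "i = 1") auto
  then show "out (d - deflate s c x) = inn (d - deflate s c (x + dir d))"
    using straight_edge [OF assms(1), of 2 "c + scl 2 x" d] by (simp add: deflate_def scl_add add.assoc)
qed

lemma deflate_step:
  assumes "valid s" "\<And>x. axial s (c + scl 2 x)"
  shows "step s (step s (c + scl 2 x)) = c + scl 2 (step (deflate s c) x)"
proof -
  let ?d = "s (c + scl 2 x)"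
  have "s (c + scl 2 x + scl (int i) (dir ?d)) mod 3 = ?d mod 3" if "0 < i" "i < 2" for i
    using assms(2) [of x] that unfolding axial_def by (cases "i = 1") auto
  then have "(step s ^^ 2) (c + scl 2 x) = c + scl 2 x + scl (int 2) (dir ?d)"
    using straight_orbit [OF assms(1) refl, where x = "c + scl 2 x" and m = 2 and i = 2] by simp
  then show ?thesis by (simp add: numeral_2_eq_2 step_def deflate_def scl_add add.assoc)
qed

lemma deflate_steps:
  assumes "valid s" "\<And>x. axial s (c + scl 2 x)"
  shows "(step s ^^ (2 * n)) (c + scl 2 x) = c + scl 2 ((step (deflate s c) ^^ n) x)"
  by (induction n) (simp_all add: deflate_step [OF assms])

lemma dir_not_even: "scl 2 x \<noteq> dir d + scl 2 y"
proof
  assume "scl 2 x = dir d + scl 2 y"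
  then have "2 * (fst x - fst y) = fst (dir d)" "2 * (snd x - snd y) = snd (dir d)"
    by (auto simp: prod_eq_iff)
  then have "even (fst (dir d))" "even (snd (dir d))" by (metis dvd_triv_left)+
  then show False by (cases d rule: mod6_cases) (simp_all add: dir_def)
qed

lemma scl2_inj: "scl 2 x = scl 2 y \<longleftrightarrow> x = y"
  by (auto simp: prod_eq_iff)

text \<open>
  Two steps from a coset site make one step of the deflated map, and an odd number of steps leads out
  of the coset; so merging orbits from coset sites merge after numbers of steps of equal parity.
\<close>

lemma deflate_conn:
  assumes s: "valid s" "\<And>x. axial s (c + scl 2 x)" and "conn s" shows "conn (deflate s c)"
  unfolding conn_def
proof (intro allI)
  fix x y
  obtain i j where ij: "(step s ^^ i) (c + scl 2 x) = (step s ^^ j) (c + scl 2 y)"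
    using \<open>conn s\<close> unfolding conn_def link_def by blast
  have ev: "(step s ^^ (2 * i')) (c + scl 2 x) \<noteq> (step s ^^ Suc (2 * j')) (c + scl 2 y)" for i' j' x y
  proof
    assume "(step s ^^ (2 * i')) (c + scl 2 x) = (step s ^^ Suc (2 * j')) (c + scl 2 y)"
    then obtain u v where "c + scl 2 u = step s (c + scl 2 v)" by (auto simp: deflate_steps [OF s])
    then have "scl 2 u = dir (s (c + scl 2 v)) + scl 2 v" by (simp add: step_def algebra_simps)
    then show False using dir_not_even by blast
  qed
  obtain i' where "i = 2 * i' \<or> i = Suc (2 * i')" by (metis oddE evenE Suc_eq_plus1)
  moreover obtain j' where "j = 2 * j' \<or> j = Suc (2 * j')" by (metis oddE evenE Suc_eq_plus1)
  ultimately consider "i = 2 * i'" "j = 2 * j'" | "i = Suc (2 * i')" "j = Suc (2 * j')"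
    using ev ij by metis
  then show "link (deflate s c) x y"
  proof cases
    case 1
    then show ?thesis using ij unfolding link_def by (auto simp: deflate_steps [OF s] scl2_inj)
  next
    case 2
    have "(step s ^^ (2 * Suc i')) (c + scl 2 x) = (step s ^^ (2 * Suc j')) (c + scl 2 y)"
      using ij 2 by simp
    then have "(step (deflate s c) ^^ Suc i') x = (step (deflate s c) ^^ Suc j') y"
      unfolding deflate_steps [OF s] by (simp add: scl2_inj)
    then show ?thesis unfolding link_def by blast
  qed
qed

lemma hier_Suc:
  assumes a: "\<And>x. axial s (c + scl 2 x)" and h: "hier E' n c' (deflate s c)"
    and E: "\<And>x. c + scl 2 x \<in> E \<Longrightarrow> x \<in> E'"
  shows "hier E (Suc n) (c + scl 2 c') s"
  unfolding hier_def
proof (intro allI impI)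
  fix k d x
  let ?y = "c + scl 2 c' + scl (2 ^ k) (dir d) + scl (2 ^ Suc k) x"
  assume k: "k < Suc n" and y: "?y \<in> E"
  show "s ?y mod 3 = d mod 3"
  proof (cases k)
    case 0
    have "?y = c + scl 2 (c' + x) + dir d" using 0 by (simp add: scl_add algebra_simps)
    then show ?thesis using a unfolding axial_def by metis
  next
    case (Suc k')
    have e: "?y = c + scl 2 (c' + scl (2 ^ k') (dir d) + scl (2 ^ Suc k') x)"
      using Suc by (simp add: scl_add scl_scl algebra_simps)
    have "c' + scl (2 ^ k') (dir d) + scl (2 ^ Suc k') x \<in> E'" using E y unfolding e by blast
    then have "deflate s c (c' + scl (2 ^ k') (dir d) + scl (2 ^ Suc k') x) mod 3 = d mod 3"
      using h k Suc unfolding hier_def by auto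
    then show ?thesis unfolding e deflate_def .
  qed
qed

text \<open>
  A constant line of the deflated map would be one of the original map, so the absence of such lines,
  and with it the absence of mixed sites, is inherited by all levels.
\<close>

lemma hier_of_no_line:
  assumes "valid s" "conn s" "\<And>x. \<not> constant_line s x" shows "\<exists>c. hier UNIV n c s"
  using assms
proof (induction n arbitrary: s)
  case 0 then show ?case by (simp add: hier_def)
next
  case (Suc n)
  have "\<not> mixed s x" for x using mixed_constant_line Suc.prems by blast
  then obtain c where c: "\<And>x. axial s (c + scl 2 x)" using level_one Suc.prems by blast
  let ?s = "deflate s c"
  have v: "valid ?s" "conn ?s" using deflate_valid deflate_conn c Suc.prems by blast+
  have "\<not> constant_line ?s x" for x
  proof
    assume l: "constant_line ?s x"
    let ?d = "?s x"
    have "s (c + scl 2 x + scl k (dir ?d)) mod 6 = ?d mod 6" for k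
    proof -
      have ev: "s (c + scl 2 x + scl (2 * j) (dir ?d)) mod 6 = ?d mod 6" for j
      proof -
        have "s (c + scl 2 x + scl (2 * j) (dir ?d)) = ?s (x + scl j (dir ?d))"
          by (simp add: deflate_def scl_add scl_scl add.assoc)
        then show ?thesis using l unfolding constant_line_def by simp
      qed
      have od: "s (c + scl 2 x + scl (2 * j + 1) (dir ?d)) mod 6 = ?d mod 6" for j
      proof -
        let ?y = "c + scl 2 x + scl (2 * j) (dir ?d)"
        have e: "c + scl 2 x + scl (2 * j + 1) (dir ?d) = ?y + dir ?d"
          by (simp add: scl_add_left add_ac)
        have "?y = c + scl 2 (x + scl j (dir ?d))" by (simp add: scl_add scl_scl add.assoc)
        then have c: "s (?y + dir ?d) mod 3 = ?d mod 3" using c unfolding axial_def by metis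
        have st: "s (?y + scl (int i) (dir ?d)) mod 3 = ?d mod 3" if "0 < i" "i < 2" for i
          using c that by (cases "i = 1") auto
        show ?thesis unfolding e
          using straight_orbit [where s = s and x = ?y and d = ?d and m = 2 and i = 1, OF Suc.prems(1) ev [of j] st] by simp
      qed
      show ?thesis using ev [of "k div 2"] od [of "k div 2"] by (cases "even k") auto
    qed
    then have "constant_line s (c + scl 2 x)" unfolding constant_line_def by (simp add: deflate_def)
    then show False using Suc.prems by blast
  qed
  then obtain c' where "hier UNIV n c' ?s" using Suc.IH v by blast
  then show ?case using hier_Suc [OF c] by blast
qed

section \<open>Half planes along a constant line\<close>

text \<open>
  The upper half plane above a line of colour 0, doubled by the half turn about the origin. On the
  line itself the heading is made 0, which R1 allows: off the line it sees only the colour.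
\<close>

definition doubled :: "(site \<Rightarrow> int) \<Rightarrow> site \<Rightarrow> int" where
  "doubled s x = (if 0 < snd x then s x else if snd x = 0 then 0 else s (- x) + 3)"

lemma dir_snd: "snd (dir d) \<in> {-1, 0, 1}"
  by (simp add: dir_def)

lemma dir_snd_0: "snd (dir d) = 0 \<longleftrightarrow> d mod 3 = 0"
  using mod3_of_mod6 [of d] by (cases d rule: mod6_cases) (simp_all add: dir_def)

lemma out_inn_colour:
  assumes "a mod 3 = b mod 3" "a mod 3 \<noteq> 0" shows "out a = out b" "inn a = inn b"
  using assms col_cases(1,2) [of a] col_cases(1,2) [of b] colour_12 [of a] by metis+

lemma doubled_valid:
  assumes s: "valid s" and row: "\<And>k. s (k,0) mod 3 = 0"
  shows "valid (doubled s)"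
  unfolding valid_def
proof (intro allI)
  fix x d
  define y where "y = x + dir d"
  have sy: "snd y = snd x + snd (dir d)" by (simp add: y_def)
  have row': "s z mod 3 = 0" if "snd z = 0" for z using row [of "fst z"] that by (metis prod.collapse)
  have c0: "out (d - 0) = out (d - s z) \<and> inn (d - 0) = inn (d - s z)" if "snd z = 0" "d mod 3 \<noteq> 0" for z d
  proof -
    have "(d - 0) mod 3 = (d - s z) mod 3" using row' [OF that(1)] by (simp add: mod_eq_dvd_iff mod_0_imp_dvd)
    then show ?thesis using out_inn_colour [of "d - 0" "d - s z"] that by simp
  qed
  have c3: "out (d - (s z + 3)) = out (d + 3 - s z)" "inn (d - (s z + 3)) = inn (d + 3 - s z)" for z
  proof -
    have "(d - (s z + 3)) mod 6 = (d + 3 - s z) mod 6" by (simp add: mod_eq_dvd_iff)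
    then show "out (d - (s z + 3)) = out (d + 3 - s z)" "inn (d - (s z + 3)) = inn (d + 3 - s z)"
      using out_cong inn_cong by blast+
  qed
  have "out (d - doubled s x) = inn (d - doubled s y)"
  proof (cases "snd x = 0 \<and> snd y = 0")
    case True
    then show ?thesis using sy dir_snd_0 [of d] col_cases(3) [of d] by (simp add: doubled_def)
  next
    case False
    consider "0 \<le> snd x" "0 \<le> snd y" | "snd x \<le> 0" "snd y \<le> 0" using dir_snd [of d] sy by fastforce
    then show ?thesis
    proof cases
      case 1
      have "out (d - doubled s x) = out (d - s x)"
        using 1 False c0 [of x d] sy dir_snd_0 [of d] by (cases "snd x = 0") (auto simp: doubled_def)
      moreover have "inn (d - doubled s y) = inn (d - s y)"
        using 1 False c0 [of y d] sy dir_snd_0 [of d] by (cases "snd y = 0") (auto simp: doubled_def)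
      ultimately show ?thesis using validD [OF s, of d x] y_def by simp
    next
      case 2
      have d3: "(d + 3) mod 3 = d mod 3" by simp
      have sh: "out (d - 0) = out (d + 3 - 0) \<and> inn (d - 0) = inn (d + 3 - 0)" if "d mod 3 \<noteq> 0"
        using out_inn_colour [of "d - 0" "d + 3 - 0"] that by simp
      have "out (d - doubled s x) = out (d + 3 - s (- x))"
        using 2 False c0 [of "- x" "d + 3"] sh sy dir_snd_0 [of d] c3 by (cases "snd x = 0") (auto simp: doubled_def)
      moreover have "inn (d - doubled s y) = inn (d + 3 - s (- y))"
        using 2 False c0 [of "- y" "d + 3"] sh sy dir_snd_0 [of d] c3 by (cases "snd y = 0") (auto simp: doubled_def)
      moreover have "- y = - x + dir (d + 3)" by (simp add: y_def dir_opp)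
      ultimately show ?thesis using validD [OF s, of "d + 3" "- x"] by simp
    qed
  qed
  then show "out (d - doubled s x) = inn (d - doubled s (x + dir d))" by (simp add: y_def)
qed

text \<open>
  The half-plane substitute for \<^const>\<open>conn\<close>: every orbit from the closed upper half plane reaches the
  boundary row.
\<close>

definition drains :: "(site \<Rightarrow> int) \<Rightarrow> bool" where
  "drains s \<longleftrightarrow> (\<forall>x. 0 \<le> snd x \<longrightarrow> (\<exists>i. snd ((step s ^^ i) x) = 0))"

lemma doubled_row_orbit: "(step (doubled s) ^^ n) (k,0) = (k + int n, 0)"
  by (induction n) (simp_all add: step_def doubled_def)

lemma step_snd: "snd (step s x) = snd x + snd (dir (s x))"
  by (simp add: step_def)

lemma doubled_drains_aux:
  "0 \<le> snd x \<Longrightarrow> snd ((step s ^^ i) x) = 0 \<Longrightarrow>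
    (\<exists>j k. (step (doubled s) ^^ j) x = (k,0)) \<and> (\<exists>j k. (step (doubled s) ^^ j) (- x) = (k,0))"
proof (induction i arbitrary: x)
  case 0
  then have "x = (fst x, 0)" "- x = (- fst x, 0)" by (simp_all add: prod_eq_iff)
  then show ?case by (metis funpow_0)
next
  case (Suc i)
  show ?case
  proof (cases "snd x = 0")
    case True
    then have "x = (fst x, 0)" "- x = (- fst x, 0)" by (simp_all add: prod_eq_iff)
    then show ?thesis by (metis funpow_0)
  next
    case False
    then have p: "0 < snd x" using Suc.prems by simp
    have 1: "step (doubled s) x = step s x" "step (doubled s) (- x) = - step s x"
      using p by (simp_all add: step_def doubled_def dir_opp)
    have "0 \<le> snd (step s x)" using p dir_snd [of "s x"] by (auto simp: step_snd)
    moreover have "snd ((step s ^^ i) (step s x)) = 0" using Suc.prems by (simp add: funpow_swap1)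
    ultimately obtain j k j' k' where "(step (doubled s) ^^ j) (step s x) = (k,0)" "(step (doubled s) ^^ j') (- step s x) = (k',0)"
      using Suc.IH by blast
    then have "(step (doubled s) ^^ Suc j) x = (k,0)" "(step (doubled s) ^^ Suc j') (- x) = (k',0)"
      using 1 by (simp_all add: funpow_swap1)
    then show ?thesis by blast
  qed
qed

lemma doubled_conn:
  assumes "drains s" shows "conn (doubled s)"
proof -
  have "\<exists>j k. (step (doubled s) ^^ j) x = (k,0)" for x
  proof (cases "0 \<le> snd x")
    case True then show ?thesis using doubled_drains_aux [where x = x and s = s] assms unfolding drains_def by blast
  next
    case False
    then have "0 \<le> snd (- x)" by simp
    then obtain i where "snd ((step s ^^ i) (- x)) = 0" using assms unfolding drains_def by blast
    then show ?thesis using doubled_drains_aux [OF \<open>0 \<le> snd (- x)\<close>] by simp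
  qed
  then have l: "\<exists>k. link (doubled s) x (k,0)" for x using link_steps by metis
  have r: "link (doubled s) (k,0) (l,0)" if "k \<le> l" for k l
    using link_steps [of "doubled s" "(k,0)" "nat (l - k)"] that by (simp add: doubled_row_orbit)
  have "link (doubled s) (k,0) (l,0)" for k l using r [of k l] r [of l k] link_sym by (cases "k \<le> l") auto
  then show ?thesis unfolding conn_def using l link_sym link_trans by metis
qed

lemma row_parity:
  assumes s: "valid s" and row: "\<And>k. s (k,0) mod 3 = 0"
  shows "s (k + 2 * m, 1) mod 3 = s (k, 1) mod 3"
proof -
  have 1: "s (k + 2, 1) mod 3 = s (k, 1) mod 3" for k
    using row_flip(1) [OF s row row, of k] row_flip(1) [OF s row row, of "k + 1"] by (simp add: add.assoc)
  have 2: "s (k + 2 * int n, 1) mod 3 = s (k, 1) mod 3" for k n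
  proof (induction n)
    case (Suc n) then show ?case using 1 [of "k + 2 * int n"] by (simp add: algebra_simps)
  qed simp
  show ?thesis using 2 [of k "nat m"] 2 [of "k + 2 * m" "nat (- m)"] by (cases "0 \<le> m") auto
qed

text \<open>
  A mixed site of the double would lie on a constant line, which has to be the boundary row. There,
  whether the corner triangle is small depends on the parity of the position alone, and the half
  turn preserves parity.
\<close>

lemma doubled_not_mixed:
  assumes s: "valid s" and row: "\<And>k. s (k,0) mod 3 = 0" and "drains s"
  shows "\<not> mixed (doubled s) x"
proof
  assume m: "mixed (doubled s) x"
  have v: "valid (doubled s)" "conn (doubled s)" using doubled_valid doubled_conn assms by blast+
  have r: "ray (doubled s) x (doubled s x)" using mixed_constant_line [OF v m] constant_line_ray by blast
  have r0: "ray (doubled s) (0,0) 0" by (simp add: ray_def doubled_def)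
  have l: "link (doubled s) x (0,0)" using v unfolding conn_def by blast
  have c: "doubled s x mod 6 = 0 mod 6" using rays_not_link [OF r r0] l by blast
  obtain i j where "(step (doubled s) ^^ i) x = (step (doubled s) ^^ j) (0,0)" using l unfolding link_def by blast
  then have "snd x = 0" unfolding ray_orbit [OF r] ray_orbit [OF r0] using dir_cong [OF c] by (simp add: prod_eq_iff)
  then obtain a where x: "x = (a,0)" by (metis prod.collapse)
  have "doubled s (a,1) mod 3 \<noteq> doubled s (a,-1) mod 3"
    using m mixed_colour [of "doubled s" x 0] unfolding x by (simp add: doubled_def)
  then show False using row_parity [OF s row, of a "- a"] by (simp add: doubled_def)
qed

text \<open>
  Deflating the double gives a map with the same properties on its upper half; only the upper half of
  the conclusion is transferred back, so the lower one may be shifted against it at every level.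
\<close>

lemma half_plane_hier:
  assumes "valid s" "\<And>k. s (k,0) mod 3 = 0" "drains s"
  shows "\<exists>c. hier {x. 0 \<le> snd x} n (c,0) s"
  using assms
proof (induction n arbitrary: s)
  case 0 then show ?case by (simp add: hier_def)
next
  case (Suc n)
  let ?t = "doubled s"
  have v: "valid ?t" "conn ?t" using doubled_valid doubled_conn Suc.prems by blast+
  obtain c where c: "\<And>x. axial ?t (c + scl 2 x)" using level_one [OF v(1)] doubled_not_mixed Suc.prems by blast
  have "even (snd c)"
  proof (rule ccontr)
    assume "odd (snd c)"
    then have "snd (c + scl 2 (0, - ((snd c + 1) div 2))) = -1" by (simp, presburger)
    then have "?t (c + scl 2 (0, - ((snd c + 1) div 2)) + dir 1) = 0" by (simp add: doubled_def)
    then show False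
      using c [of "(0, - ((snd c + 1) div 2))", unfolded axial_def, rule_format, of 1] by simp
  qed
  then have c0: "c = (fst c, 0) + scl 2 (0, snd c div 2)" by (simp add: prod_eq_iff)
  have c': "axial ?t ((fst c, 0) + scl 2 x)" for x
  proof -
    have "(fst c, 0) + scl 2 x = c + scl 2 (x - (0, snd c div 2))"
      by (subst c0) (simp add: scl_diff scl_add algebra_simps)
    then show ?thesis using c by metis
  qed
  let ?u = "deflate ?t (fst c, 0)"
  have u: "valid ?u" "conn ?u" using deflate_valid deflate_conn c' v by blast+
  have u0: "?u (k,0) = 0" for k by (simp add: deflate_def doubled_def)
  have uo: "(step ?u ^^ j) (0,0) = (int j, 0)" for j by (induction j) (simp_all add: step_def u0)
  have "drains ?u" unfolding drains_def
  proof (intro allI impI)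
    fix x
    obtain i j where "(step ?u ^^ i) x = (step ?u ^^ j) (0,0)" using u unfolding conn_def link_def by blast
    then show "\<exists>i. snd ((step ?u ^^ i) x) = 0" unfolding uo by (metis snd_conv)
  qed
  then obtain a where a: "hier {x. 0 \<le> snd x} n (a,0) ?u" using Suc.IH u u0 by (metis mod_0)
  have "hier {x. 0 \<le> snd x} (Suc n) ((fst c, 0) + scl 2 (a,0)) ?t"
    by (rule hier_Suc [OF c' a]) simp
  moreover have "s x mod 3 = ?t x mod 3" if "0 \<le> snd x" for x
    using that Suc.prems(2) [of "fst x"] prod.collapse [of x] by (cases "snd x = 0") (auto simp: doubled_def)
  ultimately have "hier {x. 0 \<le> snd x} (Suc n) (fst c + 2 * a, 0) s" unfolding hier_def by simp
  then show ?case by blast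
qed

definition halves :: "(site \<Rightarrow> int) \<Rightarrow> bool" where
  "halves v \<longleftrightarrow> (\<forall>k. v (k,0) mod 3 = 0) \<and> (\<forall>n. \<exists>c. hier {x. 0 \<le> snd x} n (c,0) v) \<and>
     (\<forall>n. \<exists>c. hier {x. 0 \<le> snd x} n (c,0) (view v 0 3))"

lemma conn_drains:
  assumes "conn s" and row: "\<And>k. s (k,0) mod 3 = 0" shows "drains s"
proof -
  have o: "snd ((step s ^^ j) (0,0)) = 0" for j
  proof (induction j)
    case (Suc j)
    then obtain k where "(step s ^^ j) (0,0) = (k,0)" by (metis prod.collapse)
    then show ?case using row [of k] dir_snd_0 [of "s (k,0)"] by (simp add: step_snd)
  qed simp
  show ?thesis unfolding drains_def
  proof (intro allI impI)
    fix x
    obtain i j where "(step s ^^ i) x = (step s ^^ j) (0,0)" using assms unfolding conn_def link_def by blast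
    then show "\<exists>i. snd ((step s ^^ i) x) = 0" using o by metis
  qed
qed

theorem connected_structure:
  assumes "valid s" "conn s"
  shows "(\<forall>n. \<exists>c. hier UNIV n c s) \<or> (\<exists>p d. halves (view s p d))"
proof (cases "\<exists>x. constant_line s x")
  case False then show ?thesis using hier_of_no_line assms by blast
next
  case True
  then obtain x where x: "constant_line s x" by blast
  let ?v = "view s x (s x)"
  have row: "?v (k,0) mod 3 = 0" for k
  proof -
    have "rot (s x) (k,0) = scl k (dir (s x))" by (simp add: rot_def)
    then have "?v (k,0) mod 6 = 0" using x sub_mod6_iff [of _ "s x" 0] by (simp add: view_def constant_line_def)
    then show ?thesis by (rule mod3_of_mod6)
  qed
  let ?w = "view ?v 0 3"
  have row': "?w (k,0) mod 3 = 0" for k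
  proof -
    have "?w (k,0) = ?v (-k,0) - 3" by (simp add: view_def [of ?v] rot_def zero_prod_def)
    then show ?thesis using row [of "-k"] by (simp add: mod_eq_0_iff_dvd)
  qed
  have v: "valid ?v" "conn ?v" "valid ?w" "conn ?w" using assms valid_view conn_view by blast+
  have "halves ?v" unfolding halves_def
    using row half_plane_hier [OF v(1) row conn_drains [OF v(2) row]]
      half_plane_hier [OF v(3) row' conn_drains [OF v(4) row']] by blast
  then show ?thesis by blast
qed

section \<open>Flow towards coarse sites\<close>

text \<open>
  The distance from the origin in the lattice graph; its balls are hexagons.
\<close>

definition hexnorm :: "site \<Rightarrow> int" where
  "hexnorm x = max (max \<bar>fst x\<bar> \<bar>snd x\<bar>) \<bar>fst x + snd x\<bar>"
definition hexball :: "site \<Rightarrow> int \<Rightarrow> site set" where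
  "hexball q R = {x. hexnorm (x - q) \<le> R}"

lemma hexnorm_le: "hexnorm x \<le> R \<longleftrightarrow> \<bar>fst x\<bar> \<le> R \<and> \<bar>snd x\<bar> \<le> R \<and> \<bar>fst x + snd x\<bar> \<le> R"
  by (auto simp: hexnorm_def)

lemma in_hexball: "x \<in> hexball q R \<longleftrightarrow> \<bar>fst x - fst q\<bar> \<le> R \<and> \<bar>snd x - snd q\<bar> \<le> R \<and>
    \<bar>fst x - fst q + (snd x - snd q)\<bar> \<le> R"
  by (simp add: hexball_def hexnorm_le)

lemma hexnorm_minus [simp]: "hexnorm (- x) = hexnorm x"
  by (auto simp: hexnorm_def max_def)

lemma hexnorm_triangle: "hexnorm (x + y) \<le> hexnorm x + hexnorm y"
proof -
  have "\<bar>fst x\<bar> \<le> hexnorm x \<and> \<bar>snd x\<bar> \<le> hexnorm x \<and> \<bar>fst x + snd x\<bar> \<le> hexnorm x"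
    "\<bar>fst y\<bar> \<le> hexnorm y \<and> \<bar>snd y\<bar> \<le> hexnorm y \<and> \<bar>fst y + snd y\<bar> \<le> hexnorm y"
    using hexnorm_le by blast+
  then show ?thesis unfolding hexnorm_le fst_add snd_add by linarith
qed

lemma hexnorm_nonneg: "0 \<le> hexnorm x" by (simp add: hexnorm_def)

lemma hexnorm_rot1: "hexnorm (rot 1 x) = hexnorm x"
proof -
  have "dir (1 + 1) = (-1,1)" by simp
  then have "rot 1 x = (- snd x, fst x + snd x)" by (simp add: rot_def prod_eq_iff)
  then show ?thesis by (simp add: hexnorm_def max.assoc max.commute max.left_commute)
qed

lemma hexnorm_rot: "hexnorm (rot d x) = hexnorm x"
proof -
  have n: "hexnorm (rot (int n) x) = hexnorm x" for n
  proof (induction n)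
    case (Suc n)
    have "rot (int (Suc n)) x = rot 1 (rot (int n) x)" by (simp add: rot_rot)
    then show ?case using Suc hexnorm_rot1 by simp
  qed simp
  have "rot d x = rot (d mod 6) x"
    unfolding rot_def using dir_cong [of "d + 1" "d mod 6 + 1"] by (simp add: mod_add_left_eq)
  then show ?thesis using n [of "nat (d mod 6)"] by simp
qed

lemma hexnorm_dir: "hexnorm (dir d) = 1"
  by (cases d rule: mod6_cases) (simp_all add: dir_def hexnorm_def)

definition segclosed :: "site set \<Rightarrow> bool" where
  "segclosed E \<longleftrightarrow> (\<forall>a u m i. a \<in> E \<longrightarrow> a + scl m u \<in> E \<longrightarrow> 0 \<le> i \<longrightarrow> i \<le> m \<longrightarrow> a + scl i u \<in> E)"

lemma between_mult:
  fixes i m b :: int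
  assumes "0 \<le> i" "i \<le> m" shows "(0 \<le> i * b \<and> i * b \<le> m * b) \<or> (m * b \<le> i * b \<and> i * b \<le> 0)"
  using assms by (cases "0 \<le> b") (auto simp: mult_right_mono mult_right_mono_neg mult_nonneg_nonneg mult_nonneg_nonpos)

lemma abs_between:
  fixes i m a b :: int
  assumes "0 \<le> i" "i \<le> m" "\<bar>a\<bar> \<le> R" "\<bar>a + m * b\<bar> \<le> R" shows "\<bar>a + i * b\<bar> \<le> R"
  using between_mult [OF assms(1,2), of b] assms(3,4) by linarith

lemma segclosed_hexball: "segclosed (hexball q R)"
  unfolding segclosed_def in_hexball
proof (intro allI impI)
  fix a u :: "site" and m i :: int
  assume h: "\<bar>fst a - fst q\<bar> \<le> R \<and> \<bar>snd a - snd q\<bar> \<le> R \<and> \<bar>fst a - fst q + (snd a - snd q)\<bar> \<le> R"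
    "\<bar>fst (a + scl m u) - fst q\<bar> \<le> R \<and> \<bar>snd (a + scl m u) - snd q\<bar> \<le> R \<and> \<bar>fst (a + scl m u) - fst q + (snd (a + scl m u) - snd q)\<bar> \<le> R"
    and i: "0 \<le> i" "i \<le> m"
  have e: "fst (a + scl k u) - fst q = fst a - fst q + k * fst u"
    "snd (a + scl k u) - snd q = snd a - snd q + k * snd u"
    "fst a - fst q + k * fst u + (snd a - snd q + k * snd u) = fst a - fst q + (snd a - snd q) + k * (fst u + snd u)" for k
    by (simp_all add: algebra_simps)
  show "\<bar>fst (a + scl i u) - fst q\<bar> \<le> R \<and> \<bar>snd (a + scl i u) - snd q\<bar> \<le> R \<and> \<bar>fst (a + scl i u) - fst q + (snd (a + scl i u) - snd q)\<bar> \<le> R"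
    using h unfolding e by (auto intro: abs_between [OF i])
qed

lemma segclosed_half: "segclosed {x. 0 \<le> snd x}"
  unfolding segclosed_def
proof (intro allI impI)
  fix a u :: "site" and m i :: int
  assume "a \<in> {x. 0 \<le> snd x}" "a + scl m u \<in> {x. 0 \<le> snd x}" and i: "0 \<le> i" "i \<le> m"
  then show "a + scl i u \<in> {x. 0 \<le> snd x}" using between_mult [OF i, of "snd u"] by auto
qed

lemma segclosed_UNIV: "segclosed UNIV" by (simp add: segclosed_def)
lemma segclosed_Int: "segclosed A \<Longrightarrow> segclosed B \<Longrightarrow> segclosed (A \<inter> B)"
  unfolding segclosed_def by blast

lemma odd_part:
  fixes i :: nat assumes "0 < i" shows "\<exists>j l. i = 2 ^ j * (2 * l + 1)"
  using assms
proof (induction i rule: less_induct)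
  case (less i)
  show ?case
  proof (cases "even i")
    case True
    then obtain k where k: "i = 2 * k" by blast
    then obtain j l where "k = 2 ^ j * (2 * l + 1)" using less by force
    then have "i = 2 ^ Suc j * (2 * l + 1)" using k by simp
    then show ?thesis by blast
  next
    case False
    then obtain l where "i = 2 ^ 0 * (2 * l + 1)" by (auto elim: oddE)
    then show ?thesis by blast
  qed
qed

text \<open>
  The site at distance \<open>i\<close> from a level \<open>n\<close> site has the level given by the power of 2 in \<open>i\<close>.
\<close>

lemma hier_segment:
  assumes h: "hier E n c s" and x: "x = c + scl (2 ^ n) z" and i: "0 < i" "i < 2 ^ n"
    and E: "x + scl (int i) (dir d) \<in> E"
  shows "s (x + scl (int i) (dir d)) mod 3 = d mod 3"
proof -
  obtain j l where jl: "i = 2 ^ j * (2 * l + 1)" using odd_part i by blast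
  have "2 ^ j * 1 \<le> i" unfolding jl by (rule mult_left_mono) auto
  then have "(2::nat) ^ j < 2 ^ n" using i by linarith
  then have j: "j < n" by simp
  then obtain k where k: "n = Suc j + k" using less_imp_Suc_add by auto
  have e: "x + scl (int i) (dir d) = c + scl (2 ^ j) (dir d) + scl (2 ^ Suc j) (scl (int l) (dir d) + scl (2 ^ k) z)"
    unfolding x k jl by (simp add: prod_eq_iff algebra_simps power_add)
  show ?thesis using h j E unfolding hier_def e by blast
qed

lemma odd_dir: "\<not> (even (fst z) \<and> even (snd z)) \<Longrightarrow> \<exists>e z'. z = dir e + scl 2 z'"
proof -
  assume "\<not> (even (fst z) \<and> even (snd z))"
  then consider "odd (fst z)" "even (snd z)" | "even (fst z)" "odd (snd z)" | "odd (fst z)" "odd (snd z)" by blast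
  then show ?thesis
  proof cases
    case 1
    then have "z = dir 0 + scl 2 (fst z div 2, snd z div 2)" by (simp add: prod_eq_iff, presburger)
    then show ?thesis by blast
  next
    case 2
    then have "z = dir 1 + scl 2 (fst z div 2, snd z div 2)" by (simp add: prod_eq_iff, presburger)
    then show ?thesis by blast
  next
    case 3
    then have "z = dir 2 + scl 2 (fst z div 2 + 1, snd z div 2)" by (simp add: prod_eq_iff, presburger)
    then show ?thesis by blast
  qed
qed

text \<open>
  Used to keep the ends of a coarse edge in every coarse hexagon that contains its midpoint: an odd
  coordinate misses an even bound by at least 1.
\<close>

lemma odd_shift:
  fixes a b M N w :: int
  assumes "\<bar>M * a\<bar> \<le> M * (2 * N)" "0 < M" "a = b + 2 * w" "\<bar>b\<bar> \<le> 1" "\<bar>b'\<bar> = \<bar>b\<bar>"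
  shows "\<bar>M * a + M * b'\<bar> \<le> M * (2 * N)"
proof -
  have "M * \<bar>a\<bar> \<le> M * (2 * N)" using assms(1,2) by (simp add: abs_mult)
  then have a: "\<bar>a\<bar> \<le> 2 * N" using assms(2) by simp
  have "\<bar>a + b'\<bar> \<le> 2 * N"
  proof (cases "b = 0")
    case True then show ?thesis using a assms(5) by simp
  next
    case False
    then have "b = 1 \<or> b = -1" using assms(4) by auto
    then have "odd a" using assms(3) by auto
    then have "\<bar>a\<bar> \<noteq> 2 * N" by (metis abs_if dvd_triv_left even_minus)
    then show ?thesis using a assms(4,5) by auto
  qed
  then have "M * \<bar>a + b'\<bar> \<le> M * (2 * N)" using assms(2) by simp
  then show ?thesis using assms(2) by (simp add: abs_mult distrib_left [symmetric])
qed

lemma dir_pm: assumes "d mod 3 = e mod 3" shows "dir d = dir e \<or> dir d = - dir e"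
proof -
  have "(d - e) mod 3 = 0" using assms by (simp add: mod_eq_dvd_iff mod_0_imp_dvd)
  then have "d mod 6 = e mod 6 \<or> d mod 6 = (e + 3) mod 6"
    using mod6_of_mod3(1) [of "d - e"] sub_mod6_iff [of d e 0] sub_mod6_iff [of d e 3] by auto
  then show ?thesis using dir_cong [of d e] dir_cong [of d "e + 3"] dir_opp by auto
qed

text \<open>
  A site of level \<open>m\<close> is the midpoint of an edge of \<open>c + 2\<^sup>m\<^sup>+\<^sup>1 L\<close>, and its orbit runs straight to one
  of the ends because the sites in between are coloured by that direction. A level \<open>n\<close> hexagon is a
  union of triangles of all finer levels, so it contains with the midpoint the edge;
  the same holds for the half plane bounded by a lattice row.
\<close>

lemma flow_to_coarse:
  assumes v: "valid s" and h: "hier E n c s" and p: "p = c + scl (2 ^ n) w"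
    and H: "H = UNIV \<or> (H = {x. 0 \<le> snd x} \<and> snd c = 0)" and sub: "hexball p (2 ^ n) \<inter> H \<subseteq> E"
  shows "k \<le> n \<Longrightarrow> x = c + scl (2 ^ (n - k)) z \<Longrightarrow> x \<in> hexball p (2 ^ n) \<inter> H \<Longrightarrow>
    \<exists>y z. y = c + scl (2 ^ n) z \<and> y \<in> hexball p (2 ^ n) \<inter> H \<and> link s x y"
proof (induction k arbitrary: x z)
  case 0 then show ?case by (metis diff_zero link_refl)
next
  case (Suc k)
  \<comment> \<open>The site has level at least \<open>m\<close>; if exactly \<open>m\<close>, one run of length \<open>2\<^sup>m\<close> raises the level.\<close>
  define m where "m = n - Suc k"
  have mn: "m < n" "Suc m = n - k" using Suc.prems(1) by (auto simp: m_def)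
  obtain l where l: "n = Suc m + l" using mn(1) less_imp_Suc_add by auto
  have x: "x = c + scl (2 ^ m) z" using Suc.prems(2) by (simp add: m_def)
  show ?case
  proof (cases "even (fst z) \<and> even (snd z)")
    case True
    then obtain z' where "z = scl 2 z'" by (auto elim!: evenE) (metis prod.collapse scl_simps(1))
    then have "x = c + scl (2 ^ (n - k)) z'" unfolding x mn(2) [symmetric] by (simp add: scl_scl mult.commute)
    then show ?thesis using Suc by simp
  next
    case False
    then obtain e z' where z: "z = dir e + scl 2 z'" using odd_dir by blast
    define d where "d = s x"
    have "x = c + scl (2 ^ m) (dir e) + scl (2 ^ Suc m) z'"
      unfolding x z by (simp add: scl_add scl_scl add.assoc mult.commute)
    then have de: "d mod 3 = e mod 3" using h mn(1) sub Suc.prems(3) unfolding hier_def d_def by blast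
    note pm = dir_pm [OF de]
    define y where "y = x + scl (2 ^ m) (dir d)"
    have "y = c + scl (2 ^ Suc m) (if dir d = dir e then z' + dir e else z')"
    proof (cases "dir d = dir e")
      case True then show ?thesis unfolding y_def x z by (simp add: prod_eq_iff algebra_simps)
    next
      case False
      then have "dir d = - dir e" using pm by blast
      then show ?thesis unfolding y_def x z using False by (simp add: prod_eq_iff algebra_simps)
    qed
    then obtain z'' where yz: "y = c + scl (2 ^ (n - k)) z''" unfolding mn(2) by blast
    have b: "\<bar>fst (dir e)\<bar> \<le> 1" "\<bar>snd (dir e)\<bar> \<le> 1" "\<bar>fst (dir e) + snd (dir e)\<bar> \<le> 1"
      using hexnorm_dir [of e] hexnorm_le [of "dir e" 1] by auto
    have b': "\<bar>fst (dir d)\<bar> = \<bar>fst (dir e)\<bar>" "\<bar>snd (dir d)\<bar> = \<bar>snd (dir e)\<bar>"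
      "\<bar>fst (dir d) + snd (dir d)\<bar> = \<bar>fst (dir e) + snd (dir e)\<bar>" using pm by auto
    have yhb: "y \<in> hexball p (2 ^ n)"
    proof -
      let ?M = "2 ^ m :: int" and ?N = "2 ^ l :: int"
      have xp: "fst x - fst p = ?M * (fst (dir e) + 2 * (fst z' - ?N * fst w))"
        "snd x - snd p = ?M * (snd (dir e) + 2 * (snd z' - ?N * snd w))"
        unfolding x p z l by (simp_all add: algebra_simps power_add)
      have xs: "fst x - fst p + (snd x - snd p) = ?M * ((fst (dir e) + snd (dir e)) + 2 * (fst z' - ?N * fst w + (snd z' - ?N * snd w)))"
        unfolding xp by (simp add: algebra_simps)
      have P: "(2::int) ^ n = ?M * (2 * ?N)" unfolding l by (simp add: power_add)
      have hx: "\<bar>fst x - fst p\<bar> \<le> 2 ^ n" "\<bar>snd x - snd p\<bar> \<le> 2 ^ n" "\<bar>fst x - fst p + (snd x - snd p)\<bar> \<le> 2 ^ n"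
        using Suc.prems(3) by (auto simp: in_hexball)
      have 1: "\<bar>fst x - fst p + ?M * fst (dir d)\<bar> \<le> 2 ^ n"
        using hx(1) unfolding xp P by (rule odd_shift [OF _ _ refl b(1) b'(1)]) simp
      have 2: "\<bar>snd x - snd p + ?M * snd (dir d)\<bar> \<le> 2 ^ n"
        using hx(2) unfolding xp P by (rule odd_shift [OF _ _ refl b(2) b'(2)]) simp
      have 3: "\<bar>fst x - fst p + (snd x - snd p) + ?M * (fst (dir d) + snd (dir d))\<bar> \<le> 2 ^ n"
        using hx(3) unfolding xs P by (rule odd_shift [OF _ _ refl b(3) b'(3)]) simp
      show ?thesis unfolding in_hexball y_def using 1 2 3 by (simp add: algebra_simps)
    qed
    have yH: "y \<in> H"
    proof (cases "H = UNIV")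
      case False
      then have H': "H = {x. 0 \<le> snd x}" "snd c = 0" using H by auto
      have "0 \<le> 2 ^ m * snd z" using Suc.prems(3) H' x by auto
      then have "0 \<le> snd z" by (simp add: zero_le_mult_iff)
      moreover have "snd z = snd (dir e) + 2 * snd z'" using z by simp
      ultimately have "0 \<le> snd z + snd (dir d)" using b(2) b'(2) by presburger
      then have "0 \<le> 2 ^ m * (snd z + snd (dir d))" by simp
      then show ?thesis unfolding H' y_def x by (simp add: H' distrib_left)
    qed simp
    have sc: "segclosed (hexball p (2 ^ n) \<inter> H)"
      using segclosed_Int segclosed_hexball segclosed_half segclosed_UNIV H by metis
    have h': "hier E m c s" using h mn(1) unfolding hier_def by auto
    have "s (x + scl (int i) (dir d)) mod 3 = d mod 3" if i: "0 < i" "i < 2 ^ m" for i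
    proof (rule hier_segment [OF h' x i])
      have "int i \<le> 2 ^ m" using i(2) by (simp add: order_less_imp_le)
      then show "x + scl (int i) (dir d) \<in> E"
        using sc [unfolded segclosed_def, rule_format, of x "2 ^ m" "dir d" "int i"] Suc.prems(3) yhb yH sub
        unfolding y_def by auto
    qed
    then have "link s x y" using straight_link [OF v, of "2 ^ m" x d] unfolding y_def d_def by simp
    then show ?thesis using Suc.IH [OF _ yz] Suc.prems(1) yhb yH link_trans by (metis IntI Suc_leD)
  qed
qed

section \<open>At most three classes\<close>

text \<open>
  At scale \<open>m\<close> the two ends of a straight run behave like neighbours: R1 relates them, and they are
  linked as soon as one of them heads for the other.
\<close>

lemma edge_facts:
  assumes v: "valid s" and m: "0 < m" and st: "\<And>i. 0 < i \<Longrightarrow> i < m \<Longrightarrow> s (x + scl (int i) (dir d)) mod 3 = d mod 3"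
    and y: "y = x + scl (int m) (dir d)"
  shows "out (d - s x) = inn (d - s y)" "s x mod 6 = d mod 6 \<Longrightarrow> link s x y"
    "s y mod 6 = (d + 3) mod 6 \<Longrightarrow> link s x y"
proof -
  show "out (d - s x) = inn (d - s y)" unfolding y by (rule straight_edge [OF v m st])
  show "s x mod 6 = d mod 6 \<Longrightarrow> link s x y" unfolding y by (rule straight_link [OF v m st])
  assume sy: "s y mod 6 = (d + 3) mod 6"
  have "link s y (y + scl (int m) (dir (d + 3)))"
  proof (rule straight_link [OF v m _ sy])
    fix i assume i: "0 < i" "i < m"
    have "y + scl (int i) (dir (d + 3)) = x + scl (int (m - i)) (dir d)"
      using i unfolding y by (simp add: dir_opp scl_minus scl_diff_left of_nat_diff)
    then show "s (y + scl (int i) (dir (d + 3))) mod 3 = (d + 3) mod 3" using st [of "m - i"] i by simp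
  qed
  moreover have "y + scl (int m) (dir (d + 3)) = x" unfolding y by (simp add: dir_opp scl_minus)
  ultimately show "link s x y" using link_sym by metis
qed

lemma hier_mono: "hier E n c s \<Longrightarrow> E' \<subseteq> E \<Longrightarrow> n' \<le> n \<Longrightarrow> hier E' n' c s"
  unfolding hier_def by (meson order_less_le_trans subsetD)

lemma value_near: assumes "a mod 3 = g mod 3" "inn (g - a) \<or> out (g - a)" shows "a mod 6 = g mod (6::int)"
proof -
  have "(g - a) mod 3 = 0" using assms(1) col_0_iff [of a g] by metis
  then have "(g - a) mod 6 = 0" using assms(2) inn_straight [of "g - a"] col_cases(3) [of "g - a"] by metis
  then show ?thesis using mod6_0_iff [of a g] by metis
qed

lemma value_far: assumes "a mod 3 = g mod 3" "\<not> inn (g - a) \<or> \<not> out (g - a)" shows "a mod 6 = (g + 3) mod (6::int)"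
proof -
  have c: "(g - a) mod 3 = 0" using assms(1) col_0_iff [of a g] by metis
  have "(g - a) mod 6 \<noteq> 0" using assms(2) by (auto simp: inn_def out_def)
  then have "(g - a) mod 6 = 3" using mod6_of_mod3(1) [OF c] by blast
  then have "g mod 6 = (a + 3) mod 6" using sub_mod6_iff [of g a 3] by simp
  then have "(g + 3) mod 6 = (a + 3 + 3) mod 6" by (rule mod_add_cong) simp
  then show ?thesis by simp
qed

lemma out_value: "a mod 6 = b mod 6 \<Longrightarrow> out (g - a) = out (g - b)"
  by (rule out_cong) (rule mod_diff_cong, simp_all)
lemma inn_value: "a mod 6 = b mod 6 \<Longrightarrow> inn (g - a) = inn (g - b)"
  by (rule inn_cong) (rule mod_diff_cong, simp_all)

lemma coarse_edge:
  assumes v: "valid s" and h: "hier E n c s" and E: "segclosed E" "x \<in> E" "y \<in> E"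
    and x: "x = c + scl (2 ^ n) z" and y: "y = x + scl (2 ^ n) (dir d)"
  shows "out (d - s x) = inn (d - s y)" "s x mod 6 = d mod 6 \<Longrightarrow> link s x y"
    "s y mod 6 = (d + 3) mod 6 \<Longrightarrow> link s x y"
proof -
  have st: "s (x + scl (int i) (dir d)) mod 3 = d mod 3" if i: "0 < i" "i < 2 ^ n" for i
  proof (rule hier_segment [OF h x i])
    have "int i \<le> 2 ^ n" using i(2) by (simp add: order_less_imp_le)
    then show "x + scl (int i) (dir d) \<in> E"
      using E y unfolding segclosed_def by (metis of_nat_0_le_iff)
  qed
  have y': "y = x + scl (int (2 ^ n)) (dir d)" using y by simp
  note e = edge_facts [OF v _ st y']
  show "out (d - s x) = inn (d - s y)" "s x mod 6 = d mod 6 \<Longrightarrow> link s x y"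
    "s y mod 6 = (d + 3) mod 6 \<Longrightarrow> link s x y" using e by simp_all
qed

text \<open>
  The worst point of a triangle of side \<open>M\<close> is its centroid.
\<close>

lemma coarse_near:
  assumes "0 < (M::int)" shows "\<exists>z. 3 * hexnorm (q - (c + scl M z)) \<le> 2 * M"
proof -
  define A where "A = fst q - fst c"
  define B where "B = snd q - snd c"
  define a where "a = A mod M"
  define b where "b = B mod M"
  have ab: "0 \<le> a" "a < M" "0 \<le> b" "b < M" using assms by (auto simp: a_def b_def)
  have e: "q - (c + scl M (A div M + i, B div M + j)) = (a - M * i, b - M * j)" for i j
    unfolding a_def b_def by (simp add: prod_eq_iff A_def B_def algebra_simps minus_div_mult_eq_mod [symmetric])
  have bd: "hexnorm (x, y) \<le> R \<Longrightarrow> 3 * R \<le> 2 * M \<Longrightarrow> 3 * hexnorm (x, y) \<le> 2 * M" for x y R by linarith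
  have c1: "3 * (a + b) \<le> 2 * M" if "\<not> 3 * (M - a) \<le> 2 * M" "\<not> 3 * (M - b) \<le> 2 * M"
    using that assms by (simp add: algebra_simps)
  have c2: "3 * (2 * M - a - b) \<le> 2 * M" if "\<not> 3 * a \<le> 2 * M" "\<not> 3 * b \<le> 2 * M"
    using that assms by (simp add: algebra_simps)
  have "a + b \<le> M \<or> M \<le> a + b" by (rule linear)
  then consider "3 * (a + b) \<le> 2 * M" | "a + b \<le> M" "3 * (M - a) \<le> 2 * M" | "a + b \<le> M" "3 * (M - b) \<le> 2 * M"
    | "M \<le> a + b" "3 * (2 * M - a - b) \<le> 2 * M" | "M \<le> a + b" "3 * b \<le> 2 * M" | "M \<le> a + b" "3 * a \<le> 2 * M"
    using c1 c2 by blast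
  then have "\<exists>i j. 3 * hexnorm (a - M * i, b - M * j) \<le> 2 * M"
  proof cases
    case 1
    have "hexnorm (a - M * 0, b - M * 0) \<le> a + b" using ab by (simp add: hexnorm_le)
    then show ?thesis using 1 bd by blast
  next
    case 2
    have "hexnorm (a - M * 1, b - M * 0) \<le> M - a" using ab 2 by (simp add: hexnorm_le)
    then show ?thesis using 2 bd by blast
  next
    case 3
    have "hexnorm (a - M * 0, b - M * 1) \<le> M - b" using ab 3 by (simp add: hexnorm_le)
    then show ?thesis using 3 bd by blast
  next
    case 4
    have "hexnorm (a - M * 1, b - M * 1) \<le> 2 * M - a - b" using ab 4 by (simp add: hexnorm_le)
    then show ?thesis using 4 bd by blast
  next
    case 5
    have "hexnorm (a - M * 1, b - M * 0) \<le> b" using ab 5 by (simp add: hexnorm_le)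
    then show ?thesis using 5 bd by blast
  next
    case 6
    have "hexnorm (a - M * 0, b - M * 1) \<le> a" using ab 6 by (simp add: hexnorm_le)
    then show ?thesis using 6 bd by blast
  qed
  then show ?thesis unfolding e [symmetric] by blast
qed

lemma hexball_mono: "hexnorm (q - p) + r \<le> R \<Longrightarrow> hexball q r \<subseteq> hexball p R"
proof
  fix x assume "hexnorm (q - p) + r \<le> R" "x \<in> hexball q r"
  moreover have "hexnorm (x - p) \<le> hexnorm (x - q) + hexnorm (q - p)" using hexnorm_triangle [of "x - q" "q - p"] by simp
  ultimately show "x \<in> hexball p R" unfolding hexball_def by simp
qed

lemma hexnorm_le_1: "hexnorm z \<le> 1 \<Longrightarrow> z = 0 \<or> (\<exists>d. z = dir d)"
proof -
  assume "hexnorm z \<le> 1"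
  then have h: "\<bar>fst z\<bar> \<le> 1" "\<bar>snd z\<bar> \<le> 1" "\<bar>fst z + snd z\<bar> \<le> 1" by (auto simp: hexnorm_le)
  obtain i j where z: "z = (i,j)" by fastforce
  have "(i = 0 \<and> j = 0) \<or> (i = 1 \<and> j = 0) \<or> (i = 0 \<and> j = 1) \<or> (i = -1 \<and> j = 1) \<or> (i = -1 \<and> j = 0) \<or> (i = 0 \<and> j = -1) \<or> (i = 1 \<and> j = -1)"
  proof -
    have "i = -1 \<or> i = 0 \<or> i = 1" "j = -1 \<or> j = 0 \<or> j = 1" "\<bar>i + j\<bar> \<le> 1" using h unfolding z by auto
    then show ?thesis by (elim disjE) simp_all
  qed
  then consider "z = 0" | "z = dir 0" | "z = dir 1" | "z = dir 2" | "z = dir 3" | "z = dir 4" | "z = dir 5"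
    unfolding z by (simp add: zero_prod_def) blast
  then show ?thesis by cases blast+
qed

lemma coarse_in_hexball:
  assumes "p = c + scl M w" "y = c + scl M z" "y \<in> hexball p M" "0 < M"
  shows "y = p \<or> (\<exists>d. y = p + scl M (dir d))"
proof -
  have "hexnorm (z - w) \<le> 1"
  proof -
    have e: "fst y - fst p = M * (fst z - fst w)" "snd y - snd p = M * (snd z - snd w)"
      unfolding assms(1,2) by (simp_all add: algebra_simps)
    have "\<bar>a\<bar> \<le> 1" if "\<bar>M * a\<bar> \<le> M" for a
    proof -
      have "M * \<bar>a\<bar> \<le> M * 1" using that assms(4) by (simp add: abs_mult)
      then show ?thesis using assms(4) by (simp only: mult_le_cancel_left_pos)
    qed
    then show ?thesis using assms(3) unfolding in_hexball e distrib_left [symmetric] by (simp add: hexnorm_le)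
  qed
  then have "z = w \<or> (\<exists>d. z - w = dir d)" using hexnorm_le_1 by fastforce
  moreover have "y = p + scl M (z - w)" unfolding assms(1,2) by (simp add: scl_diff)
  ultimately show ?thesis by auto
qed

lemma scl_dir_hexball: "0 \<le> M \<Longrightarrow> p + scl M (dir d) \<in> hexball p M"
  by (cases d rule: mod6_cases) (simp_all add: in_hexball dir_def)

lemma hexball_center: "0 \<le> M \<Longrightarrow> p \<in> hexball p M" by (simp add: in_hexball)

definition three_classes :: "(site \<Rightarrow> int) \<Rightarrow> site set \<Rightarrow> bool" where
  "three_classes s F \<longleftrightarrow> (\<exists>r1 r2 r3. \<forall>x\<in>F. link s x r1 \<or> link s x r2 \<or> link s x r3)"

text \<open>
  If \<open>p\<close> survives to the next level, its six neighbours are coloured by direction and R1 links to \<open>p\<close>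
  all but the two on one axis. Otherwise \<open>p\<close>, heading say in direction 0, is the midpoint of a
  coarse edge. Four of its neighbours have forced colours, and R1 links each end of the edge, whatever
  its heading, to two of the three sites of the star next to it; four links among seven sites leave at
  most three classes.
\<close>

lemma star_three_classes:
  assumes v: "valid s" and h: "hier E (Suc n) c s" and p: "p = c + scl (2 ^ n) w" and E: "hexball p (2 ^ n) \<subseteq> E"
  shows "three_classes s ({p} \<union> {p + scl (2 ^ n) (dir d) | d. True})"
proof -
  let ?M = "2 ^ n :: int"
  let ?q = "\<lambda>d. p + scl ?M (dir d)"
  have h': "hier (hexball p ?M) n c s" "hier (hexball p ?M) (Suc n) c s" using hier_mono [OF h E] by auto
  have q: "?q d \<in> hexball p ?M" for d by (rule scl_dir_hexball) simp
  have p': "p \<in> hexball p ?M" by (rule hexball_center) simp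
  have qc: "?q d = c + scl ?M (w + dir d)" for d unfolding p by (simp add: scl_add)
  have cls: "s (c + scl ?M (dir e + scl 2 z)) mod 3 = e mod 3" if "c + scl ?M (dir e + scl 2 z) \<in> hexball p ?M" for e z
  proof -
    have "c + scl ?M (dir e + scl 2 z) = c + scl (2 ^ n) (dir e) + scl (2 ^ Suc n) z"
      by (simp add: scl_add scl_scl mult.commute)
    then show ?thesis using h'(2) that unfolding hier_def by (metis lessI)
  qed
  have ce: "out (d - s x) = inn (d - s y)" "s x mod 6 = d mod 6 \<Longrightarrow> link s x y"
    "s y mod 6 = (d + 3) mod 6 \<Longrightarrow> link s x y"
    if "x \<in> hexball p ?M" "y \<in> hexball p ?M" "x = c + scl ?M z" "y = x + scl ?M (dir d)" for x y z d
    using coarse_edge [OF v h'(1) segclosed_hexball that] by auto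
  show ?thesis
  proof (cases "even (fst w) \<and> even (snd w)")
    case True
    then obtain w' where w: "w = scl 2 w'" by (auto elim!: evenE) (metis prod.collapse scl_simps(1))
    have col: "s (?q d) mod 3 = d mod 3" for d
      using cls [of d w'] q [of d] unfolding qc w by (simp add: add.commute)
    have l: "link s (?q d) p" if "(d - s p) mod 3 \<noteq> 1" for d
    proof -
      note e = ce [OF p' q p refl, of d]
      show ?thesis
      proof (cases "(d - s p) mod 6 = 0")
        case True
        then show ?thesis using e(2) mod6_0_iff [of "s p" d] link_sym by metis
      next
        case False
        have "\<not> out (d - s p)"
        proof (cases "(d - s p) mod 3 = 0")
          case True
          then have "(d - s p) mod 6 = 3" using False mod6_of_mod3(1) [OF True] by blast
          then show ?thesis by (simp add: out_def)
        next
          case False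
          then have "(d - s p) mod 3 = 2" using that colour_12 [of "d - s p"] by blast
          then show ?thesis using col_cases(2) by blast
        qed
        then have "s (?q d) mod 6 = (d + 3) mod 6" using e(1) value_far [OF col [of d]] by blast
        then show ?thesis using e(3) link_sym by blast
      qed
    qed
    have ex: "dir d = dir (s p + 1) \<or> dir d = dir (s p + 4)" if "(d - s p) mod 3 = 1" for d
    proof -
      have "d mod 6 = (s p + 1) mod 6 \<or> d mod 6 = (s p + 4) mod 6"
        using mod6_of_mod3(2) [OF that] sub_mod6_iff [of d "s p" 1] sub_mod6_iff [of d "s p" 4] by auto
      then show ?thesis using dir_cong [of d "s p + 1"] dir_cong [of d "s p + 4"] by blast
    qed
    have "link s y p \<or> link s y (?q (s p + 1)) \<or> link s y (?q (s p + 4))"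
      if yq: "y \<in> {p} \<union> {?q d | d. True}" for y
    proof -
      consider "y = p" | d where "y = ?q d" using yq by blast
      then show ?thesis
      proof cases
        case 1 then show ?thesis by simp
      next
        case 2
        show ?thesis
        proof (cases "(d - s p) mod 3 = 1")
          case True then show ?thesis using ex [of d] 2 by auto
        next
          case False then show ?thesis using l 2 by blast
        qed
      qed
    qed
    then show ?thesis unfolding three_classes_def by blast
  next
    case False
    then obtain e w' where w: "w = dir e + scl 2 w'" using odd_dir by blast
    have sp: "s p mod 3 = e mod 3" using cls [of e w'] p' unfolding p w by simp
    define d where "d = s p"
    have de: "dir d = dir e \<or> dir d = - dir e" using dir_pm sp unfolding d_def by blast
    have col: "s (?q f) mod 3 = g mod 3" if "dir d + dir f = dir g + scl 2 u" for f g u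
    proof -
      obtain u' where u': "dir e = dir d + scl 2 u'"
        using de by (metis add.inverse_inverse add.right_neutral add_uminus_conv_diff diff_add_cancel scl_add_left scl_simps(3) scl_simps(5) one_add_one minus_add_cancel)
      have "w + dir f = dir g + scl 2 (u + u' + w')"
        using that unfolding w u' by (simp add: scl_add algebra_simps)
      then show ?thesis using cls [of g "u + u' + w'"] q [of f] unfolding qc by simp
    qed
    define t where "t f = s (?q (d + f)) - d" for f
    have dt: "dir (d + 2) = dir (d + 1) - dir d" "dir (d + 4) = - dir (d + 1)" "dir (d + 5) = dir d - dir (d + 1)" "dir (d + 3) = - dir d"
      using dir_turn [of d] dir_opp [of d] dir_opp [of "d+1"] dir_opp [of "d+2"] by (simp_all add: algebra_simps)
    have s2: "scl 2 u = u + u" for u by (simp add: prod_eq_iff)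
    have c1: "t 1 mod 3 = 2" using col [of "d + 1" "d + 2" "dir d"] sub_mod3_iff [of "s (?q (d + 1))" d 2]
      by (simp add: t_def dt s2)
    have c2: "t 2 mod 3 = 1" using col [of "d + 2" "d + 1" 0] sub_mod3_iff [of "s (?q (d + 2))" d 1]
      by (simp add: t_def dt)
    have c4: "t 4 mod 3 = 2" using col [of "d + 4" "d + 2" "dir d - dir (d + 1)"] sub_mod3_iff [of "s (?q (d + 4))" d 2]
      by (simp add: t_def dt s2)
    have c5: "t 5 mod 3 = 1" using col [of "d + 5" "d + 1" "dir d - dir (d + 1)"] sub_mod3_iff [of "s (?q (d + 5))" d 1]
      by (simp add: t_def dt s2)
    have ed: "out (g - t f) = inn (g - t f')" "t f mod 6 = g mod 6 \<Longrightarrow> link s (?q (d + f)) (?q (d + f'))"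
      "t f' mod 6 = (g + 3) mod 6 \<Longrightarrow> link s (?q (d + f)) (?q (d + f'))"
      if "dir (d + f') = dir (d + f) + dir (d + g)" for f f' g
    proof -
      have y: "?q (d + f') = ?q (d + f) + scl ?M (dir (d + g))" using that by (simp add: scl_add add.assoc)
      note e = ce [OF q q qc y]
      show "out (g - t f) = inn (g - t f')" using e(1) by (simp add: t_def algebra_simps)
      show "t f mod 6 = g mod 6 \<Longrightarrow> link s (?q (d + f)) (?q (d + f'))"
        using e(2) by (simp add: t_def sub_mod6_iff)
      show "t f' mod 6 = (g + 3) mod 6 \<Longrightarrow> link s (?q (d + f)) (?q (d + f'))"
        using e(3) by (simp add: t_def sub_mod6_iff add.assoc)
    qed
    have lp0: "link s p (?q (d + 0))" using ce(2) [OF p' q p refl, of d] by (simp add: d_def)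
    have o0: "inn (- t 0)"
    proof -
      have "out 0 = inn (d - s (?q d))" using ce(1) [OF p' q p refl, of d] by (simp add: d_def)
      then show ?thesis by (simp add: t_def)
    qed
    have o3: "\<not> inn (3 - t 3)"
    proof -
      have "out 3 = inn (d + 3 - s (?q (d + 3)))" using ce(1) [OF p' q p refl, of "d + 3"] by (simp add: d_def)
      then show ?thesis by (simp add: t_def algebra_simps)
    qed
    have t0: "t 0 mod 6 = 0 \<or> t 0 mod 6 = 1 \<or> t 0 mod 6 = 4"
      using o0 inn_value [of "t 0" "t 0 mod 6" 0] by (cases "t 0" rule: mod6_cases) auto
    have t3: "t 3 mod 6 = 0 \<or> t 3 mod 6 = 2 \<or> t 3 mod 6 = 5"
      using o3 inn_value [of "t 3" "t 3 mod 6" 3] by (cases "t 3" rule: mod6_cases) auto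
    have A: "link s (?q (d + 0)) (?q (d + 1)) \<or> link s (?q (d + 0)) (?q (d + 5))"
      using t0
    proof (elim disjE)
      assume "t 0 mod 6 = 0"
      then have "\<not> out (2 - t 0)" using out_value [of "t 0" 0 2] by simp
      moreover have g: "dir (d + 1) = dir (d + 0) + dir (d + 2)" using dt by simp
      ultimately have "t 1 mod 6 = (2 + 3) mod 6" using ed(1) [OF g] value_far [of "t 1" 2] c1 by simp
      then show ?thesis using ed(3) [OF g] by blast
    next
      assume "t 0 mod 6 = 4"
      moreover have "dir (d + 5) = dir (d + 0) + dir (d + 4)" using dt by simp
      ultimately show ?thesis using ed(2) [of 5 0 4] by simp
    next
      assume "t 0 mod 6 = 1"
      then have "inn (1 - t 0)" using inn_value [of "t 0" 1 1] by simp
      moreover have g: "dir (d + 0) = dir (d + 5) + dir (d + 1)" using dt by simp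
      ultimately have "t 5 mod 6 = 1 mod 6" using ed(1) [OF g] value_near [of "t 5" 1] c5 by simp
      then show ?thesis using ed(2) [OF g] link_sym by blast
    qed
    have g: "dir (d + 4) = dir (d + 3) + dir (d + 5)" using dt by simp
    have B: "link s (?q (d + 3)) (?q (d + 4))"
    proof (cases "t 3 mod 6 = 5")
      case True then show ?thesis using ed(2) [OF g] by simp
    next
      case False
      then have "\<not> out (5 - t 3)" using t3 out_value [of "t 3" 0 5] out_value [of "t 3" 2 5] by auto
      then have "t 4 mod 6 = (5 + 3) mod 6" using ed(1) [OF g] value_far [of "t 4" 5] c4 by simp
      then show ?thesis using ed(3) [OF g] by blast
    qed
    have C: "link s p (?q (d + 3)) \<or> link s (?q (d + 3)) (?q (d + 2))"
    proof (cases "t 3 mod 6 = 0")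
      case True
      then have "s (?q (d + 3)) mod 6 = (d + 3 + 3) mod 6" using sub_mod6_iff [of "s (?q (d + 3))" d 0] by (simp add: t_def)
      then show ?thesis using ce(3) [OF p' q p refl] by blast
    next
      case False
      have g: "dir (d + 2) = dir (d + 3) + dir (d + 1)" using dt by simp
      have "\<not> out (1 - t 3)" using False t3 out_value [of "t 3" 2 1] out_value [of "t 3" 5 1] by auto
      then have "t 2 mod 6 = (1 + 3) mod 6" using ed(1) [OF g] value_far [of "t 2" 1] c2 by simp
      then show ?thesis using ed(3) [OF g] by blast
    qed
    \<comment> \<open>Representatives besides \<open>p\<close>: what the front end leaves over, and the class at the rear.\<close>
    define r2 where "r2 = (if link s (?q (d + 0)) (?q (d + 1)) then ?q (d + 5) else ?q (d + 1))"
    define r3 where "r3 = (if link s p (?q (d + 3)) then ?q (d + 2) else ?q (d + 3))"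
    have all: "link s (?q (d + g)) p \<or> link s (?q (d + g)) r2 \<or> link s (?q (d + g)) r3"
      if "g \<in> {0,1,2,3,4,5}" for g
    proof -
      have 0: "link s (?q (d + 0)) p" using lp0 link_sym by blast
      have 15: "(link s (?q (d + 1)) p \<or> ?q (d + 1) = r2) \<and> (link s (?q (d + 5)) p \<or> ?q (d + 5) = r2)"
      proof (cases "link s (?q (d + 0)) (?q (d + 1))")
        case True
        from link_trans [OF link_sym [OF True] 0] show ?thesis unfolding r2_def using True by simp
      next
        case False
        then have "link s (?q (d + 0)) (?q (d + 5))" using A by blast
        from link_trans [OF link_sym [OF this] 0] show ?thesis unfolding r2_def using False by simp
      qed
      have 3: "link s (?q (d + 3)) p \<or> ?q (d + 3) = r3"
        unfolding r3_def using link_sym [of s p "?q (d + 3)"] by auto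
      have 2: "link s (?q (d + 2)) r3"
        unfolding r3_def using C link_sym [of s "?q (d + 3)" "?q (d + 2)"] by auto
      have 4: "link s (?q (d + 4)) p \<or> link s (?q (d + 4)) r3"
        using 3
      proof
        assume "link s (?q (d + 3)) p" from link_trans [OF link_sym [OF B] this] show ?thesis ..
      next
        assume "?q (d + 3) = r3" then show ?thesis using link_sym [OF B] by simp
      qed
      show ?thesis using that 0 15 2 3 4 link_refl [of s] by auto
    qed
    have "link s y p \<or> link s y r2 \<or> link s y r3" if yq: "y \<in> {p} \<union> {?q d | d. True}" for y
    proof -
      consider "y = p" | f where "y = ?q f" using yq by blast
      then show ?thesis
      proof cases
        case 1 then show ?thesis by simp
      next
        case 2
        have m: "(f - d) mod 6 \<in> {0,1,2,3,4,5}" by (cases "f - d" rule: mod6_cases) auto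
        have "(d + (f - d) mod 6) mod 6 = f mod 6" by (simp add: mod_add_right_eq)
        then have "?q f = ?q (d + (f - d) mod 6)" using dir_cong by metis
        then show ?thesis using all [OF m] 2 by simp
      qed
    qed
    then show ?thesis unfolding three_classes_def by blast
  qed
qed

lemma three_classes_subset: "three_classes s F \<Longrightarrow> F' \<subseteq> F \<Longrightarrow> three_classes s F'"
  unfolding three_classes_def by (meson subsetD)

lemma three_classes_via:
  assumes "three_classes s F" "\<And>x. x \<in> F' \<Longrightarrow> \<exists>y\<in>F. link s x y" shows "three_classes s F'"
proof -
  obtain r1 r2 r3 where r: "\<And>x. x \<in> F \<Longrightarrow> link s x r1 \<or> link s x r2 \<or> link s x r3"
    using assms(1) unfolding three_classes_def by blast
  have "link s x r1 \<or> link s x r2 \<or> link s x r3" if x: "x \<in> F'" for x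
  proof -
    obtain y where y: "y \<in> F" "link s x y" using assms(2) x by blast
    from r [OF y(1)] link_trans [OF y(2)] show ?thesis by blast
  qed
  then show ?thesis unfolding three_classes_def by blast
qed

lemma hexagon_three_classes:
  assumes v: "valid s" and h: "hier E (Suc n) c s" and p: "p = c + scl (2 ^ n) w" and E: "hexball p (2 ^ n) \<subseteq> E"
  shows "three_classes s (hexball p (2 ^ n))"
proof (rule three_classes_via [OF star_three_classes [OF v h p E]])
  fix x assume x: "x \<in> hexball p (2 ^ n)"
  have h': "hier E n c s" using hier_mono [OF h] by simp
  have "x = c + scl (2 ^ (n - n)) (x - c)" by simp
  then obtain y z where y: "y = c + scl (2 ^ n) z" "y \<in> hexball p (2 ^ n)" "link s x y"
    using flow_to_coarse [OF v h' p, of UNIV n x "x - c"] E x by auto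
  have "y \<in> {p} \<union> {p + scl (2 ^ n) (dir d) | d. True}" using coarse_in_hexball [OF p y(1,2)] by auto
  then show "\<exists>y\<in>{p} \<union> {p + scl (2 ^ n) (dir d) | d. True}. link s x y" using y(3) by blast
qed

definition rowlinked :: "(site \<Rightarrow> int) \<Rightarrow> site set \<Rightarrow> site \<Rightarrow> bool" where
  "rowlinked s E x \<longleftrightarrow> (\<exists>k. (k,0) \<in> E \<and> link s x (k,0))"

lemma rowlinked_trans: "link s x y \<Longrightarrow> rowlinked s E y \<Longrightarrow> rowlinked s E x"
  unfolding rowlinked_def using link_trans by blast

text \<open>
  Of the two level \<open>n\<close> sites of the half hexagon that are off the boundary row one has colour 2, and
  R1 against the boundary colour 0 forces it to head down to the row.
\<close>

lemma half_hexagon: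
  assumes v: "valid s" and h: "hier E n (c0,0) s" and p: "p = (c0,0) + scl (2 ^ n) w" and p0: "snd p = 0"
    and E: "hexball p (2 ^ n) \<inter> {x. 0 \<le> snd x} \<subseteq> E"
    and row: "\<And>k. (k,0) \<in> E \<Longrightarrow> s (k,0) mod 3 = 0"
  shows "\<exists>o'. \<forall>x\<in>hexball p (2 ^ n). 0 \<le> snd x \<longrightarrow> rowlinked s E x \<or> link s x o'"
proof -
  let ?M = "2 ^ n :: int"
  let ?H = "{x :: site. 0 \<le> snd x}"
  let ?q = "\<lambda>d. p + scl ?M (dir d)"
  have h': "hier (hexball p ?M \<inter> ?H) n (c0,0) s" using hier_mono [OF h E] by simp
  have sc: "segclosed (hexball p ?M \<inter> ?H)" by (intro segclosed_Int segclosed_hexball segclosed_half)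
  have q: "?q d \<in> hexball p ?M \<inter> ?H" if "d \<in> {0,1,2,3}" for d
  proof -
    have "?q d \<in> hexball p ?M" by (rule scl_dir_hexball) simp
    moreover have "0 \<le> snd (?q d)" using that p0 by auto
    ultimately show ?thesis by simp
  qed
  have p': "p \<in> hexball p ?M \<inter> ?H" using hexball_center [of ?M p] p0 by simp
  have qc: "?q d = (c0,0) + scl ?M (w + dir d)" for d unfolding p by (simp add: scl_add)
  have rp: "x = (fst x, 0)" if "snd x = 0" for x :: "site" using that by (simp add: prod_eq_iff)
  have rowl: "rowlinked s E x" if "x \<in> hexball p ?M" "snd x = 0" for x
    unfolding rowlinked_def using that rp [OF that(2)] E by (metis (mono_tags, lifting) Int_iff link_refl mem_Collect_eq order_refl subsetD)
  have col0: "s x mod 3 = 0" if "x \<in> hexball p ?M" "snd x = 0" for x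
    using that rp [OF that(2)] E row [of "fst x"] by auto
  note ce = coarse_edge [OF v h' sc]
  have e1: "out (1 - s p) = inn (1 - s (?q 1))" using ce(1) [OF p' q p refl] by simp
  have e2: "out (2 - s p) = inn (2 - s (?q 2))" using ce(1) [OF p' q p refl] by simp
  have y21: "?q 1 = ?q 2 + scl ?M (dir 0)" by (simp add: prod_eq_iff)
  have e21: "out (0 - s (?q 2)) = inn (0 - s (?q 1))" using ce(1) [OF q q qc y21] by simp
  have cp: "s p mod 3 = 0" using col0 p' p0 by blast
  have k: "(g - a) mod 3 = (g - b) mod 3" if "a mod 3 = b mod 3" for g a b :: int
    by (rule mod_diff_cong) (use that in simp_all)
  have c1: "s (?q 1) mod 3 \<noteq> 0"
  proof
    assume "s (?q 1) mod 3 = 0"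
    then have "(1 - s (?q 1)) mod 3 = 1" "(1 - s p) mod 3 = 1"
      using k [of "s (?q 1)" 0 1] k [of "s p" 0 1] cp by simp_all
    then show False using e1 col_cases(1) by blast
  qed
  have c2: "s (?q 2) mod 3 \<noteq> 0"
  proof
    assume "s (?q 2) mod 3 = 0"
    then have "(2 - s (?q 2)) mod 3 = 2" "(2 - s p) mod 3 = 2"
      using k [of "s (?q 2)" 0 2] k [of "s p" 0 2] cp by simp_all
    then show False using e2 col_cases(2) by blast
  qed
  have "s (?q 1) mod 3 = 2 \<or> s (?q 2) mod 3 = 2"
  proof (rule ccontr)
    assume "\<not> (s (?q 1) mod 3 = 2 \<or> s (?q 2) mod 3 = 2)"
    then have "s (?q 1) mod 3 = 1" "s (?q 2) mod 3 = 1" using c1 c2 colour_12 by blast+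
    then have "(0 - s (?q 2)) mod 3 = 2" "(0 - s (?q 1)) mod 3 = 2"
      using k [of "s (?q 2)" 1 0] k [of "s (?q 1)" 1 0] by simp_all
    then show False using e21 col_cases(2) by blast
  qed
  moreover have down: "rowlinked s E x" if x: "x \<in> hexball p ?M \<inter> ?H" "x = (c0,0) + scl ?M z" "s x mod 3 = 2"
    and y: "y \<in> hexball p ?M" "snd y = 0" "y = x + scl ?M (dir 5)" for x y z
  proof -
    have y': "y \<in> hexball p ?M \<inter> ?H" using y by simp
    have "(5 - s y) mod 3 = 2" using col0 [OF y(1,2)] k [of "s y" 0 5] by simp
    then have "inn (5 - s y)" using col_cases(2) by blast
    then have "out (5 - s x)" using ce(1) [OF x(1) y' x(2) y(3)] by simp
    then have "s x mod 6 = 5 mod 6" using value_near [of "s x" 5] x(3) by simp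
    then have "link s x y" using ce(2) [OF x(1) y' x(2) y(3)] by simp
    then show ?thesis using rowlinked_trans rowl y by blast
  qed
  have d1: "rowlinked s E (?q 1)" if "s (?q 1) mod 3 = 2"
    by (rule down [OF q qc that, of "?q 0"]) (use q [of 0] p0 in \<open>auto simp: prod_eq_iff\<close>)
  have d2: "rowlinked s E (?q 2)" if "s (?q 2) mod 3 = 2"
    by (rule down [OF q qc that, of p]) (use p' p0 in \<open>auto simp: prod_eq_iff\<close>)
  ultimately have rq: "rowlinked s E (?q 1) \<or> rowlinked s E (?q 2)" using d1 d2 by blast
  define o' where "o' = (if rowlinked s E (?q 1) then ?q 2 else ?q 1)"
  have "rowlinked s E x \<or> link s x o'" if x: "x \<in> hexball p ?M" "0 \<le> snd x" for x
  proof -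
    have e: "x = (c0,0) + scl (2 ^ (n - n)) (x - (c0,0))" by simp
    obtain y z where y: "y = (c0,0) + scl ?M z" "y \<in> hexball p ?M \<inter> ?H" "link s x y"
      using flow_to_coarse [OF v h p _ E _ e] x by auto
    have "y = p \<or> (\<exists>d. y = ?q d)" using coarse_in_hexball [OF p y(1)] y(2) by simp
    then have "snd y = 0 \<or> y = ?q 1 \<or> y = ?q 2"
    proof
      assume "\<exists>d. y = ?q d"
      then obtain d where d: "y = ?q d" by blast
      have "0 \<le> ?M * snd (dir d)" using y(2) p0 unfolding d by simp
      then have "0 \<le> snd (dir d)" by (simp add: zero_le_mult_iff)
      then have "snd (dir d) = 0 \<or> dir d = dir 1 \<or> dir d = dir 2" 
        by (cases d rule: mod6_cases) (simp_all add: dir_def)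
      then show ?thesis using p0 unfolding d by auto
    qed (use p0 in simp)
    moreover have "snd y = 0 \<Longrightarrow> rowlinked s E y" using rowl y(2) by blast
    ultimately have "rowlinked s E y \<or> y = o'" unfolding o'_def using rq by metis
    then show ?thesis using y(3) rowlinked_trans by blast
  qed
  then show ?thesis by blast
qed

text \<open>
  A level \<open>n\<close> hexagon covering the ball has its centre above, on or below the boundary row; in the
  first case it lies in the half plane, in the last the part of the ball above is on the row.
\<close>

lemma half_cover:
  assumes v: "valid s" and h: "hier E (Suc n) (c0,0) s" and r: "3 * \<rho> \<le> 2 ^ n"
    and E: "hexball q (2 * 2 ^ n) \<inter> {x. 0 \<le> snd x} \<subseteq> E"
    and row: "\<And>k. (k,0) \<in> E \<Longrightarrow> s (k,0) mod 3 = 0" and r0: "0 \<le> \<rho>"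
  shows "three_classes s (hexball q \<rho>) \<or> (\<exists>o'. \<forall>x\<in>hexball q \<rho>. 0 \<le> snd x \<longrightarrow> rowlinked s E x \<or> link s x o')"
proof -
  let ?M = "2 ^ n :: int"
  have M: "0 < ?M" by simp
  from coarse_near [OF M, of q "(c0,0)"] obtain w where w: "3 * hexnorm (q - ((c0,0) + scl ?M w)) \<le> 2 * ?M" by blast
  define p where "p = (c0,0) + scl ?M w"
  have qp: "hexnorm (q - p) + \<rho> \<le> ?M" using w r unfolding p_def by simp
  have sub: "hexball q \<rho> \<subseteq> hexball p ?M" by (rule hexball_mono [OF qp])
  have "hexnorm (p - q) = hexnorm (q - p)" using hexnorm_minus [of "q - p"] by simp
  then have sub2: "hexball p ?M \<subseteq> hexball q (2 * ?M)" using qp r0 by (intro hexball_mono) linarith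
  have sp: "snd p = ?M * snd w" by (simp add: p_def)
  consider "0 < snd w" | "snd w = 0" | "snd w < 0" by linarith
  then show ?thesis
  proof cases
    case 1
    then have "?M * 1 \<le> ?M * snd w" by (intro mult_left_mono) auto
    then have "?M \<le> snd p" unfolding sp by simp
    then have "hexball p ?M \<subseteq> {x. 0 \<le> snd x}" unfolding in_hexball subset_iff by auto
    then have "hexball p ?M \<subseteq> E" using E sub2 by blast
    then show ?thesis using hexagon_three_classes [OF v h p_def] three_classes_subset sub by blast
  next
    case 2
    have h': "hier E n (c0,0) s" using hier_mono [OF h] by simp
    have "hexball p ?M \<inter> {x. 0 \<le> snd x} \<subseteq> E" using E sub2 by blast
    moreover have "snd p = 0" using 2 by (simp add: sp)
    ultimately show ?thesis using half_hexagon [OF v h' p_def _ _ row] sub by blast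
  next
    case 3
    then have "?M * snd w \<le> ?M * (-1)" by (intro mult_left_mono) auto
    then have pm: "snd p \<le> - ?M" unfolding sp by simp
    have "rowlinked s E x" if x: "x \<in> hexball q \<rho>" "0 \<le> snd x" for x
    proof -
      have "snd x \<le> snd p + ?M" using subsetD [OF sub x(1)] unfolding in_hexball by linarith
      then have "snd x = 0" using pm x(2) by simp
      then have "x = (fst x, 0)" by (simp add: prod_eq_iff)
      moreover have "x \<in> E" using E sub sub2 x by blast
      ultimately show ?thesis unfolding rowlinked_def by (metis link_refl)
    qed
    then show ?thesis by blast
  qed
qed

lemma row_links:
  assumes v: "valid s" and E: "segclosed E" and row: "\<And>k. (k,0) \<in> E \<Longrightarrow> s (k,0) mod 3 = 0"
    and kl: "(k,0) \<in> E" "(l,0) \<in> E"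
  shows "link s (k,0) (l,0)"
proof -
  have *: "link s (k,0) (l,0)" if kl: "(k,0) \<in> E" "(l,0) \<in> E" "k < l" for k l
  proof -
    have y: "(l,0) = (k,0) + scl (int (nat (l - k))) (dir 0)" using kl(3) by simp
    have st: "s ((k,0) + scl (int i) (dir 0)) mod 3 = 0 mod 3" if "0 < i" "i < nat (l - k)" for i
    proof -
      have "(k,0) + scl (l - k) (dir 0) \<in> E" using kl by simp
      then have "(k,0) + scl (int i) (dir 0) \<in> E"
        using E kl(1) that unfolding segclosed_def by (metis of_nat_0_le_iff less_imp_le zless_nat_eq_int_zless)
      then show ?thesis using row [of "k + int i"] by simp
    qed
    have m: "0 < nat (l - k)" using kl(3) by simp
    note e = edge_facts [OF v m st y]
    show ?thesis
    proof (cases "s (k,0) mod 6 = 0")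
      case True then show ?thesis using e(2) by simp
    next
      case False
      then have "s (k,0) mod 6 = 3" using mod6_of_mod3(1) [OF row [OF kl(1)]] by blast
      then have "\<not> out (0 - s (k,0))" using out_value [of "s (k,0)" 3 0] by simp
      then have "\<not> inn (0 - s (l,0))" using e(1) by simp
      then have "s (l,0) mod 6 = (0 + 3) mod 6" using value_far [of "s (l,0)" 0] row [OF kl(2)] by simp
      then show ?thesis using e(3) by simp
    qed
  qed
  show ?thesis using *[of k l] *[of l k] kl link_sym link_refl by (cases k l rule: linorder_cases) auto
qed

lemma hier_cong:
  assumes h: "hier F n c t" and e: "\<And>x. x \<in> E \<Longrightarrow> t x mod 3 = s x mod 3" shows "hier (E \<inter> F) n c s"
  unfolding hier_def
proof (intro allI impI)
  fix k d x assume k: "k < n" and x: "c + scl (2 ^ k) (dir d) + scl (2 ^ Suc k) x \<in> E \<inter> F"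
  then have "t (c + scl (2 ^ k) (dir d) + scl (2 ^ Suc k) x) mod 3 = d mod 3" using h unfolding hier_def by blast
  then show "s (c + scl (2 ^ k) (dir d) + scl (2 ^ Suc k) x) mod 3 = d mod 3" using e x by (metis IntD1)
qed

lemma rot_3: "rot 3 x = - x"
  by (simp add: rot_def prod_eq_iff)

text \<open>
  Either the ball is covered by a level \<open>n\<close> hexagon inside one of the closed half planes, or the part of
  the ball in each half plane flows to the boundary row and one further site, and the row is common
  to both.
\<close>

lemma halves_cover:
  assumes v: "valid s" and r0: "0 \<le> \<rho>" and r: "3 * \<rho> \<le> 2 ^ n" and R: "R = 2 * 2 ^ n"
    and t: "halves t" "\<And>x. x \<in> hexball q R \<Longrightarrow> t x mod 3 = s x mod 3"
  shows "three_classes s (hexball q \<rho>)"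
proof -
  let ?E = "hexball q R" and ?w = "view s 0 3" and ?t = "view t 0 3"
  have row: "s (k,0) mod 3 = 0" if "(k,0) \<in> ?E" for k
    using t(1) t(2) [OF that] unfolding halves_def by simp
  obtain c0 c1 where c: "hier {x. 0 \<le> snd x} (Suc n) (c0,0) t" "hier {x. 0 \<le> snd x} (Suc n) (c1,0) ?t"
    using t(1) unfolding halves_def by blast
  have h0: "hier (?E \<inter> {x. 0 \<le> snd x}) (Suc n) (c0,0) s" using hier_cong [OF c(1)] t(2) by blast
  have wx: "?w x = s (- x) - 3" "?t x = t (- x) - 3" for x by (simp_all add: view_def rot_3)
  have neg: "- x \<in> hexball q R \<longleftrightarrow> x \<in> hexball (- q) R" for x q R
  proof -
    have "- x - q = - (x - - q)" by simp
    then show ?thesis unfolding hexball_def mem_Collect_eq by (metis hexnorm_minus)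
  qed
  let ?F = "hexball (- q) R"
  have tw: "?t x mod 3 = ?w x mod 3" if "x \<in> ?F" for x
    using t(2) [of "- x"] that neg unfolding wx by (simp add: mod_eq_dvd_iff)
  have h1: "hier (?F \<inter> {x. 0 \<le> snd x}) (Suc n) (c1,0) ?w" using hier_cong [OF c(2)] tw by blast
  have row': "?w (k,0) mod 3 = 0" if "(k,0) \<in> ?F" for k
  proof -
    have "- (k,0) \<in> ?E" using neg that by blast
    then have "s (-k,0) mod 3 = 0" using row [of "-k"] by simp
    then show ?thesis unfolding wx by (simp add: mod_eq_0_iff_dvd)
  qed
  have vw: "valid ?w" using v valid_view by blast
  have lw: "link ?w x y \<longleftrightarrow> link s (- x) (- y)" for x y by (simp add: link_view rot_3)
  have U: "three_classes s (hexball q \<rho>) \<or> (\<exists>o'. \<forall>x\<in>hexball q \<rho>. 0 \<le> snd x \<longrightarrow> rowlinked s (?E \<inter> {x. 0 \<le> snd x}) x \<or> link s x o')"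
    by (rule half_cover [OF v h0 r]) (use R row r0 in auto)
  have D: "three_classes ?w (hexball (- q) \<rho>) \<or> (\<exists>o'. \<forall>x\<in>hexball (- q) \<rho>. 0 \<le> snd x \<longrightarrow> rowlinked ?w (?F \<inter> {x. 0 \<le> snd x}) x \<or> link ?w x o')"
    by (rule half_cover [OF vw h1 r]) (use R row' r0 in auto)
  have "three_classes s (hexball q \<rho>)" if "three_classes ?w (hexball (- q) \<rho>)"
  proof -
    obtain r1 r2 r3 where "\<And>x. x \<in> hexball (- q) \<rho> \<Longrightarrow> link s (- x) (- r1) \<or> link s (- x) (- r2) \<or> link s (- x) (- r3)"
      using \<open>three_classes ?w (hexball (- q) \<rho>)\<close> unfolding three_classes_def lw by blast
    then have "link s x (- r1) \<or> link s x (- r2) \<or> link s x (- r3)" if "x \<in> hexball q \<rho>" for x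
      using that neg [of "- x" q \<rho>] by fastforce
    then show ?thesis unfolding three_classes_def by blast
  qed
  moreover have "three_classes s (hexball q \<rho>)"
    if ha: "\<forall>x\<in>hexball q \<rho>. 0 \<le> snd x \<longrightarrow> rowlinked s (?E \<inter> {x. 0 \<le> snd x}) x \<or> link s x a"
      and hlow: "\<forall>x\<in>hexball (- q) \<rho>. 0 \<le> snd x \<longrightarrow> rowlinked ?w (?F \<inter> {x. 0 \<le> snd x}) x \<or> link ?w x b" for a b
  proof -
    define k0 where "k0 = (SOME k. (k,0) \<in> ?E)"
    have rl: "link s x (k0,0)" if "(k,0) \<in> ?E" "link s x (k,0)" for x k
    proof -
      have "(k0,0) \<in> ?E" unfolding k0_def using someI [of "\<lambda>k. (k,0) \<in> ?E"] that(1) by blast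
      then show ?thesis using row_links [OF v segclosed_hexball row that(1)] that(2) link_trans by blast
    qed
    have "link s x (k0,0) \<or> link s x a \<or> link s x (- b)" if x: "x \<in> hexball q \<rho>" for x
    proof (cases "0 \<le> snd x")
      case True
      then show ?thesis using ha x rl unfolding rowlinked_def by blast
    next
      case False
      then have x': "- x \<in> hexball (- q) \<rho>" "0 \<le> snd (- x)" using neg [of "- x" q \<rho>] x by auto
      then have "rowlinked ?w (?F \<inter> {x. 0 \<le> snd x}) (- x) \<or> link ?w (- x) b" using hlow by blast
      then show ?thesis
      proof
        assume "rowlinked ?w (?F \<inter> {x. 0 \<le> snd x}) (- x)"
        then obtain k where k: "(k,0) \<in> ?F" "link s x (- (k,0))" unfolding rowlinked_def lw by auto
        then have "(-k,0) \<in> ?E" "link s x (-k,0)" using neg [of "(k,0)" q R] by auto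
        then show ?thesis using rl by blast
      qed (simp add: lw)
    qed
    then show ?thesis unfolding three_classes_def by blast
  qed
  ultimately show ?thesis using U D by blast
qed

text \<open>
  The heading maps of the tilings in the hull: they agree on every ball with one that satisfies R2.
\<close>

definition local_limit :: "(site \<Rightarrow> int) \<Rightarrow> bool" where
  "local_limit s \<longleftrightarrow> valid s \<and> (\<forall>R. \<exists>t. valid t \<and> conn t \<and> (\<forall>x\<in>hexball 0 R. t x mod 6 = s x mod 6))"

lemma mod6_mod3: "a mod 6 = b mod 6 \<Longrightarrow> a mod 3 = b mod (3::int)"
proof -
  have "k mod 3 = (k mod 6) mod 3" for k :: int by (simp add: mod_mod_cancel)
  then show "a mod 6 = b mod 6 \<Longrightarrow> a mod 3 = b mod 3" by metis
qed

theorem local_limit_three_classes: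
  assumes "local_limit s" "0 \<le> \<rho>" shows "three_classes s (hexball 0 \<rho>)"
proof -
  have v: "valid s" using assms unfolding local_limit_def by blast
  obtain n where n: "nat (3 * \<rho>) < 2 ^ n" using less_exp by blast
  have r: "3 * \<rho> \<le> 2 ^ n"
  proof -
    have "int (nat (3 * \<rho>)) < int (2 ^ n)" using n by (simp only: of_nat_less_iff)
    then show ?thesis using assms(2) by simp
  qed
  define R :: int where "R = 2 * 2 ^ n"
  obtain t where t: "valid t" "conn t" and a: "\<And>x. x \<in> hexball 0 R \<Longrightarrow> t x mod 6 = s x mod 6"
    using assms unfolding local_limit_def by blast
  have a3: "t x mod 3 = s x mod 3" if "x \<in> hexball 0 R" for x using a [OF that] mod6_mod3 by blast
  from connected_structure [OF t] show ?thesis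
  proof
    assume "\<forall>n. \<exists>c. hier UNIV n c t"
    then obtain c where "hier UNIV (Suc n) c t" by blast
    then have h: "hier (hexball 0 R) (Suc n) c s" using hier_cong [of UNIV "Suc n" c t "hexball 0 R" s] a3 by simp
    obtain w where w: "3 * hexnorm (0 - (c + scl (2 ^ n) w)) \<le> 2 * 2 ^ n" 
      using coarse_near [of "2 ^ n" 0 c] zero_less_power [of "2::int" n] by auto
    define p where "p = c + scl (2 ^ n) w"
    have qp: "hexnorm (0 - p) + \<rho> \<le> 2 ^ n" using w r unfolding p_def by simp
    have "hexnorm (p - 0) + 2 ^ n \<le> R" using qp assms(2) by (simp add: R_def)
    then have "hexball p (2 ^ n) \<subseteq> hexball 0 R" by (rule hexball_mono)
    then show ?thesis using hexagon_three_classes [OF v h p_def] hexball_mono [OF qp] three_classes_subset by blast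
  next
    assume "\<exists>p d. halves (view t p d)"
    then obtain p d where h: "halves (view t p d)" by blast
    define q where "q = rot (- d) (- p)"
    have m: "p + rot d x \<in> hexball 0 r \<longleftrightarrow> x \<in> hexball q r" for x r
    proof -
      have "p + rot d x - 0 = rot d (x - q)" by (simp add: q_def rot_diff rot_inverse)
      then show ?thesis unfolding hexball_def mem_Collect_eq by (simp add: hexnorm_rot)
    qed
    have "three_classes (view s p d) (hexball q \<rho>)"
    proof (rule halves_cover [OF valid_view [OF v] assms(2) r R_def h])
      fix x assume "x \<in> hexball q R"
      then have "t (p + rot d x) mod 3 = s (p + rot d x) mod 3" using a3 m by blast
      then show "view t p d x mod 3 = view s p d x mod 3" by (simp add: view_def mod_eq_dvd_iff)
    qed
    then obtain r1 r2 r3 where r: "\<And>x. x \<in> hexball q \<rho> \<Longrightarrow> link s (p + rot d x) r1 \<or> link s (p + rot d x) r2 \<or> link s (p + rot d x) r3"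
      unfolding three_classes_def link_view by blast
    have "link s x r1 \<or> link s x r2 \<or> link s x r3" if "x \<in> hexball 0 \<rho>" for x
    proof -
      have e: "p + rot d (rot (- d) (x - p)) = x" by (simp add: rot_inverse)
      then have "rot (- d) (x - p) \<in> hexball q \<rho>" using m [of "rot (- d) (x - p)" \<rho>] that by simp
      then show ?thesis using r e by metis
    qed
    then show ?thesis unfolding three_classes_def by blast
  qed
qed

section \<open>Aperiodicity and infinite classes of local limits\<close>

lemma dyadic_decomposition:
  assumes "a \<noteq> (0 :: site)" shows "\<exists>k e z. a = scl (2 ^ k) (dir e + scl 2 z)"
  using assms
proof (induction "nat (\<bar>fst a\<bar> + \<bar>snd a\<bar>)" arbitrary: a rule: less_induct)
  case less
  show ?case
  proof (cases "even (fst a) \<and> even (snd a)")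
    case True
    then obtain i j where ij: "fst a = 2 * i" "snd a = 2 * j" by (auto elim!: evenE)
    have a: "a = scl 2 (i,j)" using ij by (simp add: prod_eq_iff)
    have nz: "(i,j) \<noteq> 0" using less.prems unfolding a by (auto simp: zero_prod_def)
    then have "i \<noteq> 0 \<or> j \<noteq> 0" by (simp add: zero_prod_def)
    then have "nat (\<bar>fst (i,j)\<bar> + \<bar>snd (i,j)\<bar>) < nat (\<bar>fst a\<bar> + \<bar>snd a\<bar>)" unfolding ij by auto
    then obtain k e z where "(i,j) = scl (2 ^ k) (dir e + scl 2 z)" using less.hyps nz by blast
    then have "a = scl (2 ^ Suc k) (dir e + scl 2 z)" unfolding a by (simp add: scl_scl)
    then show ?thesis by blast
  next
    case False
    then obtain e z where "a = dir e + scl 2 z" using odd_dir by blast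
    then have "a = scl (2 ^ 0) (dir e + scl 2 z)" by simp
    then show ?thesis by blast
  qed
qed

text \<open>
  A translation by \<open>2\<^sup>k\<close> times a vector outside \<open>2 L\<close> moves the sites of one class of level \<open>k\<close> to
  another class of that level.
\<close>

lemma hier_aperiodic:
  assumes h: "hier E (Suc k) c s" and a: "a = scl (2 ^ k) (dir e + scl 2 z)"
    and E: "hexball q (2 ^ Suc k + hexnorm a) \<subseteq> E"
  shows "\<exists>x\<in>E. x + a \<in> E \<and> s (x + a) mod 3 \<noteq> s x mod 3"
proof -
  let ?M = "2 ^ Suc k :: int"
  have M: "0 < ?M" by simp
  from coarse_near [OF M, of q "c + scl (2 ^ k) (dir (e + 1))"]
  obtain w where w: "3 * hexnorm (q - (c + scl (2 ^ k) (dir (e + 1)) + scl ?M w)) \<le> 2 * ?M" by blast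
  define y where "y = c + scl (2 ^ k) (dir (e + 1)) + scl ?M w"
  have "hexnorm (q - y) \<le> ?M" using w M unfolding y_def by linarith
  then have hy: "hexnorm (y - q) \<le> ?M" using hexnorm_minus [of "q - y"] by simp
  have yE: "y \<in> E" using E hy hexnorm_nonneg [of a] unfolding hexball_def by fastforce
  have "hexnorm (y + a - q) \<le> ?M + hexnorm a" using hexnorm_triangle [of "y - q" a] hy by (simp add: algebra_simps)
  then have yaE: "y + a \<in> E" using E unfolding hexball_def by blast
  have 1: "s y mod 3 = (e + 1) mod 3" using h yE unfolding hier_def y_def by blast
  have "dir (e + 1) + dir e = dir (e + 2) + scl 2 (dir e)" using dir_turn [of e] by (simp add: prod_eq_iff)
  then have "y + a = c + scl (2 ^ k) (dir (e + 2)) + scl ?M (dir e + z + w)"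
    unfolding y_def a by (simp add: prod_eq_iff algebra_simps)
  then have 2: "s (y + a) mod 3 = (e + 2) mod 3" using h yaE unfolding hier_def by (metis lessI)
  have "(e + 1) mod 3 \<noteq> (e + 2) mod 3" by (simp add: mod_eq_dvd_iff)
  then show ?thesis using yE yaE 1 2 by metis
qed

theorem local_limit_nonperiodic:
  assumes "local_limit s" "a \<noteq> 0" shows "\<exists>x. s (x + a) mod 6 \<noteq> s x mod 6"
proof (rule ccontr)
  assume "\<nexists>x. s (x + a) mod 6 \<noteq> s x mod 6"
  then have per: "s (x + a) mod 3 = s x mod 3" for x using mod6_mod3 by blast
  obtain k e z where a: "a = scl (2 ^ k) (dir e + scl 2 z)" using dyadic_decomposition assms(2) by blast
  define r where "r = 2 ^ Suc k + hexnorm a"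
  have r0: "0 \<le> r" unfolding r_def using hexnorm_nonneg [of a] by simp
  obtain t where t: "valid t" "conn t" and ts: "\<And>x. x \<in> hexball 0 (2 * r) \<Longrightarrow> t x mod 6 = s x mod 6"
    using assms(1) unfolding local_limit_def by blast
  have t3: "t x mod 3 = s x mod 3" if "x \<in> hexball 0 (2 * r)" for x using ts [OF that] mod6_mod3 by blast
  from connected_structure [OF t] show False
  proof
    assume "\<forall>n. \<exists>c. hier UNIV n c t"
    then obtain c where "hier UNIV (Suc k) c t" by blast
    then have h: "hier (hexball 0 (2 * r)) (Suc k) c s" using hier_cong [of UNIV "Suc k" c t "hexball 0 (2 * r)" s] t3 by simp
    have "hexball 0 r \<subseteq> hexball 0 (2 * r)" using r0 by (intro hexball_mono) (simp add: hexnorm_def)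
    then show False using hier_aperiodic [OF h a, of 0] per unfolding r_def by blast
  next
    assume "\<exists>p d. halves (view t p d)"
    then obtain p d where hv: "halves (view t p d)" by blast
    \<comment> \<open>one of the two half planes contains a large part of the ball\<close>
    have "\<exists>f c q. hier {x. 0 \<le> snd x} (Suc k) c (view t p f) \<and> hexball q r \<subseteq> {x. 0 \<le> snd x} \<and> (\<forall>x\<in>hexball q r. p + rot f x \<in> hexball 0 (2 * r))"
    proof -
      define q where "q f = rot (- f) (- p)" for f
      have g: "hexball (q f + (0,r)) r \<subseteq> {x. 0 \<le> snd x} \<and> (\<forall>x\<in>hexball (q f + (0,r)) r. p + rot f x \<in> hexball 0 (2 * r))"
        if "0 \<le> snd (q f)" for f
      proof -
        have "0 \<le> snd x" if "x \<in> hexball (q f + (0,r)) r" for x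
          using that \<open>0 \<le> snd (q f)\<close> by (auto simp: in_hexball)
        moreover have "p + rot f x \<in> hexball 0 (2 * r)" if "x \<in> hexball (q f + (0,r)) r" for x
        proof -
          have "hexnorm (x - q f) \<le> hexnorm (x - (q f + (0,r))) + hexnorm (0,r)"
            using hexnorm_triangle [of "x - (q f + (0,r))" "(0,r)"] by (simp add: algebra_simps)
          also have "\<dots> \<le> 2 * r" using that r0 by (simp add: hexball_def hexnorm_def)
          finally have "hexnorm (x - q f) \<le> 2 * r" .
          moreover have "p + rot f x - 0 = rot f (x - q f)" by (simp add: q_def rot_diff rot_inverse)
          ultimately show ?thesis unfolding hexball_def mem_Collect_eq by (simp add: hexnorm_rot)
        qed
        ultimately show ?thesis by (intro conjI subsetI ballI CollectI)
      qed
      obtain c0 c1 where c: "hier {x. 0 \<le> snd x} (Suc k) (c0,0) (view t p d)"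
        "hier {x. 0 \<le> snd x} (Suc k) (c1,0) (view (view t p d) 0 3)"
        using hv unfolding halves_def by blast
      have "q (d + 3) = - q d"
      proof -
        have "rot (- (d + 3)) (- p) = rot (- d) (rot (-3) (- p))" by (simp add: rot_rot algebra_simps)
        moreover have "rot (-3) x = - x" for x 
          using rot_3 [of "rot (-3) x"] rot_inverse(1) [of 3 x] by (metis minus_minus)
        ultimately show ?thesis by (simp add: q_def rot_minus)
      qed
      then consider "0 \<le> snd (q d)" | "0 \<le> snd (q (d + 3))" by force
      then show ?thesis
      proof cases
        case 1 then show ?thesis using g c(1) by blast
      next
        case 2
        have "hier {x. 0 \<le> snd x} (Suc k) (c1,0) (view t p (d + 3))" using c(2) unfolding view_view by simp
        then show ?thesis using g [OF 2] by blast
      qed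
    qed
    then obtain f c q where f: "hier {x. 0 \<le> snd x} (Suc k) c (view t p f)" "hexball q r \<subseteq> {x. 0 \<le> snd x}"
      "\<And>x. x \<in> hexball q r \<Longrightarrow> p + rot f x \<in> hexball 0 (2 * r)" by blast
    have "hier (hexball q r \<inter> {x. 0 \<le> snd x}) (Suc k) c (view s p f)"
    proof (rule hier_cong [OF f(1)])
      fix x assume "x \<in> hexball q r"
      then have "t (p + rot f x) mod 3 = s (p + rot f x) mod 3" using t3 f(3) by blast
      then show "view t p f x mod 3 = view s p f x mod 3" by (simp add: view_def mod_eq_dvd_iff)
    qed
    then have h: "hier (hexball q r) (Suc k) c (view s p f)" using f(2) by (simp add: Int_absorb2)
    have a': "rot (- f) a = scl (2 ^ k) (dir (- f + e) + scl 2 (rot (- f) z))"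
      unfolding a by (simp only: rot_scl rot_add rot_dir)
    have "hexball q (2 ^ Suc k + hexnorm (rot (- f) a)) \<subseteq> hexball q r" unfolding r_def hexnorm_rot by simp
    from hier_aperiodic [OF h a' this] obtain x where
      x: "view s p f (x + rot (- f) a) mod 3 \<noteq> view s p f x mod 3" by blast
    have "view s p f (x + rot (- f) a) = s (p + rot f x + a) - f" by (simp add: view_def rot_add rot_inverse add.assoc)
    then show False using x per [of "p + rot f x"] by (simp add: view_def mod_eq_dvd_iff)
  qed
qed

text \<open>
  On a finite class and its neighbours the map coincides with one whose orbits all merge. The class is
  closed under steps of the latter in both directions, so it would be the whole lattice.
\<close>

theorem local_limit_infinite:
  assumes "local_limit s" shows "infinite {y. link s x y}"
proof
  let ?K = "{y. link s x y}"
  assume fin: "finite ?K"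
  define R where "R = Max (hexnorm ` ?K) + 1"
  have K: "hexnorm y + 1 \<le> R" if "y \<in> ?K" for y unfolding R_def using fin that by simp
  obtain t where t: "conn t" and ts: "\<And>y. y \<in> hexball 0 R \<Longrightarrow> t y mod 6 = s y mod 6"
    using assms unfolding local_limit_def by blast
  have st: "step t y = step s y" if "y \<in> hexball 0 R" for y
    using dir_cong [OF ts [OF that]] by (simp add: step_def)
  have fw: "step t y \<in> ?K" if "y \<in> ?K" for y
  proof -
    have "y \<in> hexball 0 R" using K [OF that] by (simp add: hexball_def)
    then show ?thesis using st [of y] that link_trans [OF _ link_step [of s y]] by simp
  qed
  have bw: "y \<in> ?K" if "step t y \<in> ?K" for y
  proof -
    have "y = step t y + - dir (t y)" by (simp add: step_def)
    then have "hexnorm y \<le> hexnorm (step t y) + 1" using hexnorm_triangle [of "step t y" "- dir (t y)"] hexnorm_dir [of "t y"] by simp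
    then have "y \<in> hexball 0 R" using K [OF that] by (simp add: hexball_def)
    then have "link s x (step s y)" using st [of y] that by simp
    then show ?thesis using link_trans link_sym [OF link_step [of s y]] by blast
  qed
  have fw': "(step t ^^ i) y \<in> ?K" if "y \<in> ?K" for i y
    using that fw by (induction i) auto
  have bw': "(step t ^^ i) y \<in> ?K \<Longrightarrow> y \<in> ?K" for i y
  proof (induction i)
    case (Suc i) then show ?case using bw by simp
  qed simp
  have "?K = UNIV"
  proof -
    have "z \<in> ?K" for z
    proof -
      obtain i j where "(step t ^^ i) x = (step t ^^ j) z" using t unfolding conn_def link_def by blast
      moreover have "(step t ^^ i) x \<in> ?K" by (rule fw') simp
      ultimately have "(step t ^^ j) z \<in> ?K" by simp
      then show ?thesis by (rule bw')
    qed
    then show ?thesis by blast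
  qed
  then show False using fin by (simp add: finite_prod)
qed

section \<open>Hexagons and tiles\<close>

text \<open>
  The powers of \<open>e\<^sup>i\<^sup>\<pi>\<^sup>/\<^sup>3\<close>, the outer normals of the hexagon.
\<close>

definition zeta :: "int \<Rightarrow> complex" where "zeta d = cis (real_of_int d * pi / 3)"

lemma zeta_add: "zeta (d + e) = zeta d * zeta e"
  by (simp add: zeta_def cis_mult algebra_simps add_divide_distrib)
lemma norm_zeta [simp]: "norm (zeta d) = 1" by (simp add: zeta_def)
lemma zeta_values: "zeta 0 = 1" "zeta 1 = Complex (1/2) (sqrt 3 / 2)" "zeta 2 = Complex (-1/2) (sqrt 3 / 2)"
  "zeta 3 = -1" "zeta 4 = Complex (-1/2) (- (sqrt 3 / 2))" "zeta 5 = Complex (1/2) (- (sqrt 3 / 2))" "zeta 6 = 1"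
proof -
  show 1: "zeta 1 = Complex (1/2) (sqrt 3 / 2)" by (simp add: zeta_def cis.ctr cos_60 sin_60)
  have s: "Complex (1/2) (sqrt 3 / 2) * Complex (1/2) (sqrt 3 / 2) = Complex (-1/2) (sqrt 3 / 2)"
    by (simp add: complex_eq_iff)
  show 2: "zeta 2 = Complex (-1/2) (sqrt 3 / 2)" using zeta_add [of 1 1] 1 s by simp
  show 3: "zeta 3 = -1" using zeta_add [of 1 2] unfolding 1 2 by (simp add: complex_eq_iff)
  show "zeta 4 = Complex (-1/2) (- (sqrt 3 / 2))" using zeta_add [of 3 1] unfolding 1 3 by (simp add: complex_eq_iff)
  show "zeta 5 = Complex (1/2) (- (sqrt 3 / 2))" using zeta_add [of 3 2] unfolding 2 3 by (simp add: complex_eq_iff)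
  show "zeta 6 = 1" using zeta_add [of 3 3] unfolding 3 by simp
  show "zeta 0 = 1" by (simp add: zeta_def)
qed

lemma zeta_cong: "d mod 6 = e mod 6 \<Longrightarrow> zeta d = zeta e"
proof -
  have p: "zeta (6 * k) = 1" for k
  proof -
    have "zeta (6 * k) = cis (2 * pi * real_of_int k)" by (simp add: zeta_def algebra_simps)
    then show ?thesis by (simp add: cis_multiple_2pi)
  qed
  have "zeta d = zeta (d mod 6)" for d
    using zeta_add [of "6 * (d div 6)" "d mod 6"] p [of "d div 6"] by simp
  then show "d mod 6 = e mod 6 \<Longrightarrow> zeta d = zeta e" by metis
qed

lemma zeta_opp: "zeta (d + 3) = - zeta d" by (simp add: zeta_add zeta_values)

lemma edge_normal_zeta: "edge_normal k = zeta (int k)"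
  by (simp add: edge_normal_def zeta_def cis.ctr)
lemma edge_tangent_zeta: "edge_tangent k = \<i> * zeta (int k)"
  by (simp add: edge_tangent_def zeta_def complex_eq_iff)

lemma inner_mult_unit: "norm w = 1 \<Longrightarrow> (w * a) \<bullet> (w * b) = a \<bullet> (b :: complex)"
proof -
  assume "norm w = 1"
  then have w: "(Re w)\<^sup>2 + (Im w)\<^sup>2 = 1" by (metis cmod_power2 one_power2)
  have "(w * a) \<bullet> (w * b) = ((Re w)\<^sup>2 + (Im w)\<^sup>2) * (a \<bullet> b)"
    by (simp add: inner_complex_def power2_eq_square algebra_simps)
  then show ?thesis by (simp add: w)
qed

definition hex :: "complex \<Rightarrow> complex \<Rightarrow> complex set" where
  "hex w b = (\<lambda>z. w * z + b) ` regular_hexagon"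

lemma regular_hexagon_iff: "z \<in> regular_hexagon \<longleftrightarrow> (\<forall>d. z \<bullet> zeta d \<le> 1/2)"
proof -
  have "z \<bullet> zeta d \<le> 1/2" if h: "\<forall>k<6. z \<bullet> zeta (int k) \<le> 1/2" for d
  proof -
    have "nat (d mod 6) < 6" by simp
    then have "z \<bullet> zeta (int (nat (d mod 6))) \<le> 1/2" using h by blast
    then show ?thesis using zeta_cong [of "d mod 6" d] by simp
  qed
  then show ?thesis unfolding regular_hexagon_def edge_normal_zeta by blast
qed

lemma hex_iff:
  assumes "norm w = 1" shows "z \<in> hex w b \<longleftrightarrow> (\<forall>d. (z - b) \<bullet> (w * zeta d) \<le> 1/2)"
proof -
  have w0: "w \<noteq> 0" using assms by auto
  have e: "z = w * ((z - b) / w) + b" using w0 by simp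
  have "z \<in> hex w b \<longleftrightarrow> (z - b) / w \<in> regular_hexagon"
  proof
    assume "z \<in> hex w b" then show "(z - b) / w \<in> regular_hexagon" using w0 by (auto simp: hex_def)
  next
    assume "(z - b) / w \<in> regular_hexagon" then show "z \<in> hex w b" unfolding hex_def using e by blast
  qed
  also have "\<dots> \<longleftrightarrow> (\<forall>d. (w * ((z - b) / w)) \<bullet> (w * zeta d) \<le> 1/2)"
    unfolding regular_hexagon_iff inner_mult_unit [OF assms] ..
  finally show ?thesis using w0 by simp
qed

lemma hex_alt: assumes "norm w = 1" shows "hex w b = (\<Inter>d. {z. (w * zeta d) \<bullet> z \<le> 1/2 + (w * zeta d) \<bullet> b})"
proof -
  have "(z - b) \<bullet> u \<le> 1/2 \<longleftrightarrow> u \<bullet> z \<le> 1/2 + u \<bullet> b" for z u :: complex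
    by (simp only: inner_diff_left inner_commute [of u]) linarith
  then show ?thesis by (auto simp only: hex_iff [OF assms] set_eq_iff INT_iff mem_Collect_eq UNIV_I)
qed

lemma hex_closed: "norm w = 1 \<Longrightarrow> closed (hex w b)"
  unfolding hex_alt by (intro closed_INT ballI closed_halfspace_le)
lemma hex_convex: "norm w = 1 \<Longrightarrow> convex (hex w b)"
  unfolding hex_alt by (intro convex_INT convex_halfspace_le)

lemma hex_ball: assumes "norm w = 1" "norm (z - b) < 1/2" shows "z \<in> interior (hex w b)"
proof -
  have "ball b (1/2) \<subseteq> hex w b"
  proof
    fix y assume "y \<in> ball b (1/2)"
    then have "norm (y - b) \<le> 1/2" by (simp add: dist_norm norm_minus_commute)
    then have "(y - b) \<bullet> (w * zeta d) \<le> 1/2" for d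
      using norm_cauchy_schwarz [of "y - b" "w * zeta d"] assms(1) by (simp add: norm_mult)
    then show "y \<in> hex w b" using hex_iff assms(1) by blast
  qed
  then have "ball b (1/2) \<subseteq> interior (hex w b)" by (rule interior_maximal) simp
  moreover have "z \<in> ball b (1/2)" using assms(2) by (simp add: dist_norm norm_minus_commute)
  ultimately show ?thesis by blast
qed

lemma polar_sector: "\<exists>d \<phi>. \<bar>\<phi>\<bar> \<le> pi / 6 \<and> z = of_real (norm z) * zeta d * cis \<phi>"
proof -
  define d where "d = round (Arg z / (pi / 3))"
  define \<phi> where "\<phi> = Arg z - real_of_int d * pi / 3"
  have "\<bar>real_of_int d - Arg z / (pi / 3)\<bar> \<le> 1/2" unfolding d_def by (rule of_int_round_abs_le)
  then have "\<bar>real_of_int d - Arg z / (pi / 3)\<bar> * (pi / 3) \<le> 1/2 * (pi / 3)" by (rule mult_right_mono) simp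
  moreover have "\<phi> = - ((real_of_int d - Arg z / (pi / 3)) * (pi / 3))" unfolding \<phi>_def by (simp add: field_simps)
  then have "\<bar>\<phi>\<bar> = \<bar>real_of_int d - Arg z / (pi / 3)\<bar> * (pi / 3)" by (simp add: abs_mult)
  ultimately have "\<bar>\<phi>\<bar> \<le> pi / 6" by linarith
  moreover have "z = of_real (norm z) * zeta d * cis \<phi>"
  proof -
    have "z = rcis (norm z) (Arg z)" by (simp add: rcis_cmod_Arg)
    then show ?thesis by (simp add: rcis_def zeta_def \<phi>_def cis_mult mult.assoc)
  qed
  ultimately show ?thesis by blast
qed

lemma cos_sector: assumes "\<bar>\<phi>\<bar> \<le> pi / 6"
  shows "sqrt 3 / 2 \<le> cos \<phi>" "cos \<phi> = sqrt 3 / 2 \<Longrightarrow> \<bar>\<phi>\<bar> = pi / 6"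
proof -
  have "cos (pi / 6) \<le> cos \<bar>\<phi>\<bar>" using assms by (intro cos_monotone_0_pi_le) auto
  then show "sqrt 3 / 2 \<le> cos \<phi>" by (simp add: cos_30)
  assume "cos \<phi> = sqrt 3 / 2"
  then have "cos \<bar>\<phi>\<bar> = cos (pi / 6)" by (simp add: cos_30)
  moreover have "\<bar>\<phi>\<bar> \<le> pi" "pi / 6 \<le> pi" "0 \<le> pi / 6" using assms pi_gt_zero by linarith+
  ultimately show "\<bar>\<phi>\<bar> = pi / 6" using cos_inj_pi [of "\<bar>\<phi>\<bar>" "pi / 6"] by simp
qed

text \<open>
  Some edge normal makes an angle of at most 30 degrees with \<open>z - b\<close>, which bounds the distance
  from the centre; the bound is attained only at an angle of exactly 30 degrees, at the vertices.
\<close>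

lemma hex_radius:
  assumes w: "norm w = 1" and z: "z \<in> hex w b"
  shows "norm (z - b) \<le> 1 / sqrt 3"
    "norm (z - b) = 1 / sqrt 3 \<Longrightarrow> \<exists>d. z - b = of_real (1 / sqrt 3) * w * zeta d * cis (pi / 6)"
proof -
  have w0: "w \<noteq> 0" using w by auto
  obtain d \<phi> where p: "\<bar>\<phi>\<bar> \<le> pi / 6" "(z - b) / w = of_real (norm ((z - b) / w)) * zeta d * cis \<phi>"
    using polar_sector by blast
  have n: "norm ((z - b) / w) = norm (z - b)" by (simp add: norm_divide w)
  have e: "z - b = (w * zeta d) * (of_real (norm (z - b)) * cis \<phi>)"
    using p(2) w0 unfolding n by (simp add: field_simps)
  have "(z - b) \<bullet> (w * zeta d) = ((w * zeta d) * (of_real (norm (z - b)) * cis \<phi>)) \<bullet> ((w * zeta d) * 1)"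
    using e by simp
  also have "\<dots> = (of_real (norm (z - b)) * cis \<phi>) \<bullet> 1" by (rule inner_mult_unit) (simp add: norm_mult w)
  also have "\<dots> = norm (z - b) * cos \<phi>" by (simp add: inner_complex_def)
  finally have le: "norm (z - b) * cos \<phi> \<le> 1/2" using z hex_iff [OF w] by metis
  note c = cos_sector [OF p(1)]
  have "norm (z - b) * (sqrt 3 / 2) \<le> 1/2" using le c(1) by (meson mult_left_mono norm_ge_zero order_trans)
  then show "norm (z - b) \<le> 1 / sqrt 3" by (simp add: field_simps)
  assume eq: "norm (z - b) = 1 / sqrt 3"
  then have "1 / sqrt 3 * cos \<phi> \<le> 1/2" using le by simp
  then have "cos \<phi> \<le> sqrt 3 / 2" by (simp add: field_simps)
  then have "\<bar>\<phi>\<bar> = pi / 6" using c by force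
  then consider "\<phi> = pi / 6" | "\<phi> = - (pi / 6)" by linarith
  then show "\<exists>d. z - b = of_real (1 / sqrt 3) * w * zeta d * cis (pi / 6)"
  proof cases
    case 1
    have "z - b = of_real (1 / sqrt 3) * w * zeta d * cis (pi / 6)"
      using e unfolding eq 1 by (simp only: mult_ac)
    then show ?thesis by blast
  next
    case 2
    have o: "zeta d * cis (- (pi / 6)) = zeta (d - 1) * cis (pi / 6)"
      by (simp add: zeta_def cis_mult field_simps)
    have "z - b = of_real (1 / sqrt 3) * w * (zeta d * cis (- (pi / 6)))"
      using e unfolding eq 2 by (simp only: mult_ac)
    then have "z - b = of_real (1 / sqrt 3) * w * zeta (d - 1) * cis (pi / 6)"
      unfolding o by (simp only: mult_ac)
    then show ?thesis by blast
  qed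
qed

text \<open>
  The point of edge \<open>d\<close> at signed distance \<open>x\<close> counterclockwise from its midpoint.
\<close>

definition edge_pt :: "complex \<Rightarrow> complex \<Rightarrow> int \<Rightarrow> real \<Rightarrow> complex" where
  "edge_pt w b d x = b + w * zeta d * Complex (1/2) x"

lemma edge_pt_inner:
  assumes w: "norm w = 1"
  shows "(edge_pt w b d x - b) \<bullet> (w * zeta e) = Complex (1/2) x \<bullet> zeta (e - d)"
proof -
  have e: "w * zeta e = w * zeta d * zeta (e - d)" using zeta_add [of d "e - d"] by simp
  show ?thesis unfolding edge_pt_def
    by (subst e) (use inner_mult_unit [of "w * zeta d" "Complex (1/2) x" "zeta (e - d)"] in \<open>simp add: norm_mult w\<close>)
qed

lemma edge_inner_values:
  "Complex (1/2) x \<bullet> zeta 0 = 1/2" "Complex (1/2) x \<bullet> zeta 1 = 1/4 + sqrt 3 / 2 * x"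
  "Complex (1/2) x \<bullet> zeta 2 = - 1/4 + sqrt 3 / 2 * x" "Complex (1/2) x \<bullet> zeta 3 = - 1/2"
  "Complex (1/2) x \<bullet> zeta 4 = - 1/4 - sqrt 3 / 2 * x" "Complex (1/2) x \<bullet> zeta 5 = 1/4 - sqrt 3 / 2 * x"
  unfolding zeta_values by (simp_all add: inner_complex_def)

lemma open_edge_slack:
  assumes w: "norm w = 1" and x: "\<bar>x\<bar> \<le> y" and e: "e mod 6 \<noteq> d mod 6"
  shows "(edge_pt w b d x - b) \<bullet> (w * zeta e) \<le> 1/4 + sqrt 3 / 2 * y"
proof -
  have k: "(e - d) mod 6 \<noteq> 0" using e mod6_0_iff [of d e] by simp
  have s: "0 \<le> sqrt 3 / 2 * y" using x by simp
  have a: "sqrt 3 / 2 * x \<le> sqrt 3 / 2 * y" "sqrt 3 / 2 * (- x) \<le> sqrt 3 / 2 * y"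
    by (rule mult_left_mono; use x in simp)+
  have o: "zeta (e - d) = zeta ((e - d) mod 6)" by (rule zeta_cong) simp
  show ?thesis
  proof (cases "e - d" rule: mod6_cases)
    case 1 then show ?thesis using k by simp
  next
    case 2 show ?thesis unfolding edge_pt_inner [OF w] o 2 edge_inner_values using s a by linarith
  next
    case 3 show ?thesis unfolding edge_pt_inner [OF w] o 3 edge_inner_values using s a by linarith
  next
    case 4 show ?thesis unfolding edge_pt_inner [OF w] o 4 edge_inner_values using s a by linarith
  next
    case 5 show ?thesis unfolding edge_pt_inner [OF w] o 5 edge_inner_values using s a by linarith
  next
    case 6 show ?thesis unfolding edge_pt_inner [OF w] o 6 edge_inner_values using s a by linarith
  qed
qed

lemma edge_pt_normal: "norm w = 1 \<Longrightarrow> (edge_pt w b d x - b) \<bullet> (w * zeta d) = 1/2"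
  using edge_pt_inner [of w b d x d] edge_inner_values(1) [of x] by simp

definition ptile :: "real \<Rightarrow> complex \<Rightarrow> complex \<Rightarrow> tile" where
  "ptile \<delta> w b = map_tile (\<lambda>z. w * z + b) (monotile \<delta>)"

lemma is_tile_ptile: "is_tile \<delta> t \<longleftrightarrow> (\<exists>w b. norm w = 1 \<and> t = ptile \<delta> w b)"
  unfolding is_tile_def direct_isometry_def ptile_def by blast

lemma support_ptile: "support (ptile \<delta> w b) = hex w b"
  by (simp add: ptile_def map_tile_def monotile_def hex_def)

lemma tiling_tile: "is_tiling \<delta> T \<Longrightarrow> t \<in> T \<Longrightarrow> \<exists>w b. norm w = 1 \<and> t = ptile \<delta> w b"
  using is_tile_ptile [of \<delta> t] unfolding is_tiling_def by simp

lemma tiling_interior_disjoint: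
  assumes "is_tiling \<delta> T" "s \<in> T" "t \<in> T" "s \<noteq> t" "x \<in> interior (support s)" shows "x \<notin> support t"
proof
  assume "x \<in> support t"
  moreover have "x \<in> support s" using assms(5) interior_subset by blast
  ultimately have "x \<in> frontier (support s)" using assms unfolding is_tiling_def by blast
  then show False using assms(5) by (simp add: frontier_def)
qed

text \<open>
  The discs of radius 1/2 inscribed in two tiles do not overlap.
\<close>

lemma centres_apart:
  assumes T: "is_tiling \<delta> T" "ptile \<delta> w b \<in> T" "ptile \<delta> w' b' \<in> T" "ptile \<delta> w b \<noteq> ptile \<delta> w' b'"
    and w: "norm w = 1" "norm w' = 1"
  shows "1 \<le> norm (b - b')"
proof (rule ccontr)
  assume "\<not> 1 \<le> norm (b - b')"
  then have n: "norm (b - b') < 1" by simp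
  have "(b + b') / 2 - b = - ((b - b') / 2)" "(b + b') / 2 - b' = (b - b') / 2" by (simp_all add: field_simps)
  then have 1: "norm ((b + b') / 2 - b) < 1/2" "norm ((b + b') / 2 - b') < 1/2" using n
    by (simp_all only: norm_minus_cancel norm_divide norm_numeral)
  have "(b + b') / 2 \<in> interior (support (ptile \<delta> w b))" "(b + b') / 2 \<in> support (ptile \<delta> w' b')"
    unfolding support_ptile using hex_ball [OF w(1) 1(1)] hex_ball [OF w(2) 1(2)] interior_subset by blast+
  then show False using tiling_interior_disjoint [OF T] by blast
qed

lemma separated_finite:
  fixes C :: "complex set"
  assumes "\<And>x y. x \<in> C \<Longrightarrow> y \<in> C \<Longrightarrow> x \<noteq> y \<Longrightarrow> 1 \<le> norm (x - y)" "C \<subseteq> cball p r"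
  shows "finite C"
proof (rule ccontr)
  assume "infinite C"
  then obtain x where x: "x islimpt C"
    using Heine_Borel_imp_Bolzano_Weierstrass [OF compact_cball _ assms(2)] by blast
  obtain y where y: "y \<in> C" "y \<noteq> x" "dist y x < 1/2" using x unfolding islimpt_approachable by (metis half_gt_zero zero_less_one)
  then have "0 < dist y x" by simp
  then obtain z where z: "z \<in> C" "z \<noteq> x" "dist z x < dist y x" using x unfolding islimpt_approachable by blast
  have "dist y z < 1" using y(3) z(3) dist_triangle2 [of y z x] by linarith
  moreover have "y \<noteq> z" using z(3) by auto
  ultimately show False using assms(1) [OF y(1) z(1)] by (simp add: dist_norm)
qed

lemma finite_near:
  assumes T: "is_tiling \<delta> T" shows "finite {t \<in> T. support t \<inter> cball p r \<noteq> {}}"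
proof -
  let ?F = "{t \<in> T. support t \<inter> cball p r \<noteq> {}}"
  have "\<forall>t. \<exists>w b. t \<in> T \<longrightarrow> norm w = 1 \<and> t = ptile \<delta> w b" using tiling_tile [OF T] by blast
  then obtain ro ce where rc: "\<And>t. t \<in> T \<Longrightarrow> norm (ro t) = 1 \<and> t = ptile \<delta> (ro t) (ce t)" by metis
  have apart: "1 \<le> norm (ce s - ce t)" if "s \<in> T" "t \<in> T" "s \<noteq> t" for s t
    using centres_apart [OF T, of "ro s" "ce s" "ro t" "ce t"] rc that by metis
  have inj: "inj_on ce ?F"
    by (rule inj_onI) (use apart in force)
  have "finite (ce ` ?F)"
  proof (rule separated_finite)
    fix x y assume "x \<in> ce ` ?F" "y \<in> ce ` ?F" "x \<noteq> y"
    then show "1 \<le> norm (x - y)" using apart by blast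
  next
    show "ce ` ?F \<subseteq> cball p (r + 1)"
    proof
      fix c assume "c \<in> ce ` ?F"
      then obtain t z where t: "t \<in> T" "c = ce t" "z \<in> support t" "z \<in> cball p r" by blast
      then have "z \<in> hex (ro t) c" using rc support_ptile by metis
      then have "norm (z - c) \<le> 1 / sqrt 3" using rc [OF t(1)] hex_radius(1) by blast
      moreover have "1 / sqrt 3 \<le> (1::real)" by simp
      ultimately have "dist z c \<le> 1" unfolding dist_norm by linarith
      then show "c \<in> cball p (r + 1)" using t(4) dist_triangle [of p c z] unfolding mem_cball by linarith
    qed
  qed
  then show ?thesis using inj by (rule finite_imageD)
qed

abbreviation (input) half_edge :: real where "half_edge \<equiv> 1 / (2 * sqrt 3)"

section \<open>Hexagons tile the plane edge to edge\<close>

text \<open>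
  A tile through an interior point of an edge lies beyond that edge: otherwise the segment from
  that point towards a suitable point of its inscribed disc would enter the first tile while running
  in the interior of the second one. So its centre is at least 1/2 beyond the edge.
\<close>

lemma other_tile_height:
  assumes T: "is_tiling \<delta> T" "ptile \<delta> w b \<in> T" "ptile \<delta> w' b' \<in> T" "ptile \<delta> w b \<noteq> ptile \<delta> w' b'"
    and w: "norm w = 1" "norm w' = 1" and x: "\<bar>x\<bar> < half_edge" and p: "edge_pt w b d x \<in> hex w' b'"
  shows "1 \<le> (b' - b) \<bullet> (w * zeta d)"
proof (rule ccontr)
  define n where "n = w * zeta d"
  have nn: "norm n = 1" by (simp add: n_def norm_mult w)
  have n2: "n \<bullet> n = 1" using nn by (simp add: dot_square_norm)
  define p' where "p' = edge_pt w b d x"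
  define X where "X = (b' - b) \<bullet> n"
  assume "\<not> 1 \<le> (b' - b) \<bullet> (w * zeta d)"
  then have X: "X < 1" unfolding X_def n_def by simp
  \<comment> \<open>A point of the inscribed disc below the edge line: \<open>X - 1/2 < \<rho> < 1/2\<close> as \<open>X < 1\<close>.\<close>
  define \<rho> where "\<rho> = max 0 (X / 2)"
  define q where "q = b' - \<rho> *\<^sub>R n"
  have r: "0 \<le> \<rho>" "\<rho> < 1/2" "X - \<rho> < 1/2" using X by (auto simp: \<rho>_def)
  have "norm (q - b') < 1/2" using r by (simp add: q_def nn)
  then have qi: "q \<in> interior (hex w' b')" by (rule hex_ball [OF w(2)])
  have pn: "(p' - b) \<bullet> n = 1/2" unfolding p'_def n_def by (rule edge_pt_normal [OF w(1)])
  have "q - p' = (b' - b) - \<rho> *\<^sub>R n - (p' - b)" by (simp add: q_def)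
  then have "(q - p') \<bullet> n = ((b' - b) - \<rho> *\<^sub>R n - (p' - b)) \<bullet> n" by (rule arg_cong)
  also have "\<dots> = X - \<rho> * (n \<bullet> n) - (p' - b) \<bullet> n"
    unfolding X_def by (simp only: inner_diff_left inner_scaleR_left)
  finally have qn: "(q - p') \<bullet> n < 0" using r pn n2 by simp
  \<comment> \<open>The slack of the other five half planes at the point allows a short step towards \<open>q\<close>.\<close>
  define sl where "sl = 1/4 - sqrt 3 / 2 * \<bar>x\<bar>"
  have sl: "0 < sl" using x by (simp add: sl_def field_simps)
  define \<epsilon> where "\<epsilon> = min 1 (sl / (norm (q - p') + 1))"
  have np: "0 < norm (q - p') + 1" using norm_ge_zero [of "q - p'"] by linarith
  have e: "0 < \<epsilon>" "\<epsilon> \<le> 1" using sl np by (auto simp: \<epsilon>_def)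
  have "\<epsilon> * norm (q - p') \<le> sl / (norm (q - p') + 1) * norm (q - p')" unfolding \<epsilon>_def by (intro mult_right_mono) auto
  also have "\<dots> \<le> sl" using sl np by (simp add: field_simps)
  finally have es: "\<epsilon> * norm (q - p') \<le> sl" .
  define y where "y = p' - \<epsilon> *\<^sub>R (p' - q)"
  have yi: "y \<in> interior (hex w' b')" unfolding y_def
    by (rule mem_interior_convex_shrink [OF hex_convex [OF w(2)] qi p [folded p'_def] e])
  have "y \<in> hex w b" unfolding hex_iff [OF w(1)]
  proof
    fix f
    have yy: "(y - b) \<bullet> u = (p' - b) \<bullet> u + \<epsilon> * ((q - p') \<bullet> u)" for u
      by (simp add: y_def inner_diff_left algebra_simps)
    show "(y - b) \<bullet> (w * zeta f) \<le> 1/2"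
    proof (cases "f mod 6 = d mod 6")
      case True
      then have f: "w * zeta f = n" using zeta_cong [OF True] by (simp add: n_def)
      have "\<epsilon> * ((q - p') \<bullet> n) \<le> 0" using e(1) qn by (simp add: mult_nonneg_nonpos)
      then show ?thesis unfolding f yy pn by simp
    next
      case False
      have "(p' - b) \<bullet> (w * zeta f) \<le> 1/4 + sqrt 3 / 2 * \<bar>x\<bar>"
        unfolding p'_def by (rule open_edge_slack [OF w(1) _ False]) simp
      moreover have "(q - p') \<bullet> (w * zeta f) \<le> norm (q - p')"
        using norm_cauchy_schwarz [of "q - p'" "w * zeta f"] by (simp add: norm_mult w)
      then have "\<epsilon> * ((q - p') \<bullet> (w * zeta f)) \<le> sl" using e(1) es by (meson mult_left_mono order_trans less_imp_le)
      ultimately show ?thesis unfolding yy sl_def by linarith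
    qed
  qed
  then show False using tiling_interior_disjoint [OF T(1,3,2) _ yi [folded support_ptile [of \<delta>]]] T(4)
    unfolding support_ptile by metis
qed

lemma mult_cnj_unit: "norm n = 1 \<Longrightarrow> n * cnj n = 1"
  by (metis complex_norm_square mult_1 of_real_1 one_power2)

lemma inner_as_Re: "z \<bullet> n = Re (z * cnj n)" for z n :: complex
  by (simp add: inner_complex_def)

lemma edge_pt_frame:
  assumes "norm w = 1"
  shows "(c - edge_pt w b d x) * cnj (w * zeta d) = (c - b) * cnj (w * zeta d) - Complex (1/2) x"
proof -
  have "(w * zeta d) * cnj (w * zeta d) = 1" by (rule mult_cnj_unit) (simp add: norm_mult assms)
  moreover have "(c - (b + n * z)) * m = (c - b) * m - (n * m) * z" for n z m :: complex
    by (simp add: algebra_simps)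
  ultimately show ?thesis unfolding edge_pt_def by simp
qed

lemma sqrt3_bounds: "half_edge\<^sup>2 = 1/12" "(1 / sqrt 3)\<^sup>2 = (1/3 :: real)" "0 < half_edge"
  by (simp_all add: power_divide power_mult_distrib)

lemma other_tile_centre:
  assumes T: "is_tiling \<delta> T" "ptile \<delta> w b \<in> T" "ptile \<delta> w' b' \<in> T" "ptile \<delta> w b \<noteq> ptile \<delta> w' b'"
    and w: "norm w = 1" "norm w' = 1" and x: "\<bar>x\<bar> < half_edge" and p: "edge_pt w b d x \<in> hex w' b'"
  defines "\<beta> \<equiv> (b' - b) * cnj (w * zeta d)"
  shows "1 \<le> Re \<beta>" "(Re \<beta> - 1/2)\<^sup>2 + (Im \<beta> - x)\<^sup>2 \<le> 1/3"
proof -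
  show "1 \<le> Re \<beta>" unfolding \<beta>_def inner_as_Re [symmetric] by (rule other_tile_height [OF T w x p])
  have "norm (edge_pt w b d x - b') \<le> 1 / sqrt 3" by (rule hex_radius(1) [OF w(2) p])
  moreover have "norm ((b' - edge_pt w b d x) * cnj (w * zeta d)) = norm (edge_pt w b d x - b')"
    by (simp add: norm_mult w norm_minus_commute)
  ultimately have "norm (\<beta> - Complex (1/2) x) \<le> 1 / sqrt 3" unfolding edge_pt_frame [OF w(1)] \<beta>_def by simp
  then have "(norm (\<beta> - Complex (1/2) x))\<^sup>2 \<le> (1 / sqrt 3)\<^sup>2" by (rule power_mono) simp
  then show "(Re \<beta> - 1/2)\<^sup>2 + (Im \<beta> - x)\<^sup>2 \<le> 1/3" unfolding sqrt3_bounds cmod_power2 by simp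
qed

text \<open>
  The centre of such a tile is at least 1/2 beyond the edge and within the circumradius of the point.
  This region is so small that two centres in it would be less than 1 apart.
\<close>

lemma other_tile_unique:
  assumes T: "is_tiling \<delta> T" "ptile \<delta> w b \<in> T" and w: "norm w = 1" and x: "\<bar>x\<bar> < half_edge"
    and s: "s \<in> T" "s \<noteq> ptile \<delta> w b" "edge_pt w b d x \<in> support s"
    and t: "t \<in> T" "t \<noteq> ptile \<delta> w b" "edge_pt w b d x \<in> support t"
  shows "s = t"
proof (rule ccontr)
  assume ne: "s \<noteq> t"
  obtain v c where s': "norm v = 1" "s = ptile \<delta> v c" using tiling_tile [OF T(1) s(1)] by blast
  obtain v' c' where t': "norm v' = 1" "t = ptile \<delta> v' c'" using tiling_tile [OF T(1) t(1)] by blast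
  define n where "n = cnj (w * zeta d)"
  define a where "a = (c - b) * n"
  define a' where "a' = (c' - b) * n"
  have A: "1 \<le> Re a" "(Re a - 1/2)\<^sup>2 + (Im a - x)\<^sup>2 \<le> 1/3"
    using other_tile_centre [OF T(1,2) _ _ w s'(1) x, of c d] s unfolding s' support_ptile a_def n_def by auto
  have A': "1 \<le> Re a'" "(Re a' - 1/2)\<^sup>2 + (Im a' - x)\<^sup>2 \<le> 1/3"
    using other_tile_centre [OF T(1,2) _ _ w t'(1) x, of c' d] t unfolding t' support_ptile a'_def n_def by auto
  have bnd: "Re u \<le> 11/10 \<and> (Im u - x)\<^sup>2 \<le> 1/12" if "1 \<le> Re u" "(Re u - 1/2)\<^sup>2 + (Im u - x)\<^sup>2 \<le> 1/3" for u
  proof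
    have "(1/2)\<^sup>2 \<le> (Re u - 1/2)\<^sup>2" using that(1) by (intro power_mono) auto
    moreover have "(1/2)\<^sup>2 = (1/4 :: real)" by (simp add: power2_eq_square)
    ultimately show "(Im u - x)\<^sup>2 \<le> 1/12" using that(2) by linarith
    have "(Re u - 1/2)\<^sup>2 \<le> (6/10)\<^sup>2" 
    proof -
      have "(6/10)\<^sup>2 = (36/100 :: real)" by (simp add: power2_eq_square)
      then show ?thesis using that(2) zero_le_power2 [of "Im u - x"] by linarith
    qed
    then have "Re u - 1/2 \<le> 6/10" by (rule power2_le_imp_le) simp
    then show "Re u \<le> 11/10" by simp
  qed
  have r: "\<bar>Re a - Re a'\<bar> \<le> 1/10" using bnd [OF A] bnd [OF A'] A(1) A'(1) by linarith
  have "(Re a - Re a')\<^sup>2 \<le> (1/10)\<^sup>2" using r by (metis abs_ge_zero power2_abs power_mono)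
  moreover have "(Im a - Im a')\<^sup>2 \<le> 1/3"
  proof -
    have "(Im a - Im a')\<^sup>2 = 2 * (Im a - x)\<^sup>2 + 2 * (Im a' - x)\<^sup>2 - (Im a + Im a' - 2 * x)\<^sup>2"
      by (simp add: power2_eq_square algebra_simps)
    then show ?thesis using bnd [OF A] bnd [OF A'] zero_le_power2 [of "Im a + Im a' - 2 * x"] by linarith
  qed
  ultimately have "(norm (a - a'))\<^sup>2 < 1" unfolding cmod_power2 by (simp add: power2_eq_square)
  moreover have "norm (a - a') = norm (c - c')"
  proof -
    have "a - a' = (c - c') * n" unfolding a_def a'_def by (simp add: algebra_simps)
    then show ?thesis by (simp add: n_def norm_mult w)
  qed
  moreover have "1 \<le> norm (c - c')" using centres_apart [OF T(1), of v c v' c'] s(1) t(1) ne s' t' by simp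
  ultimately show False using one_le_power [of "norm (c - c')" 2] by (metis not_less)
qed

lemma other_tile_exists:
  assumes T: "is_tiling \<delta> T" "ptile \<delta> w b \<in> T" and w: "norm w = 1"
  shows "\<exists>t\<in>T. t \<noteq> ptile \<delta> w b \<and> edge_pt w b d x \<in> support t"
proof -
  let ?p = "edge_pt w b d x"
  let ?F = "{t \<in> T. support t \<inter> cball ?p 1 \<noteq> {}} - {ptile \<delta> w b}"
  let ?U = "\<Union>t\<in>?F. support t"
  define n where "n = w * zeta d"
  have nn: "norm n = 1" "n \<bullet> n = 1" by (simp_all add: n_def norm_mult w dot_square_norm)
  have cl: "closed ?U"
  proof (rule closed_UN)
    show "finite ?F" using finite_near [OF T(1)] by simp
    show "\<forall>t\<in>?F. closed (support t)"
    proof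
      fix t assume "t \<in> ?F"
      then obtain v c where "norm v = 1" "t = ptile \<delta> v c" using tiling_tile [OF T(1)] by blast
      then show "closed (support t)" using hex_closed support_ptile by simp
    qed
  qed
  define y where "y k = ?p + inverse (real (Suc k)) *\<^sub>R n" for k
  have "y k \<in> ?U" for k
  proof -
    have i: "0 < inverse (real (Suc k))" "inverse (real (Suc k)) \<le> 1" by (auto simp: field_simps)
    have "y k \<in> (\<Union>t\<in>T. support t)" using T(1) unfolding is_tiling_def by simp
    then obtain t where t: "t \<in> T" "y k \<in> support t" by blast
    have "y k - b = (?p - b) + inverse (real (Suc k)) *\<^sub>R n" by (simp add: y_def)
    then have "(y k - b) \<bullet> n = 1/2 + inverse (real (Suc k))"
      using edge_pt_normal [OF w, of b d x] nn by (simp only: inner_add_left inner_scaleR_left n_def [symmetric])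
    then have "\<not> (y k - b) \<bullet> (w * zeta d) \<le> 1/2" using i(1) unfolding n_def by linarith
    then have "y k \<notin> hex w b" using hex_iff [OF w] by blast
    then have "t \<noteq> ptile \<delta> w b" using t(2) support_ptile by metis
    moreover have "y k \<in> cball ?p 1" using i by (simp add: y_def dist_norm nn)
    ultimately show ?thesis using t by blast
  qed
  moreover have "y \<longlonglongrightarrow> ?p"
  proof -
    have "(\<lambda>k. ?p + inverse (real (Suc k)) *\<^sub>R n) \<longlonglongrightarrow> ?p + 0 *\<^sub>R n"
      by (intro tendsto_intros LIMSEQ_inverse_real_of_nat)
    then show ?thesis unfolding y_def by simp
  qed
  ultimately have "?p \<in> ?U" using cl closed_sequentially by blast
  then show ?thesis by blast
qed

lemma edge_pt_continuous: "continuous_on UNIV (edge_pt w b d)"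
proof -
  have "edge_pt w b d = (\<lambda>x. b + w * zeta d * (of_real (1/2) + \<i> * of_real x))"
    by (rule ext) (simp add: edge_pt_def Complex_eq)
  then show ?thesis by (simp only:) (intro continuous_intros)
qed

lemma tile_closed: "is_tiling \<delta> T \<Longrightarrow> t \<in> T \<Longrightarrow> closed (support t)"
  using tiling_tile hex_closed support_ptile by metis

text \<open>
  The unique other tile at a point of the open edge is locally constant along the edge, because near
  any point only finitely many tiles occur and they are closed.
\<close>

lemma edge_shared:
  assumes T: "is_tiling \<delta> T" "ptile \<delta> w b \<in> T" and w: "norm w = 1"
  shows "\<exists>t\<in>T. t \<noteq> ptile \<delta> w b \<and> (\<forall>x. \<bar>x\<bar> \<le> half_edge \<longrightarrow> edge_pt w b d x \<in> support t)"
proof -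
  let ?p = "edge_pt w b d"
  define f where "f x = (SOME t. t \<in> T \<and> t \<noteq> ptile \<delta> w b \<and> ?p x \<in> support t)" for x
  have f: "f x \<in> T \<and> f x \<noteq> ptile \<delta> w b \<and> ?p x \<in> support (f x)" for x
    unfolding f_def using other_tile_exists [OF T w, of d x] by (rule_tac someI_ex) blast
  have fu: "t = f x" if "\<bar>x\<bar> < half_edge" "t \<in> T" "t \<noteq> ptile \<delta> w b" "?p x \<in> support t" for x t
    using other_tile_unique [OF T w that(1) that(2,3,4)] f [of x] by blast
  let ?I = "{- half_edge <..< half_edge}"
  have loc: "\<forall>\<^sub>F y in at x within ?I. f x = f y" if "x \<in> ?I" for x
  proof -
    let ?F = "{t \<in> T. support t \<inter> cball (?p x) 1 \<noteq> {}} - {ptile \<delta> w b, f x}"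
    let ?V = "ball (?p x) 1 - (\<Union>t\<in>?F. support t)"
    have x: "\<bar>x\<bar> < half_edge" using that by auto
    have "closed (\<Union>t\<in>?F. support t)"
      using finite_near [OF T(1)] tile_closed [OF T(1)] by (intro closed_UN) auto
    then have o: "open ?V" by (simp add: open_Diff)
    have "?p x \<notin> support t" if "t \<in> ?F" for t using fu [OF x, of t] that by blast
    then have "?p x \<in> ?V" by auto
    moreover have "isCont ?p x" using edge_pt_continuous continuous_on_eq_continuous_at [OF open_UNIV] by blast
    then have "(?p \<longlongrightarrow> ?p x) (at x within ?I)" by (simp add: isCont_def tendsto_within_subset [of _ _ _ UNIV])
    ultimately have "\<forall>\<^sub>F y in at x within ?I. ?p y \<in> ?V" using o topological_tendstoD by blast
    moreover have "\<forall>\<^sub>F y in at x within ?I. y \<in> ?I" by (simp add: eventually_at_filter)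
    ultimately show ?thesis
    proof eventually_elim
      case (elim y)
      have "f y \<notin> ?F" using elim(1) f [of y] by blast
      moreover have "?p y \<in> cball (?p x) 1" using elim(1) by auto
      then have "f y \<in> {t \<in> T. support t \<inter> cball (?p x) 1 \<noteq> {}}" using f [of y] by blast
      ultimately have "f y = f x" using f [of y] by simp
      then show ?case by simp
    qed
  qed
  have h0: "0 < half_edge" by simp
  have const: "f x = f 0" if "x \<in> ?I" for x
    by (rule connected_local_const [of ?I]) (use that loc h0 in \<open>auto simp: is_interval_connected\<close>)
  have cl: "closed {x. ?p x \<in> support (f 0)}"
    using continuous_closed_vimage [OF tile_closed [OF T(1)], of "f 0" ?p] f [of 0] edge_pt_continuous
    by (simp add: vimage_def continuous_on_eq_continuous_at)
  have "?I \<subseteq> {x. ?p x \<in> support (f 0)}" using const f by (metis (mono_tags, lifting) mem_Collect_eq subsetI)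
  then have "closure ?I \<subseteq> {x. ?p x \<in> support (f 0)}" using cl by (rule closure_minimal)
  then have "?p x \<in> support (f 0)" if "\<bar>x\<bar> \<le> half_edge" for x
    using that h0 by (auto simp: closure_greaterThanLessThan subset_iff abs_le_iff)
  then show ?thesis using f by blast
qed

text \<open>
  The tile across an edge contains both of its ends. Its centre is within the circumradius of
  either end and at least 1/2 beyond the edge, which leaves only the mirror image of the
  first centre. Then the ends are vertices, so the rotation differs by a multiple of 60 degrees.
\<close>

theorem neighbour_tile:
  assumes T: "is_tiling \<delta> T" "ptile \<delta> w b \<in> T" and w: "norm w = 1"
  shows "\<exists>e. ptile \<delta> (w * zeta e) (b + w * zeta d) \<in> T"
proof -
  obtain t where t: "t \<in> T" "t \<noteq> ptile \<delta> w b" and sh: "\<And>x. \<bar>x\<bar> \<le> half_edge \<Longrightarrow> edge_pt w b d x \<in> support t"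
    using edge_shared [OF T w] by blast
  obtain v c where v: "norm v = 1" "t = ptile \<delta> v c" using tiling_tile [OF T(1) t(1)] by blast
  define n where "n = w * zeta d"
  have nn: "norm n = 1" by (simp add: n_def norm_mult w)
  define \<beta> where "\<beta> = (c - b) * cnj n"
  have h: "0 < half_edge" "half_edge\<^sup>2 = 1/12" using sqrt3_bounds by auto
  have R1: "1 \<le> Re \<beta>"
    using other_tile_centre(1) [OF T(1,2) _ _ w v(1), of c 0 d] t sh [of 0] h(1) unfolding v(2) support_ptile \<beta>_def n_def by auto
  have rad: "(Re \<beta> - 1/2)\<^sup>2 + (Im \<beta> - x)\<^sup>2 \<le> 1/3" if "\<bar>x\<bar> \<le> half_edge" for x
  proof -
    have "norm (edge_pt w b d x - c) \<le> 1 / sqrt 3" using hex_radius(1) [OF v(1)] sh [OF that] unfolding v(2) support_ptile by blast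
    moreover have "norm ((c - edge_pt w b d x) * cnj (w * zeta d)) = norm (edge_pt w b d x - c)"
      by (simp add: norm_mult w norm_minus_commute)
    ultimately have "norm (\<beta> - Complex (1/2) x) \<le> 1 / sqrt 3" unfolding edge_pt_frame [OF w] \<beta>_def n_def by simp
    then have "(norm (\<beta> - Complex (1/2) x))\<^sup>2 \<le> (1 / sqrt 3)\<^sup>2" by (rule power_mono) simp
    then show ?thesis unfolding sqrt3_bounds cmod_power2 by simp
  qed
  have q: "(1/2)\<^sup>2 \<le> (Re \<beta> - 1/2)\<^sup>2" using R1 by (intro power_mono) auto
  have q4: "(1/2)\<^sup>2 = (1/4 :: real)" by (simp add: power2_eq_square)
  have e1: "(Im \<beta> - half_edge)\<^sup>2 = (Im \<beta>)\<^sup>2 - 2 * (half_edge * Im \<beta>) + half_edge\<^sup>2" "(Im \<beta> - - half_edge)\<^sup>2 = (Im \<beta>)\<^sup>2 + 2 * (half_edge * Im \<beta>) + half_edge\<^sup>2"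
    by (simp_all add: power2_diff power2_sum)
  have r1: "(Re \<beta> - 1/2)\<^sup>2 + (Im \<beta> - half_edge)\<^sup>2 \<le> 1/3" "(Re \<beta> - 1/2)\<^sup>2 + (Im \<beta> - - half_edge)\<^sup>2 \<le> 1/3"
    using rad [of half_edge] rad [of "- half_edge"] h(1) by auto
  have "(Im \<beta>)\<^sup>2 \<le> 0" using r1 q unfolding e1 q4 h(2) by linarith
  then have I: "Im \<beta> = 0" by simp
  then have "(Re \<beta> - 1/2)\<^sup>2 \<le> (1/2)\<^sup>2" using r1(1) unfolding e1 q4 h(2) by simp
  then have "Re \<beta> - 1/2 \<le> 1/2" by (rule power2_le_imp_le) simp
  then have "\<beta> = 1" using R1 I by (simp add: complex_eq_iff)
  then have "(c - b) * (n * cnj n) = n" unfolding \<beta>_def by (metis mult.left_commute mult.right_neutral)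
  then have c: "c = b + n" unfolding mult_cnj_unit [OF nn] by (simp add: algebra_simps)
  have z: "edge_pt w b d half_edge - c = of_real (1 / sqrt 3) * w * zeta (d + 2) * cis (pi / 6)"
  proof -
    have "Complex (1/2) half_edge - 1 = of_real (1 / sqrt 3) * zeta 2 * cis (pi / 6)"
      by (simp add: zeta_values complex_eq_iff cos_30 sin_30 field_simps)
    moreover have "edge_pt w b d half_edge - c = w * zeta d * (Complex (1/2) half_edge - 1)"
      unfolding c n_def edge_pt_def by (simp add: algebra_simps)
    ultimately show ?thesis by (simp add: zeta_add mult_ac)
  qed
  have "norm (edge_pt w b d half_edge - c) = 1 / sqrt 3" unfolding z by (simp add: norm_mult w norm_divide)
  moreover have "edge_pt w b d half_edge \<in> hex v c" using sh [of half_edge] h(1) unfolding v(2) support_ptile by simp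
  ultimately obtain e where "edge_pt w b d half_edge - c = of_real (1 / sqrt 3) * v * zeta e * cis (pi / 6)"
    using hex_radius(2) [OF v(1)] by blast
  then have "of_real (1 / sqrt 3) * cis (pi / 6) * (v * zeta e) = of_real (1 / sqrt 3) * cis (pi / 6) * (w * zeta (d + 2))"
    using z by (simp add: mult_ac)
  then have "v * zeta e = w * zeta (d + 2)" by simp
  then have "v * (zeta e * zeta (- e)) = w * (zeta (d + 2) * zeta (- e))" by (metis mult.assoc)
  moreover have "zeta e * zeta (- e) = 1" using zeta_add [of e "- e"] zeta_values(1) by simp
  ultimately have "v = w * zeta (d + 2 - e)" using zeta_add [of "d + 2" "- e"] by simp
  then show ?thesis using t(1) unfolding v(2) c n_def by blast
qed

section \<open>Heading map of a tiling\<close>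

definition pos :: "site \<Rightarrow> complex" where
  "pos x = of_int (fst x) + of_int (snd x) * zeta 1"

lemma pos_add: "pos (x + y) = pos x + pos y" and pos_diff: "pos (x - y) = pos x - pos y"
  and pos_0 [simp]: "pos 0 = 0"
  by (simp_all add: pos_def algebra_simps)

lemma pos_dir: "pos (dir d) = zeta d"
proof -
  have "zeta d = zeta (d mod 6)" by (rule zeta_cong) simp
  then show ?thesis
    by (cases d rule: mod6_cases) (simp_all add: dir_def pos_def zeta_values complex_eq_iff)
qed

lemma norm_form: "(a + c / 2)\<^sup>2 + (c * (sqrt 3 / 2))\<^sup>2 = a * a + a * c + c * (c :: real)"
proof -
  have "(c * (sqrt 3 / 2))\<^sup>2 = c\<^sup>2 * (3 / 4)" by (simp add: power_mult_distrib power_divide)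
  then show ?thesis by (simp add: power2_eq_square algebra_simps)
qed

lemma pos_norm: "(norm (pos x))\<^sup>2 = of_int (fst x * fst x + fst x * snd x + snd x * snd x)"
proof -
  have "Re (pos x) = of_int (fst x) + of_int (snd x) / 2" "Im (pos x) = of_int (snd x) * (sqrt 3 / 2)"
    by (simp_all add: pos_def zeta_values)
  then show ?thesis unfolding cmod_power2 by (simp only: norm_form of_int_add of_int_mult)
qed

lemma pos_norm_ge_1: assumes "x \<noteq> 0" shows "1 \<le> norm (pos x)"
proof -
  obtain i j where x: "x = (i,j)" by fastforce
  have "0 < i * i + i * j + j * j"
  proof -
    have e: "4 * (i * i + i * j + j * j) = (2 * i + j)\<^sup>2 + 3 * j\<^sup>2" by (simp add: power2_eq_square algebra_simps)
    have "0 < (2 * i + j)\<^sup>2 + 3 * j\<^sup>2"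
    proof (cases "j = 0")
      case True
      then have "i \<noteq> 0" using assms x by (simp add: zero_prod_def)
      then show ?thesis using True by simp
    next
      case False then show ?thesis by (simp add: add_nonneg_pos)
    qed
    then have "0 < 4 * (i * i + i * j + j * j)" unfolding e .
    then show ?thesis by simp
  qed
  then have "1 \<le> i * i + i * j + j * j" by linarith
  then have "(1::real) \<le> of_int (i * i + i * j + j * j)" by (simp only: of_int_1_le_iff)
  then have "1\<^sup>2 \<le> (norm (pos x))\<^sup>2" unfolding pos_norm x by simp
  then show ?thesis by (rule power2_le_imp_le) simp
qed

text \<open>
  Rounding both lattice coordinates leaves an error of squared length at most 3/4.
\<close>

lemma pos_near: "\<exists>x. norm (z - pos x) < 1"
proof -
  define t where "t = Im z / (sqrt 3 / 2)"
  define u where "u = Re z - t / 2"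
  define x where "x = (round u, round t)"
  define a where "a = u - of_int (round u)"
  define c where "c = t - of_int (round t)"
  have ac: "\<bar>a\<bar> \<le> 1/2" "\<bar>c\<bar> \<le> 1/2"
    using of_int_round_abs_le [of u] of_int_round_abs_le [of t] unfolding a_def c_def by linarith+
  have z: "Re z = u + t / 2" "Im z = t * (sqrt 3 / 2)" by (simp_all add: u_def t_def)
  have "Re (z - pos x) = a + c / 2" "Im (z - pos x) = c * (sqrt 3 / 2)"
    unfolding a_def c_def by (simp_all add: pos_def zeta_values x_def z algebra_simps diff_divide_distrib)
  then have "(norm (z - pos x))\<^sup>2 = a * a + a * c + c * c"
    unfolding cmod_power2 by (simp only: norm_form)
  moreover have "a * a \<le> 1/4" "c * c \<le> 1/4" "a * c \<le> 1/4"
  proof -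
    have "\<bar>a\<bar> * \<bar>a\<bar> \<le> 1/2 * (1/2)" "\<bar>c\<bar> * \<bar>c\<bar> \<le> 1/2 * (1/2)" "\<bar>a\<bar> * \<bar>c\<bar> \<le> 1/2 * (1/2)"
      using ac by (intro mult_mono; simp)+
    moreover have "a * c \<le> \<bar>a\<bar> * \<bar>c\<bar>" by (metis abs_ge_self abs_mult)
    ultimately show "a * a \<le> 1/4" "c * c \<le> 1/4" "a * c \<le> 1/4" by simp_all
  qed
  ultimately have "(norm (z - pos x))\<^sup>2 < 1" by linarith
  then have "norm (z - pos x) < 1" using one_le_power [of "norm (z - pos x)" 2] by (metis not_less)
  then show ?thesis by blast
qed

text \<open>
  The choice depends only on the set of admissible rotations at the site. Tilings that contain the
  same tiles at a site therefore get the same value there. The straight R1-segment ends on edge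
  4, hence the summand.
\<close>

definition heading :: "real \<Rightarrow> tile set \<Rightarrow> complex \<Rightarrow> complex \<Rightarrow> site \<Rightarrow> int" where
  "heading \<delta> T w b x = (SOME r. ptile \<delta> (w * zeta r) (b + w * pos x) \<in> T) + 4"

definition tile_at :: "real \<Rightarrow> tile set \<Rightarrow> complex \<Rightarrow> complex \<Rightarrow> site \<Rightarrow> tile" where
  "tile_at \<delta> T w b x = ptile \<delta> (w * zeta (heading \<delta> T w b x - 4)) (b + w * pos x)"

lemma tile_at_in:
  assumes T: "is_tiling \<delta> T" "ptile \<delta> w b \<in> T" and w: "norm w = 1"
  shows "tile_at \<delta> T w b x \<in> T"
proof -
  have "\<exists>r. ptile \<delta> (w * zeta r) (b + w * pos x) \<in> T"
  proof (rule lattice_induct [where c = 0])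
    show "\<exists>r. ptile \<delta> (w * zeta r) (b + w * pos 0) \<in> T" using T(2) zeta_values(1) by (intro exI [of _ 0]) simp
    fix x d assume "\<exists>r. ptile \<delta> (w * zeta r) (b + w * pos x) \<in> T"
    then obtain r where r: "ptile \<delta> (w * zeta r) (b + w * pos x) \<in> T" by blast
    obtain e where e: "ptile \<delta> (w * zeta r * zeta e) (b + w * pos x + w * zeta r * zeta (d - r)) \<in> T"
      using neighbour_tile [OF T(1) r, of "d - r"] w by (auto simp: norm_mult)
    have "zeta r * zeta (d - r) = zeta d" using zeta_add [of r "d - r"] by simp
    then have "b + w * pos x + w * zeta r * zeta (d - r) = b + w * pos (x + dir d)"
      by (simp add: pos_add pos_dir algebra_simps)
    moreover have "w * zeta r * zeta e = w * zeta (r + e)" by (simp add: zeta_add)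
    ultimately show "\<exists>r. ptile \<delta> (w * zeta r) (b + w * pos (x + dir d)) \<in> T" using e by metis
  qed
  from someI_ex [OF this] show ?thesis unfolding tile_at_def heading_def by simp
qed

lemma tile_is_site:
  assumes T: "is_tiling \<delta> T" "ptile \<delta> w b \<in> T" and w: "norm w = 1" and t: "t \<in> T"
  shows "\<exists>x. t = tile_at \<delta> T w b x"
proof -
  obtain v c where v: "norm v = 1" "t = ptile \<delta> v c" using tiling_tile [OF T(1) t] by blast
  have w0: "w \<noteq> 0" using w by auto
  obtain x where x: "norm ((c - b) / w - pos x) < 1" using pos_near by blast
  have "c - (b + w * pos x) = w * ((c - b) / w - pos x)" using w0 by (simp add: field_simps)
  then have "norm (c - (b + w * pos x)) < 1" using x by (simp add: norm_mult w)
  then have "t = tile_at \<delta> T w b x"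
    using centres_apart [OF T(1), of v c "w * zeta (heading \<delta> T w b x - 4)" "b + w * pos x"] v t
      tile_at_in [OF T w, of x] w unfolding tile_at_def by (force simp: norm_mult)
  then show ?thesis by blast
qed

section \<open>The rule R1 as validity of the heading map\<close>

lemma r1_point_eq: "r1_point \<delta> k = zeta (int k) * Complex (1/2) (edge_sign k * \<delta>)"
proof -
  have "Complex (1/2) y = of_real (1/2) + \<i> * of_real y" for y by (simp add: complex_eq_iff)
  then show ?thesis unfolding r1_point_def edge_mid_def edge_normal_zeta edge_tangent_zeta scaleR_conv_of_real
    by (simp add: algebra_simps)
qed

lemma r1_endpoints_ptile: "r1_endpoints (ptile \<delta> v c) = (\<lambda>k. edge_pt v c (int k) (edge_sign k * \<delta>)) ` {0,1,2,3,4,5}"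
proof -
  have "r1_endpoints (ptile \<delta> v c) = (\<lambda>z. v * z + c) ` (r1_point \<delta> ` {1,4,2,3,5,0})"
    unfolding r1_endpoints_def ptile_def map_tile_def monotile_def
    by (simp add: pathstart_compose pathfinish_compose Let_def insert_commute)
  also have "{1,4,2,3,5,0} = {0,1,2,3,4,5::nat}" by auto
  finally show ?thesis unfolding image_image r1_point_eq edge_pt_def by (simp add: algebra_simps)
qed

definition edge_set :: "complex \<Rightarrow> complex \<Rightarrow> int \<Rightarrow> complex set" where
  "edge_set v c k = edge_pt v c k ` {- half_edge .. half_edge}"

lemma half_edge_slack: "1/4 + sqrt 3 / 2 * half_edge = 1/2" by simp

lemma edge_set_face:
  assumes v: "norm v = 1"
  shows "edge_set v c k = hex v c \<inter> {z. (v * zeta k) \<bullet> z = 1/2 + (v * zeta k) \<bullet> c}"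
proof
  show "edge_set v c k \<subseteq> hex v c \<inter> {z. (v * zeta k) \<bullet> z = 1/2 + (v * zeta k) \<bullet> c}"
  proof
    fix z assume "z \<in> edge_set v c k"
    then obtain x where x0: "x \<in> {- half_edge .. half_edge}" and x2: "z = edge_pt v c k x" unfolding edge_set_def by blast
    have "\<bar>x\<bar> \<le> half_edge" using x0 unfolding atLeastAtMost_iff by linarith
    note x = this x2
    have n: "(z - c) \<bullet> (v * zeta k) = 1/2" unfolding x by (rule edge_pt_normal [OF v])
    have "(z - c) \<bullet> (v * zeta e) \<le> 1/2" for e
    proof (cases "e mod 6 = k mod 6")
      case True then show ?thesis using n zeta_cong [OF True] by simp
    next
      case False then show ?thesis using open_edge_slack [OF v x(1) False, of c] unfolding x(2) half_edge_slack by blast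
    qed
    moreover have "(v * zeta k) \<bullet> z = 1/2 + (v * zeta k) \<bullet> c" using n by (simp add: inner_diff_left inner_commute)
    ultimately show "z \<in> hex v c \<inter> {z. (v * zeta k) \<bullet> z = 1/2 + (v * zeta k) \<bullet> c}" using hex_iff [OF v] by blast
  qed
next
  show "hex v c \<inter> {z. (v * zeta k) \<bullet> z = 1/2 + (v * zeta k) \<bullet> c} \<subseteq> edge_set v c k"
  proof
    fix z assume z: "z \<in> hex v c \<inter> {z. (v * zeta k) \<bullet> z = 1/2 + (v * zeta k) \<bullet> c}"
    then have n: "(z - c) \<bullet> (v * zeta k) = 1/2" by (simp add: inner_diff_left inner_commute)
    define u where "u = (z - c) * cnj (v * zeta k)"
    have "(v * zeta k) * cnj (v * zeta k) = 1" by (rule mult_cnj_unit) (simp add: norm_mult v)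
    then have "(v * zeta k) * u = z - c" unfolding u_def by (metis mult.commute mult.left_commute mult.right_neutral)
    moreover have "Re u = 1/2" using n unfolding inner_as_Re u_def .
    then have "u = Complex (1/2) (Im u)" by (simp add: complex_eq_iff)
    ultimately have e: "z = edge_pt v c k (Im u)" unfolding edge_pt_def by (metis add.commute diff_add_cancel)
    have i: "(edge_pt v c k (Im u) - c) \<bullet> (v * zeta (k + j)) \<le> 1/2" for j using z hex_iff [OF v] e by blast
    have "1/4 + sqrt 3 / 2 * Im u \<le> 1/2" using i [of 1] unfolding edge_pt_inner [OF v] by (simp only: add_diff_cancel_left' edge_inner_values)
    moreover have "1/4 - sqrt 3 / 2 * Im u \<le> 1/2" using i [of 5] unfolding edge_pt_inner [OF v] by (simp only: add_diff_cancel_left' edge_inner_values)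
    ultimately have "\<bar>Im u\<bar> \<le> half_edge" by (simp add: abs_le_iff field_simps)
    then show "z \<in> edge_set v c k" unfolding edge_set_def e by (intro imageI) (simp add: abs_le_iff)
  qed
qed

lemma edge_set_edge: assumes v: "norm v = 1" shows "edge_set v c k edge_of hex v c"
  unfolding edge_of_def
proof
  show "edge_set v c k face_of hex v c" unfolding edge_set_face [OF v]
  proof (rule face_of_Int_supporting_hyperplane_le [OF hex_convex [OF v]])
    fix x assume "x \<in> hex v c"
    then show "(v * zeta k) \<bullet> x \<le> 1/2 + (v * zeta k) \<bullet> c" unfolding hex_alt [OF v] by blast
  qed
  let ?a = "edge_pt v c k (- half_edge)" and ?b = "edge_pt v c k half_edge"
  have h: "0 < half_edge" by simp
  have p: "edge_pt v c k x = (1 - u) *\<^sub>R ?a + u *\<^sub>R ?b" if "x = (2 * u - 1) * half_edge" for x u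
  proof -
    have "Complex (1/2) ((2 * u - 1) * h) = (1 - u) *\<^sub>R Complex (1/2) (- h) + u *\<^sub>R Complex (1/2) h" for h
      by (simp add: complex_eq_iff algebra_simps)
    from this [of half_edge] have "Complex (1/2) x = (1 - u) *\<^sub>R Complex (1/2) (- half_edge) + u *\<^sub>R Complex (1/2) half_edge"
      unfolding that .
    moreover have "c + n * ((1 - u) *\<^sub>R A + u *\<^sub>R B) = (1 - u) *\<^sub>R (c + n * A) + u *\<^sub>R (c + n * B)" for n A B
      by (simp add: algebra_simps)
    ultimately show ?thesis unfolding edge_pt_def by simp
  qed
  have "edge_set v c k = closed_segment ?a ?b"
  proof
    show "edge_set v c k \<subseteq> closed_segment ?a ?b"
    proof
      fix z assume "z \<in> edge_set v c k"
      then obtain x where x: "- half_edge \<le> x" "x \<le> half_edge" "z = edge_pt v c k x" unfolding edge_set_def by auto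
      define u where "u = (x / half_edge + 1) / 2"
      have "y = (2 * ((y / g + 1) / 2) - 1) * g" if "g \<noteq> 0" for y g :: real using that by (simp add: field_simps)
      from this [of half_edge x] have "x = (2 * u - 1) * half_edge" using h unfolding u_def by auto
      moreover have "0 \<le> u" "u \<le> 1"
        using x h divide_right_mono [OF x(1), of half_edge] divide_right_mono [OF x(2), of half_edge] unfolding u_def by simp_all
      ultimately show "z \<in> closed_segment ?a ?b" using p x(3) unfolding in_segment by blast
    qed
    show "closed_segment ?a ?b \<subseteq> edge_set v c k"
    proof
      fix z assume "z \<in> closed_segment ?a ?b"
      then obtain u where u: "0 \<le> u" "u \<le> 1" "z = (1 - u) *\<^sub>R ?a + u *\<^sub>R ?b" unfolding in_segment by blast
      have "-1 * half_edge \<le> (2 * u - 1) * half_edge" "(2 * u - 1) * half_edge \<le> 1 * half_edge"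
        using u h by (intro mult_right_mono; simp)+
      then show "z \<in> edge_set v c k" unfolding edge_set_def u(3) using p [OF refl, of u] by (intro image_eqI [of _ _ "(2 * u - 1) * half_edge"]) auto
    qed
  qed
  moreover have "?a \<noteq> ?b"
  proof
    assume "?a = ?b"
    then have "v * zeta k * Complex (1/2) (- half_edge) = v * zeta k * Complex (1/2) half_edge" unfolding edge_pt_def by simp
    moreover have "v * zeta k \<noteq> 0" using v norm_zeta by (metis mult_eq_0_iff norm_zero zero_neq_one)
    ultimately have "- half_edge = half_edge" by (simp add: complex_eq_iff)
    then show False using h by linarith
  qed
  ultimately show "aff_dim (edge_set v c k) = 1"
    by (simp add: segment_convex_hull aff_dim_convex_hull aff_dim_2)
qed

text \<open>
  An R1-endpoint is at distance \<open>\<delta>\<close> from the midpoint of its edge, hence interior to it and on no other edge.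
\<close>

lemma r1_endpoint_on_edge:
  assumes v: "norm v = 1" and d: "0 < \<delta>" "\<delta> < half_edge" and k: "k mod 6 = int m" "m < 6"
  shows "r1_endpoints (ptile \<delta> v c) \<inter> edge_set v c k = {edge_pt v c k (edge_sign m * \<delta>)}"
proof -
  have sg: "\<bar>edge_sign j\<bar> = 1" if "j \<in> {0,1,2,3,4,5}" for j using that by (auto simp: edge_sign_def)
  have ab: "\<bar>edge_sign j * \<delta>\<bar> = \<delta>" if "j \<in> {0,1,2,3,4,5}" for j using sg [OF that] d by (simp add: abs_mult)
  have m: "m \<in> {0,1,2,3,4,5}" using k(2) by auto
  have e: "edge_pt v c (int m) = edge_pt v c k" 
  proof -
    have "zeta (int m) = zeta k" by (rule zeta_cong) (use k in simp)
    then show ?thesis by (simp add: edge_pt_def fun_eq_iff)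
  qed
  show ?thesis
  proof (intro equalityI subsetI)
    fix z assume z: "z \<in> r1_endpoints (ptile \<delta> v c) \<inter> edge_set v c k"
    then obtain j where j: "j \<in> {0,1,2,3,4,5}" "z = edge_pt v c (int j) (edge_sign j * \<delta>)"
      unfolding r1_endpoints_ptile by blast
    have n: "(z - c) \<bullet> (v * zeta k) = 1/2" using z edge_pt_normal [OF v] unfolding edge_set_def by auto
    have "j = m"
    proof (rule ccontr)
      assume "j \<noteq> m"
      moreover have "int j mod 6 = int j" using j(1) by auto
      ultimately have "k mod 6 \<noteq> int j mod 6" using k by simp
      then have "(z - c) \<bullet> (v * zeta k) \<le> 1/4 + sqrt 3 / 2 * \<delta>"
        unfolding j(2) by (intro open_edge_slack [OF v]) (use ab [OF j(1)] in simp_all)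
      moreover have "sqrt 3 / 2 * \<delta> < sqrt 3 / 2 * half_edge" by (rule mult_strict_left_mono [OF d(2)]) simp
      ultimately show False using n half_edge_slack by linarith
    qed
    then show "z \<in> {edge_pt v c k (edge_sign m * \<delta>)}" using j(2) e by simp
  next
    fix z assume "z \<in> {edge_pt v c k (edge_sign m * \<delta>)}"
    then have z: "z = edge_pt v c k (edge_sign m * \<delta>)" by simp
    have "z \<in> r1_endpoints (ptile \<delta> v c)" 
      unfolding r1_endpoints_ptile z by (rule image_eqI [of _ _ m]) (use m e in simp_all)
    moreover have "z \<in> edge_set v c k" unfolding z edge_set_def
      by (rule imageI) (use ab [OF m] d in \<open>auto simp: abs_le_iff\<close>)
    ultimately show "z \<in> r1_endpoints (ptile \<delta> v c) \<inter> edge_set v c k" by blast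
  qed
qed

lemma edge_sign_out: "k mod 6 = int m \<Longrightarrow> m < 6 \<Longrightarrow> edge_sign m = (if out (k - 4) then 1 else -1)"
  "k mod 6 = int m \<Longrightarrow> m < 6 \<Longrightarrow> edge_sign m = (if inn (k - 1) then -1 else 1)"
proof -
  assume k: "k mod 6 = int m" "m < 6"
  have "out (k - 4) = out (int m - 4)" "inn (k - 1) = inn (int m - 1)"
    by (intro out_cong inn_cong mod_diff_cong; use k in simp)+
  moreover have "m = 0 \<or> m = 1 \<or> m = 2 \<or> m = 3 \<or> m = 4 \<or> m = 5" using k(2) by auto
  ultimately show "edge_sign m = (if out (k - 4) then 1 else -1)" "edge_sign m = (if inn (k - 1) then -1 else 1)"
    by (elim disjE; simp add: edge_sign_def)+
qed

theorem R1_valid: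
  assumes T: "is_tiling \<delta> T" "ptile \<delta> w b \<in> T" and w: "norm w = 1" and d: "0 < \<delta>" "\<delta> < half_edge" and R: "R1 T"
  shows "valid (heading \<delta> T w b)"
  unfolding valid_def
proof (intro allI)
  fix x d
  let ?s = "heading \<delta> T w b"
  define y where "y = x + dir d"
  define v where "v = w * zeta (?s x - 4)"
  define v' where "v' = w * zeta (?s y - 4)"
  define c where "c = b + w * pos x"
  define c' where "c' = b + w * pos y"
  define k where "k = d - (?s x - 4)"
  define k' where "k' = d + 3 - (?s y - 4)"
  have nv: "norm v = 1" "norm v' = 1" by (simp_all add: v_def v'_def norm_mult w)
  have t: "ptile \<delta> v c \<in> T" "ptile \<delta> v' c' \<in> T" using tile_at_in [OF T w] by (simp_all add: tile_at_def v_def v'_def c_def c'_def)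
  have vk: "v * zeta k = w * zeta d" using zeta_add [of "?s x - 4" k] by (simp add: v_def k_def)
  have "(?s y - 4) + k' = d + 3" by (simp add: k'_def)
  then have "zeta (?s y - 4) * zeta k' = - zeta d" using zeta_add [of "?s y - 4" k'] zeta_opp [of d] by metis
  then have vk': "v' * zeta k' = - (w * zeta d)" by (simp add: v'_def mult.assoc)
  have cc: "c' = c + w * zeta d" by (simp add: c_def c'_def y_def pos_add pos_dir algebra_simps)
  have pt: "edge_pt v' c' k' \<tau> = edge_pt v c k (- \<tau>)" for \<tau>
  proof -
    have e: "Complex (1/2) (- \<tau>) = 1 - Complex (1/2) \<tau>" by (simp add: complex_eq_iff)
    show ?thesis unfolding edge_pt_def vk vk' cc e by (simp add: algebra_simps)
  qed
  have es: "edge_set v' c' k' = edge_set v c k"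
  proof -
    have "edge_set v' c' k' = (\<lambda>\<tau>. edge_pt v c k (- \<tau>)) ` {- half_edge..half_edge}" unfolding edge_set_def pt ..
    also have "\<dots> = edge_pt v c k ` (uminus ` {- half_edge..half_edge})" by (simp only: image_image)
    also have "uminus ` {- half_edge..half_edge} = {- half_edge..half_edge}" by (simp only: image_uminus_atLeastAtMost minus_minus)
    finally show ?thesis unfolding edge_set_def .
  qed
  define m where "m = nat (k mod 6)"
  define m' where "m' = nat (k' mod 6)"
  have m: "k mod 6 = int m" "m < 6" "k' mod 6 = int m'" "m' < 6" by (auto simp: m_def m'_def)
  have "r1_endpoints (ptile \<delta> v c) \<inter> edge_set v c k = r1_endpoints (ptile \<delta> v' c') \<inter> edge_set v c k"
  proof -
    have "edge_set v c k edge_of support (ptile \<delta> v c)" unfolding support_ptile by (rule edge_set_edge [OF nv(1)])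
    moreover have "edge_set v c k edge_of support (ptile \<delta> v' c')" unfolding support_ptile es [symmetric] by (rule edge_set_edge [OF nv(2)])
    ultimately show ?thesis using R t unfolding R1_def by blast
  qed
  then have "edge_pt v c k (edge_sign m * \<delta>) = edge_pt v c k (- (edge_sign m' * \<delta>))"
    using r1_endpoint_on_edge [OF nv(1) assms(4,5) m(1,2), of c] r1_endpoint_on_edge [OF nv(2) assms(4,5) m(3,4), of c']
    unfolding es pt by simp
  then have "(v * zeta k) * Complex (1/2) (edge_sign m * \<delta>) = (v * zeta k) * Complex (1/2) (- (edge_sign m' * \<delta>))"
    unfolding edge_pt_def by simp
  moreover have "v * zeta k \<noteq> 0" using nv norm_zeta by (metis mult_eq_0_iff norm_zero zero_neq_one)
  ultimately have "Complex (1/2) (edge_sign m * \<delta>) = Complex (1/2) (- (edge_sign m' * \<delta>))"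
    unfolding mult_cancel_left by simp
  then have "edge_sign m * \<delta> = - (edge_sign m' * \<delta>)" by simp
  then have "edge_sign m * \<delta> = (- edge_sign m') * \<delta>" by simp
  moreover have "\<delta> \<noteq> 0" using assms(4) by simp
  ultimately have "edge_sign m = - edge_sign m'" by (metis mult_right_cancel)
  then have "out (k - 4) = inn (k' - 1)" using edge_sign_out(1) [OF m(1,2)] edge_sign_out(2) [OF m(3,4)] by (auto split: if_splits)
  moreover have "k - 4 = d - ?s x" by (simp add: k_def)
  moreover have "inn (k' - 1) = inn (d - ?s y)" by (rule inn_cong) (simp add: k'_def mod_eq_dvd_iff)
  ultimately show "out (d - ?s x) = inn (d - ?s (x + dir d))" by (simp add: y_def)
qed

section \<open>The rule R2 as merging of orbits\<close>

text \<open>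
  Directions relative to the heading in which the R2-tree has an arm.
\<close>

definition arm :: "int \<Rightarrow> bool" where "arm k \<longleftrightarrow> k mod 6 \<in> {0,2,3,5}"

lemma r2_tree_ptile:
  "r2_tree (ptile \<delta> v c) = {c + v * zeta k * of_real \<tau> | k \<tau>. k \<in> {0,1,3,4} \<and> 0 \<le> \<tau> \<and> \<tau> \<le> 1/2}"
proof -
  have seg: "closed_segment 0 (edge_mid k) = (\<lambda>\<tau>. zeta (int k) * of_real \<tau>) ` {0..1/2}" for k
  proof (intro equalityI subsetI)
    fix z assume "z \<in> closed_segment 0 (edge_mid k)"
    then obtain u where u: "0 \<le> u" "u \<le> 1" "z = u *\<^sub>R edge_mid k" unfolding in_segment by auto
    then have "z = zeta (int k) * of_real (u / 2)" by (simp add: edge_mid_def edge_normal_zeta scaleR_conv_of_real)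
    then show "z \<in> (\<lambda>\<tau>. zeta (int k) * of_real \<tau>) ` {0..1/2}" using u by (intro image_eqI [of _ _ "u / 2"]) auto
  next
    fix z assume "z \<in> (\<lambda>\<tau>. zeta (int k) * of_real \<tau>) ` {0..1/2}"
    then obtain \<tau> where t: "0 \<le> \<tau>" "\<tau> \<le> 1/2" "z = zeta (int k) * of_real \<tau>" by auto
    then have "z = (1 - 2 * \<tau>) *\<^sub>R 0 + (2 * \<tau>) *\<^sub>R edge_mid k" by (simp add: edge_mid_def edge_normal_zeta scaleR_conv_of_real)
    then show "z \<in> closed_segment 0 (edge_mid k)" unfolding in_segment using t by (intro exI [of _ "2 * \<tau>"]) simp
  qed
  have "r2_tree (ptile \<delta> v c) = (\<lambda>z. v * z + c) ` (\<Union>k\<in>{0,1,3,4}. closed_segment 0 (edge_mid k))"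
    by (simp add: ptile_def map_tile_def monotile_def)
  also have "\<dots> = (\<Union>k\<in>{0,1,3,4}. (\<lambda>\<tau>. c + v * zeta (int k) * of_real \<tau>) ` {0..1/2})"
    unfolding seg image_UN image_image by (simp add: algebra_simps)
  also have "\<dots> = {c + v * zeta k * of_real \<tau> | k \<tau>. k \<in> {0,1,3,4} \<and> 0 \<le> \<tau> \<and> \<tau> \<le> 1/2}"
    by fastforce
  finally show ?thesis .
qed

definition tree :: "complex \<Rightarrow> complex \<Rightarrow> (site \<Rightarrow> int) \<Rightarrow> site \<Rightarrow> complex set" where
  "tree w b s x = {b + w * (pos x + of_real \<tau> * zeta d) | d \<tau>. arm (d - s x) \<and> 0 \<le> \<tau> \<and> \<tau> \<le> 1/2}"

lemma tree_of_tile_at: "r2_tree (tile_at \<delta> T w b x) = tree w b (heading \<delta> T w b) x"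
proof -
  let ?s = "heading \<delta> T w b x"
  have key: "zeta (?s - 4) * zeta k = zeta (?s - 4 + k)" for k by (simp only: zeta_add)
  have arm4: "arm (k - 4)" if "k \<in> {0,1,3,4}" for k using that by (auto simp: arm_def)
  have kback: "\<exists>k\<in>{0,1,3,4}. zeta k = zeta (d - (?s - 4))" if "arm (d - ?s)" for d
  proof -
    have "(d - ?s) mod 6 \<in> {0,2,3,5}" using that by (simp add: arm_def)
    define j where "j = (d - ?s) mod 6"
    have j: "j \<in> {0,2,3,5::int}" "(d - ?s) mod 6 = j" using \<open>(d - ?s) mod 6 \<in> {0,2,3,5}\<close> unfolding j_def by simp_all
    have "(d - (?s - 4)) mod 6 = (j + 4) mod 6"
    proof -
      have "(d - ?s) mod 6 = j mod 6" by (simp add: j_def)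
      then have "(d - ?s + 4) mod 6 = (j + 4) mod 6" by (rule mod_add_cong) simp
      then show ?thesis by (simp add: algebra_simps)
    qed
    then have o: "zeta (d - (?s - 4)) = zeta ((j + 4) mod 6)" by (intro zeta_cong) simp
    have "(j + 4) mod 6 \<in> {0,1,3,4}" using j(1) by auto
    then show ?thesis using o by (intro bexI [of _ "(j + 4) mod 6"]) simp_all
  qed
  have e: "b + w * pos x + w * zeta (?s - 4) * zeta k * of_real \<tau> = b + w * (pos x + of_real \<tau> * zeta (?s - 4 + k))" for k \<tau>
    unfolding key [symmetric] distrib_left by (simp only: add.assoc mult.assoc mult.commute [of "of_real \<tau>"])
  show ?thesis unfolding tile_at_def r2_tree_ptile tree_def e
  proof (intro equalityI subsetI)
    fix z assume "z \<in> {b + w * (pos x + of_real \<tau> * zeta (?s - 4 + k)) | k \<tau>. k \<in> {0,1,3,4} \<and> 0 \<le> \<tau> \<and> \<tau> \<le> 1/2}"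
    then obtain k \<tau> where z: "z = b + w * (pos x + of_real \<tau> * zeta (?s - 4 + k))" "k \<in> {0,1,3,4}" "0 \<le> \<tau>" "\<tau> \<le> 1/2" by blast
    have "arm ((?s - 4 + k) - ?s)" using arm4 [OF z(2)] by (simp add: algebra_simps)
    then show "z \<in> {b + w * (pos x + of_real \<tau> * zeta d) | d \<tau>. arm (d - ?s) \<and> 0 \<le> \<tau> \<and> \<tau> \<le> 1/2}" using z by blast
  next
    fix z assume "z \<in> {b + w * (pos x + of_real \<tau> * zeta d) | d \<tau>. arm (d - ?s) \<and> 0 \<le> \<tau> \<and> \<tau> \<le> 1/2}"
    then obtain d \<tau> where z: "z = b + w * (pos x + of_real \<tau> * zeta d)" "arm (d - ?s)" "0 \<le> \<tau>" "\<tau> \<le> 1/2" by blast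
    obtain k where k: "k \<in> {0,1,3,4}" "zeta k = zeta (d - (?s - 4))" using kback [OF z(2)] by blast
    have "zeta (?s - 4 + k) = zeta (?s - 4) * zeta (d - (?s - 4))" unfolding zeta_add k(2) ..
    also have "\<dots> = zeta d" using zeta_add [of "?s - 4" "d - (?s - 4)"] by simp
    finally have eq: "zeta (?s - 4 + k) = zeta d" .
    show "z \<in> {b + w * (pos x + of_real \<tau> * zeta (?s - 4 + k)) | k \<tau>. k \<in> {0,1,3,4} \<and> 0 \<le> \<tau> \<and> \<tau> \<le> 1/2}"
      unfolding mem_Collect_eq by (rule exI [of _ k], rule exI [of _ \<tau>]) (simp only: eq z k simp_thms)
  qed
qed

lemma centre_in_tree: "b + w * pos x \<in> tree w b s x"
proof -
  show ?thesis unfolding tree_def mem_Collect_eq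
    by (intro exI [of _ "s x"] exI [of _ 0]) (simp add: arm_def)
qed

lemma tree_connected: "connected (tree w b s x)"
proof -
  let ?c = "b + w * pos x"
  have seg: "closed_segment ?c y \<subseteq> tree w b s x" if y: "y \<in> tree w b s x" for y
  proof
    obtain d \<tau> where d: "y = b + w * (pos x + of_real \<tau> * zeta d)" "arm (d - s x)" "0 \<le> \<tau>" "\<tau> \<le> 1/2"
      using y unfolding tree_def by blast
    fix z assume "z \<in> closed_segment ?c y"
    then obtain u where u: "0 \<le> u" "u \<le> 1" "z = (1 - u) *\<^sub>R ?c + u *\<^sub>R y" unfolding in_segment by blast
    have "z = b + w * (pos x + of_real (u * \<tau>) * zeta d)" unfolding u(3) d(1) by (simp add: scaleR_conv_of_real algebra_simps)
    moreover have "0 \<le> u * \<tau>" "u * \<tau> \<le> 1/2" using u d mult_mono [of u 1 \<tau> "1/2"] by auto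
    ultimately show "z \<in> tree w b s x" unfolding tree_def using d(2) by blast
  qed
  let ?S = "closed_segment ?c ` tree w b s x"
  have "connected (\<Union>?S)"
  proof (rule connected_Union)
    have "?c \<in> \<Inter>?S" by simp
    then show "\<Inter>?S \<noteq> {}" by blast
  qed auto
  moreover have "\<Union>?S = tree w b s x" using seg by force
  ultimately show ?thesis by simp
qed

lemma tree_closed: "closed (tree w b s x)"
proof -
  have "tree w b s x = (\<Union>d\<in>{d \<in> {0..<6}. arm (d - s x)}. (\<lambda>\<tau>. b + w * (pos x + of_real \<tau> * zeta d)) ` {0..1/2})"
  proof (intro equalityI subsetI)
    fix z assume "z \<in> tree w b s x"
    then obtain d \<tau> where z: "z = b + w * (pos x + of_real \<tau> * zeta d)" "arm (d - s x)" "0 \<le> \<tau>" "\<tau> \<le> 1/2" unfolding tree_def by blast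
    have "zeta d = zeta (d mod 6)" by (rule zeta_cong) simp
    moreover have "arm (d mod 6 - s x)" using z(2) by (simp add: arm_def mod_diff_left_eq)
    ultimately show "z \<in> (\<Union>d\<in>{d \<in> {0..<6}. arm (d - s x)}. (\<lambda>\<tau>. b + w * (pos x + of_real \<tau> * zeta d)) ` {0..1/2})"
      using z by (intro UN_I [of "d mod 6"]) auto
  next
    fix z assume "z \<in> (\<Union>d\<in>{d \<in> {0..<6}. arm (d - s x)}. (\<lambda>\<tau>. b + w * (pos x + of_real \<tau> * zeta d)) ` {0..1/2})"
    then obtain d \<tau> where "arm (d - s x)" "\<tau> \<in> {0..1/2::real}" "z = b + w * (pos x + of_real \<tau> * zeta d)" by blast
    then show "z \<in> tree w b s x" unfolding tree_def atLeastAtMost_iff mem_Collect_eq by blast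
  qed
  moreover have "closed (\<Union>d\<in>{d \<in> {0..<6}. arm (d - s x)}. (\<lambda>\<tau>. b + w * (pos x + of_real \<tau> * zeta d)) ` {0..1/2::real})"
  proof (rule closed_UN)
    show "finite {d \<in> {0..<6}. arm (d - s x)}" by (rule finite_subset [of _ "{0..<6}"]) auto
    show "\<forall>d\<in>{d \<in> {0..<6}. arm (d - s x)}. closed ((\<lambda>\<tau>. b + w * (pos x + of_real \<tau> * zeta d)) ` {0..1/2::real})"
      by (intro ballI compact_imp_closed compact_continuous_image continuous_intros) simp
  qed
  ultimately show ?thesis by simp
qed

lemma tree_bounded: assumes "norm w = 1" "z \<in> tree w b s x" shows "norm (z - (b + w * pos x)) \<le> 1/2"
  using assms unfolding tree_def by (auto simp: norm_mult algebra_simps)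

lemma zeta_inj: "zeta d = zeta e \<Longrightarrow> d mod 6 = e mod 6"
proof -
  assume "zeta d = zeta e"
  then have "zeta (d - e) = 1" using zeta_add [of e "d - e"] zeta_add [of "-e" e] zeta_values(1)
    by (metis add.commute add.left_inverse diff_add_cancel mult.commute zeta_add uminus_add_conv_diff)
  moreover have "zeta (d - e) = zeta ((d - e) mod 6)" by (rule zeta_cong) simp
  ultimately have "zeta ((d - e) mod 6) = 1" by simp
  then have "(d - e) mod 6 = 0" by (cases "d - e" rule: mod6_cases) (auto simp: zeta_values complex_eq_iff)
  then show ?thesis by (simp add: mod_eq_dvd_iff mod_0_imp_dvd)
qed

text \<open>
  Trees of different tiles can only meet in the midpoint of a common edge. If both tiles have
  an arm there, R1 leaves only the case that one of them heads across that edge.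
\<close>

lemma trees_meet:
  assumes s: "valid s" and w: "norm w = 1" and z: "z \<in> tree w b s x" "z \<in> tree w b s y" and xy: "x \<noteq> y"
  shows "step s x = y \<or> step s y = x"
proof -
  have w0: "w \<noteq> 0" using w by auto
  obtain d \<tau> where d: "z = b + w * (pos x + of_real \<tau> * zeta d)" "arm (d - s x)" "0 \<le> \<tau>" "\<tau> \<le> 1/2" using z(1) unfolding tree_def by blast
  obtain e \<sigma> where e: "z = b + w * (pos y + of_real \<sigma> * zeta e)" "arm (e - s y)" "0 \<le> \<sigma>" "\<sigma> \<le> 1/2" using z(2) unfolding tree_def by blast
  have "pos x + of_real \<tau> * zeta d = pos y + of_real \<sigma> * zeta e" using d(1) e(1) w0 by simp
  then have p: "pos (y - x) = of_real \<tau> * zeta d - of_real \<sigma> * zeta e" by (simp add: pos_diff algebra_simps)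
  have "norm (pos (y - x)) \<le> norm (of_real \<tau> * zeta d) + norm (of_real \<sigma> * zeta e)" unfolding p by (rule norm_triangle_ineq4)
  also have "\<dots> = \<tau> + \<sigma>" using d e by (simp add: norm_mult)
  finally have le: "norm (pos (y - x)) \<le> \<tau> + \<sigma>" .
  have ge: "1 \<le> norm (pos (y - x))" using xy by (intro pos_norm_ge_1) simp
  have t: "\<tau> = 1/2" "\<sigma> = 1/2" using le ge d e by linarith+
  have p2: "2 * pos (y - x) = zeta d - zeta e" unfolding p t by simp
  have "2 \<le> norm (2 * pos (y - x))" using ge by (simp add: norm_mult)
  then have n: "2 \<le> norm (zeta d - zeta e)" unfolding p2 .
  have par: "(norm (a + c))\<^sup>2 + (norm (a - c))\<^sup>2 = 2 * (norm a)\<^sup>2 + 2 * (norm c)\<^sup>2" for a c :: complex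
    unfolding cmod_power2 by (simp add: power2_eq_square algebra_simps)
  have "2\<^sup>2 \<le> (norm (zeta d - zeta e))\<^sup>2" using n by (intro power_mono) auto
  then have "4 \<le> (norm (zeta d - zeta e))\<^sup>2" by simp
  moreover have "(norm (zeta d + zeta e))\<^sup>2 + (norm (zeta d - zeta e))\<^sup>2 = 4" using par [of "zeta d" "zeta e"] by simp
  ultimately have "(norm (zeta d + zeta e))\<^sup>2 \<le> 0" by linarith
  then have "zeta d + zeta e = 0" by simp
  then have oe: "zeta e = zeta (d + 3)" by (simp add: zeta_opp eq_neg_iff_add_eq_0 add.commute)
  then have ed: "e mod 6 = (d + 3) mod 6" by (rule zeta_inj)
  have "2 * pos (y - x) = 2 * zeta d" using p2 oe zeta_opp [of d] by simp
  then have "pos (y - x) = pos (dir d)" by (simp add: pos_dir)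
  then have "pos (y - x - dir d) = 0" by (simp add: pos_diff)
  then have "y - x - dir d = 0" using pos_norm_ge_1 [of "y - x - dir d"] by force
  then have y: "y = x + dir d" by (simp add: algebra_simps)
  have v: "out (d - s x) = inn (d - s y)" unfolding y by (rule validD [OF s])
  show ?thesis
  proof (cases "(d - s x) mod 6 = 0")
    case True
    then have "dir (s x) = dir d" using mod6_0_iff [of "s x" d] dir_cong [of "s x" d] by simp
    then show ?thesis by (simp add: step_def y)
  next
    case False
    then have "\<not> out (d - s x)" using d(2) by (auto simp: arm_def out_def)
    then have "\<not> inn (d - s y)" using v by simp
    moreover have "arm (d + 3 - s y)"
    proof -
      have "(d + 3 - s y) mod 6 = (e - s y) mod 6" by (rule mod_diff_cong) (use ed in simp_all)
      then show ?thesis using e(2) by (simp add: arm_def)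
    qed
    moreover have "(d + 3 - s y) mod 6 = ((d - s y) mod 6 + 3) mod 6"
      by (metis mod_add_left_eq diff_add_eq)
    ultimately have "(d - s y) mod 6 = 3"
      by (cases "d - s y" rule: mod6_cases) (simp_all add: arm_def inn_def)
    then have "d mod 6 = (s y + 3) mod 6" using sub_mod6_iff [of d "s y" 3] by simp
    then have "dir d = - dir (s y)" using dir_cong [of d "s y + 3"] dir_opp [of "s y"] by simp
    then have "y + dir (s y) = y - dir d" by simp
    also have "\<dots> = x" using y by simp
    finally show ?thesis by (simp only: step_def simp_thms)
  qed
qed

lemma trees_touch:
  assumes s: "valid s" shows "tree w b s x \<inter> tree w b s (step s x) \<noteq> {}"
proof -
  let ?d = "s x" and ?y = "step s x"
  let ?z = "b + w * (pos x + of_real (1/2) * zeta ?d)"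
  have "arm (?d - s x)" by (simp add: arm_def)
  then have "?z \<in> tree w b s x" unfolding tree_def mem_Collect_eq
    by (intro exI [of _ ?d] exI [of _ "1/2"]) simp
  moreover have "?z \<in> tree w b s ?y"
  proof -
    have "out (?d - s x) = inn (?d - s ?y)" unfolding step_def by (rule validD [OF s])
    then have i: "inn (?d - s ?y)" by simp
    have "(?d + 3 - s ?y) mod 6 = ((?d - s ?y) mod 6 + 3) mod 6" by (metis mod_add_left_eq diff_add_eq)
    then have a: "arm (?d + 3 - s ?y)" using i by (auto simp: inn_def arm_def)
    have "pos ?y + of_real (1/2) * zeta (?d + 3) = pos x + of_real (1/2) * zeta ?d"
      by (simp add: step_def pos_add pos_dir zeta_opp)
    then have "?z = b + w * (pos ?y + of_real (1/2) * zeta (?d + 3))" by simp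
    then show ?thesis unfolding tree_def mem_Collect_eq using a
      by (intro exI [of _ "?d + 3"] exI [of _ "1/2"]) simp
  qed
  ultimately show ?thesis by blast
qed

lemma finite_sites: "finite {x. norm (pos x - z) \<le> r}"
proof -
  have inj: "inj_on pos A" for A
  proof (rule inj_onI)
    fix x y assume "pos x = pos y"
    then have "pos (x - y) = 0" by (simp add: pos_diff)
    then show "x = y" using pos_norm_ge_1 [of "x - y"] by force
  qed
  have "finite (pos ` {x. norm (pos x - z) \<le> r})"
  proof (rule separated_finite)
    fix u v assume "u \<in> pos ` {x. norm (pos x - z) \<le> r}" "v \<in> pos ` {x. norm (pos x - z) \<le> r}" "u \<noteq> v"
    then obtain x y where "u = pos x" "v = pos y" "x \<noteq> y" by blast
    then show "1 \<le> norm (u - v)" using pos_norm_ge_1 [of "x - y"] by (simp add: pos_diff)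
  next
    show "pos ` {x. norm (pos x - z) \<le> r} \<subseteq> cball z r" by (auto simp: dist_norm norm_minus_commute)
  qed
  then show ?thesis by (rule finite_imageD [OF _ inj])
qed

text \<open>
  The family of trees is locally finite.
\<close>

lemma union_trees_closed:
  assumes w: "norm w = 1" shows "closed (\<Union>x\<in>K. tree w b s x)"
proof -
  have w0: "w \<noteq> 0" using w by auto
  let ?U = "\<Union>x\<in>K. tree w b s x"
  have "\<exists>V. open V \<and> z \<in> V \<and> V \<subseteq> - ?U" if z: "z \<notin> ?U" for z
  proof -
    let ?N = "{x. norm (pos x - (z - b) / w) \<le> 2}"
    let ?V = "ball z 1 - (\<Union>x\<in>K \<inter> ?N. tree w b s x)"
    have "closed (\<Union>x\<in>K \<inter> ?N. tree w b s x)"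
      by (intro closed_UN ballI tree_closed) (simp add: finite_sites)
    then have "open ?V" by (simp add: open_Diff)
    moreover have "z \<in> ?V" using z by auto
    moreover have "?V \<subseteq> - ?U"
    proof
      fix y assume y: "y \<in> ?V"
      have "y \<notin> tree w b s x" if x: "x \<in> K" for x
      proof
        assume t: "y \<in> tree w b s x"
        have "norm (y - (b + w * pos x)) \<le> 1/2" by (rule tree_bounded [OF w t])
        moreover have "norm (z - y) < 1" using y by (simp add: dist_norm)
        ultimately have "norm (z - (b + w * pos x)) \<le> 2"
        proof -
          have "z - (b + w * pos x) = (z - y) + (y - (b + w * pos x))" by simp
          then have "norm (z - (b + w * pos x)) \<le> norm (z - y) + norm (y - (b + w * pos x))" by (metis norm_triangle_ineq)
          then show ?thesis using \<open>norm (y - (b + w * pos x)) \<le> 1/2\<close> \<open>norm (z - y) < 1\<close> by linarith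
        qed
        moreover have "norm (z - (b + w * pos x)) = norm (w * (pos x - (z - b) / w))"
        proof -
          have "w * (pos x - (z - b) / w) = - (z - (b + w * pos x))" using w0 by (simp add: field_simps)
          then show ?thesis by (simp only: norm_minus_cancel)
        qed
        ultimately have "x \<in> ?N" by (simp add: norm_mult w)
        then show False using y t x by blast
      qed
      then show "y \<in> - ?U" by blast
    qed
    ultimately show ?thesis by blast
  qed
  then have "open (- ?U)" by (subst open_subopen) blast
  then show ?thesis by (simp add: closed_def)
qed

lemma R2_union_trees:
  assumes T: "is_tiling \<delta> T" "ptile \<delta> w b \<in> T" and w: "norm w = 1"
  shows "R2_union T = (\<Union>x. tree w b (heading \<delta> T w b) x)"
proof -
  have "T = range (tile_at \<delta> T w b)" using tile_at_in [OF T w] tile_is_site [OF T w] by blast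
  then have "R2_union T = (\<Union>x. r2_tree (tile_at \<delta> T w b x))" unfolding R2_union_def by (metis image_image)
  then show ?thesis by (simp add: tree_of_tile_at)
qed

text \<open>
  The trees of a class and those of the other classes form two disjoint closed sets.
\<close>

theorem R2_conn:
  assumes T: "is_tiling \<delta> T" "ptile \<delta> w b \<in> T" and w: "norm w = 1" and v: "valid (heading \<delta> T w b)" and R: "R2 T"
  shows "conn (heading \<delta> T w b)"
  unfolding conn_def
proof (intro allI, rule ccontr)
  let ?s = "heading \<delta> T w b"
  fix x0 y0 assume no: "\<not> link ?s x0 y0"
  let ?K = "{x. link ?s x0 x}"
  let ?A = "\<Union>x\<in>?K. tree w b ?s x" and ?B = "\<Union>x\<in>- ?K. tree w b ?s x"
  have c: "closed ?A" "closed ?B" by (rule union_trees_closed [OF w])+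
  have U: "R2_union T = ?A \<union> ?B" unfolding R2_union_trees [OF T w] by blast
  have dis: "?A \<inter> ?B = {}"
  proof (rule ccontr)
    assume "?A \<inter> ?B \<noteq> {}"
    then obtain z x y where z: "x \<in> ?K" "y \<notin> ?K" "z \<in> tree w b ?s x" "z \<in> tree w b ?s y" by blast
    then have "x \<noteq> y" by blast
    then have "step ?s x = y \<or> step ?s y = x" using trees_meet [OF v w z(3,4)] by blast
    then have "link ?s x y" using link_step link_sym by metis
    then show False using z(1,2) link_trans by blast
  qed
  have "b + w * pos x0 \<in> ?A" using centre_in_tree [of b w x0 ?s] link_refl by blast
  moreover have "b + w * pos y0 \<in> ?B" using centre_in_tree [of b w y0 ?s] no by blast
  moreover have "connected (?A \<union> ?B)" using R U unfolding R2_def by simp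
  moreover have False if "closed A" "closed B" "connected (A \<union> B)" "A \<inter> B = {}" "p \<in> A" "q \<in> B"
    for A B :: "complex set" and p q
    using connected_closedD [of "A \<union> B" A B] that by auto
  ultimately show False using c dis by blast
qed

section \<open>Tilings in the continuous hull\<close>

definition shift :: "complex \<Rightarrow> tile \<Rightarrow> tile" where "shift v = map_tile (\<lambda>z. z + v)"

lemma translate_shift: "translate v T = shift v ` T"
  by (simp add: translate_def shift_def)

lemma map_tile_comp: "map_tile f (map_tile g t) = map_tile (f \<circ> g) t"
  by (simp add: map_tile_def image_comp comp_assoc image_image)

lemma map_tile_id: "map_tile (\<lambda>z. z) t = t"
  by (simp add: map_tile_def comp_def)

lemma shift_shift: "shift u (shift v t) = shift (u + v) t"
  unfolding shift_def map_tile_comp by (simp add: comp_def add_ac)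

lemma shift_0: "shift 0 t = t" using map_tile_id by (simp add: shift_def)

lemma shift_ptile: "shift v (ptile \<delta> w b) = ptile \<delta> w (b + v)"
  unfolding ptile_def shift_def map_tile_comp by (simp add: comp_def add_ac)

lemma translate_iff: "t \<in> translate v T \<longleftrightarrow> shift (- v) t \<in> T"
proof
  assume "t \<in> translate v T"
  then obtain s where "s \<in> T" "t = shift v s" unfolding translate_shift by blast
  then show "shift (- v) t \<in> T" by (simp add: shift_shift shift_0)
next
  assume "shift (- v) t \<in> T"
  then have "shift v (shift (- v) t) \<in> translate v T" unfolding translate_shift by blast
  then show "t \<in> translate v T" by (simp add: shift_shift shift_0)
qed

lemma support_shift: "support (shift v t) = (\<lambda>z. z + v) ` support t"
  by (simp add: shift_def map_tile_def)

text \<open>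
  The members of \<open>C\<close> approximate \<open>S\<close> only after a translation, which is carried along explicitly.
\<close>

lemma hull_agreement:
  assumes S: "S \<in> continuous_hull \<delta> C"
  shows "\<exists>T\<in>C. \<exists>v. \<forall>t. support t \<inter> ball 0 \<rho> \<noteq> {} \<longrightarrow> (t \<in> S \<longleftrightarrow> shift v t \<in> T)"
proof -
  obtain X where X: "\<And>n. X n \<in> {translate x T | x T. T \<in> C}" "tiling_tendsto X S"
    using S unfolding continuous_hull_def by blast
  \<comment> \<open>Closeness \<open>e \<le> 1\<close> moves tiles by at most 1, and \<open>1 / e\<close> exceeds \<open>\<rho>\<close> by that much.\<close>
  define e where "e = 1 / (\<bar>\<rho>\<bar> + 1)"
  have e: "0 < e" "e \<le> 1" by (simp_all add: e_def)
  have re: "1 / e = \<bar>\<rho>\<bar> + 1" by (simp add: e_def)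
  have "\<forall>\<^sub>F n in sequentially. tiling_close e (X n) S" using X(2) e(1) unfolding tiling_tendsto_def by blast
  then obtain n where "tiling_close e (X n) S" using eventually_sequentially by auto
  then obtain x y where xy: "norm x \<le> e" "norm y \<le> e" "agree_on (ball 0 (1 / e)) (translate x (X n)) (translate y S)"
    unfolding tiling_close_def by blast
  obtain u T where T: "X n = translate u T" "T \<in> C" using X(1) by blast
  have "t \<in> S \<longleftrightarrow> shift (y - x - u) t \<in> T" if t: "support t \<inter> ball 0 \<rho> \<noteq> {}" for t
  proof -
    obtain z where z: "z \<in> support t" "norm z < \<rho>" using t by auto
    have "norm (z + y) < 1 / e" unfolding re using norm_triangle_ineq [of z y] z(2) xy(2) e(2) by linarith
    then have m: "support (shift y t) \<inter> ball 0 (1 / e) \<noteq> {}" unfolding support_shift using z(1) by auto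
    have "t \<in> S \<longleftrightarrow> shift y t \<in> translate y S" unfolding translate_iff shift_shift by (simp add: shift_0)
    also have "\<dots> \<longleftrightarrow> shift y t \<in> translate x (X n)" using xy(3) m unfolding agree_on_def set_eq_iff by blast
    also have "\<dots> \<longleftrightarrow> shift (y - x - u) t \<in> T" unfolding T(1) translate_iff shift_shift by (simp add: algebra_simps)
    finally show ?thesis .
  qed
  then show ?thesis using T(2) by blast
qed

lemma tiling_nonempty: "is_tiling \<delta> T \<Longrightarrow> \<exists>w b. norm w = 1 \<and> ptile \<delta> w b \<in> T"
proof -
  assume T: "is_tiling \<delta> T"
  have "(0 :: complex) \<in> (\<Union>t\<in>T. support t)" using T unfolding is_tiling_def by simp
  then obtain t where "t \<in> T" by blast
  then show ?thesis using tiling_tile [OF T] by blast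
qed

lemma hull_tiling: "S \<in> continuous_hull \<delta> C \<Longrightarrow> is_tiling \<delta> S"
  unfolding continuous_hull_def by blast

lemma pos_hexnorm: "norm (pos x) \<le> 2 * of_int (hexnorm x)"
proof -
  have "norm (pos x) \<le> norm (of_int (fst x) :: complex) + norm (of_int (snd x) * zeta 1)"
    unfolding pos_def by (rule norm_triangle_ineq)
  also have "\<dots> = of_int \<bar>fst x\<bar> + of_int \<bar>snd x\<bar>" by (simp add: norm_mult)
  also have "\<dots> \<le> of_int (hexnorm x) + of_int (hexnorm x)" 
  proof -
    have "\<bar>fst x\<bar> \<le> hexnorm x" "\<bar>snd x\<bar> \<le> hexnorm x" using hexnorm_le [of x "hexnorm x"] by simp_all
    then show ?thesis by (intro add_mono) (simp_all only: of_int_le_iff)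
  qed
  finally show ?thesis by simp
qed

lemma hull_limit:
  fixes \<delta> :: real
  defines "C \<equiv> {T. is_tiling \<delta> T \<and> R1 T \<and> R2 T}"
  assumes d: "0 < \<delta>" "\<delta> < half_edge" and S: "S \<in> continuous_hull \<delta> C" and b: "norm w = 1" "ptile \<delta> w b \<in> S"
  shows "local_limit (heading \<delta> S w b)"
proof -
  let ?s = "heading \<delta> S w b"
  have ag: "\<exists>t. valid t \<and> conn t \<and> (\<forall>x\<in>hexball 0 R. t x = ?s x)" for R
  proof -
    \<comment> \<open>The ball contains the centres of all tiles at sites of the hexagon.\<close>
    define \<rho> where "\<rho> = norm b + 2 * of_int \<bar>R\<bar> + 1"
    obtain T v where T: "T \<in> C" and agr: "\<And>t. support t \<inter> ball 0 \<rho> \<noteq> {} \<Longrightarrow> t \<in> S \<longleftrightarrow> shift v t \<in> T"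
      using hull_agreement [OF S] by blast
    have site: "ptile \<delta> (w * zeta r) (b + w * pos x) \<in> S \<longleftrightarrow> ptile \<delta> (w * zeta r) (b + v + w * pos x) \<in> T"
      if x: "hexnorm x \<le> \<bar>R\<bar>" for r x
    proof -
      have "b + w * pos x \<in> hex (w * zeta r) (b + w * pos x)"
        using subsetD [OF interior_subset hex_ball [of "w * zeta r" "b + w * pos x" "b + w * pos x"]] by (simp add: norm_mult b)
      moreover have "norm (b + w * pos x) < \<rho>"
      proof -
        have "norm (b + w * pos x) \<le> norm b + norm (pos x)" using norm_triangle_ineq [of b "w * pos x"] by (simp add: norm_mult b)
        moreover have "of_int (hexnorm x) \<le> (of_int \<bar>R\<bar> :: real)" using x by (simp only: of_int_le_iff)
        ultimately show ?thesis using pos_hexnorm [of x] unfolding \<rho>_def by linarith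
      qed
      ultimately have "support (ptile \<delta> (w * zeta r) (b + w * pos x)) \<inter> ball 0 \<rho> \<noteq> {}" unfolding support_ptile by auto
      from agr [OF this] show ?thesis unfolding shift_ptile by (simp add: add_ac)
    qed
    have T': "is_tiling \<delta> T" "R1 T" "R2 T" using T unfolding C_def by auto
    have base: "ptile \<delta> w (b + v) \<in> T" using site [of 0 0] b(2) zeta_values(1) by (simp add: hexnorm_def)
    have "valid (heading \<delta> T w (b + v))" by (rule R1_valid [OF T'(1) base b(1) d T'(2)])
    moreover from this have "conn (heading \<delta> T w (b + v))" by (rule R2_conn [OF T'(1) base b(1) _ T'(3)])
    moreover have "heading \<delta> T w (b + v) x = ?s x" if "x \<in> hexball 0 R" for x
    proof -
      have "hexnorm x \<le> \<bar>R\<bar>" using that by (simp add: hexball_def)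
      then show ?thesis unfolding heading_def using site by simp
    qed
    ultimately show ?thesis by blast
  qed
  have "valid ?s" unfolding valid_def
  proof (intro allI)
    fix x d
    obtain t where t: "valid t" "\<forall>y\<in>hexball 0 (hexnorm x + 1). t y = ?s y" using ag by blast
    have "x \<in> hexball 0 (hexnorm x + 1)" "x + dir d \<in> hexball 0 (hexnorm x + 1)"
      using hexnorm_triangle [of x "dir d"] by (simp_all add: hexball_def hexnorm_dir)
    then show "out (d - ?s x) = inn (d - ?s (x + dir d))" using validD [OF t(1), of d x] t(2) by simp
  qed
  then show ?thesis unfolding local_limit_def using ag by metis
qed

lemma edge_of_shift:
  assumes "e edge_of (\<lambda>z. z + v) ` S" shows "(\<lambda>z. z - v) ` e edge_of (S :: complex set)"
proof -
  have e: "e = (+) v ` ((\<lambda>z. z - v) ` e)" by (simp add: image_image)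
  have s: "(\<lambda>z. z + v) ` S = (+) v ` S" by (simp add: add.commute image_def)
  have f: "(+) v ` ((\<lambda>z. z - v) ` e) face_of (+) v ` S" "aff_dim ((+) v ` ((\<lambda>z. z - v) ` e)) = 1"
    using assms unfolding edge_of_def s using e by simp_all
  show ?thesis unfolding edge_of_def
    using f unfolding face_of_translation_eq aff_dim_translation_eq by blast
qed

lemma r1_endpoints_shift: "r1_endpoints (shift v t) = (\<lambda>z. z + v) ` r1_endpoints t"
  unfolding r1_endpoints_def shift_def map_tile_def by (auto simp: pathstart_compose pathfinish_compose)

lemma hull_R1:
  assumes S: "S \<in> continuous_hull \<delta> {T. is_tiling \<delta> T \<and> R1 T \<and> R2 T}"
  shows "R1 S"
  unfolding R1_def
proof (intro ballI allI impI)
  fix s t e assume st: "s \<in> S" "t \<in> S" and e: "e edge_of support s \<and> e edge_of support t"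
  have ne: "\<exists>z. z \<in> support u" if uS: "u \<in> S" for u
  proof -
    obtain w b where u: "norm w = 1" "u = ptile \<delta> w b" using tiling_tile [OF hull_tiling [OF S] uS] by blast
    have "b \<in> hex w b" using subsetD [OF interior_subset hex_ball [OF u(1), of b b]] by simp
    then show ?thesis unfolding u(2) support_ptile by blast
  qed
  obtain z z' where z: "z \<in> support s" "z' \<in> support t" using ne st by blast
  define \<rho> where "\<rho> = norm z + norm z' + 1"
  have "z \<in> ball 0 \<rho>" "z' \<in> ball 0 \<rho>" unfolding \<rho>_def mem_ball dist_norm
    using norm_ge_zero [of z] norm_ge_zero [of z'] unfolding diff_0 norm_minus_cancel by linarith+
  then have m: "support s \<inter> ball 0 \<rho> \<noteq> {}" "support t \<inter> ball 0 \<rho> \<noteq> {}" using z by blast+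
  obtain T v where T: "R1 T" and agr: "\<And>t. support t \<inter> ball 0 \<rho> \<noteq> {} \<Longrightarrow> t \<in> S \<longleftrightarrow> shift v t \<in> T"
    using hull_agreement [OF S, of \<rho>] by blast
  have in_T: "shift v s \<in> T" "shift v t \<in> T" using agr m st by blast+
  let ?e = "(\<lambda>z. z + v) ` e"
  have eq: "?e edge_of support (shift v u)" if "e edge_of support u" for u
  proof -
    have "e edge_of (\<lambda>z. z + - v) ` support (shift v u)" using that by (simp add: support_shift image_image)
    then show ?thesis using edge_of_shift [of e "- v"] by simp
  qed
  have "r1_endpoints (shift v s) \<inter> ?e = r1_endpoints (shift v t) \<inter> ?e"
    using T in_T eq e unfolding R1_def by blast
  then have "(\<lambda>z. z + v) ` (r1_endpoints s \<inter> e) = (\<lambda>z. z + v) ` (r1_endpoints t \<inter> e)"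
    unfolding r1_endpoints_shift by (simp add: image_Int)
  then show "r1_endpoints s \<inter> e = r1_endpoints t \<inter> e" by (simp add: inj_image_eq_iff)
qed

text \<open>
  Two opposite vertices of one hexagon are within the circumradius of the other centre; the
  parallelogram law then leaves no room for a difference of the centres.
\<close>

lemma hex_centre:
  assumes v: "norm v = 1" "norm v' = 1" and e: "hex v c = hex v' c'" shows "c = c'"
proof -
  have par: "(norm (a + u))\<^sup>2 + (norm (a - u))\<^sup>2 = 2 * (norm a)\<^sup>2 + 2 * (norm u)\<^sup>2" for a u :: complex
    unfolding cmod_power2 by (simp add: power2_eq_square algebra_simps)
  define u where "u = v * Complex (1/2) half_edge"
  have q4: "(1/2)\<^sup>2 = (1/4 :: real)" by (simp add: power2_eq_square)
  have u2: "(norm u)\<^sup>2 = 1/3" unfolding u_def norm_mult v(1) cmod_power2 mult_1 complex.sel sqrt3_bounds(1) q4 by simp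
  have "edge_pt v c 0 half_edge \<in> edge_set v c 0" "edge_pt v c 3 half_edge \<in> edge_set v c 3" unfolding edge_set_def by auto
  then have "edge_pt v c 0 half_edge \<in> hex v' c'" "edge_pt v c 3 half_edge \<in> hex v' c'" using edge_set_face [OF v(1)] e by blast+
  then have n: "norm (edge_pt v c 0 half_edge - c') \<le> 1 / sqrt 3" "norm (edge_pt v c 3 half_edge - c') \<le> 1 / sqrt 3"
    using hex_radius(1) [OF v(2)] by blast+
  have p: "edge_pt v c 0 half_edge - c' = (c - c') + u" "edge_pt v c 3 half_edge - c' = (c - c') - u"
    unfolding edge_pt_def u_def zeta_values by (simp_all add: algebra_simps)
  have "(norm ((c - c') + u))\<^sup>2 \<le> (1 / sqrt 3)\<^sup>2" "(norm ((c - c') - u))\<^sup>2 \<le> (1 / sqrt 3)\<^sup>2"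
    using n unfolding p by (intro power_mono; simp)+
  then have "2 * (norm (c - c'))\<^sup>2 \<le> 0" using par [of "c - c'" u] u2 unfolding sqrt3_bounds(2) by linarith
  then show ?thesis by simp
qed

lemma pos_inj: "pos x = pos y \<Longrightarrow> x = y"
proof -
  assume "pos x = pos y"
  then have "pos (x - y) = 0" by (simp add: pos_diff)
  then show "x = y" using pos_norm_ge_1 [of "x - y"] by force
qed

lemma finite_card_le_3:
  assumes "\<And>F. finite F \<Longrightarrow> F \<subseteq> A \<Longrightarrow> card F \<le> 3" shows "finite A \<and> card A \<le> 3"
proof -
  have "finite A"
  proof (rule ccontr)
    assume "infinite A"
    then obtain F where "finite F" "card F = 4" "F \<subseteq> A" using infinite_arbitrarily_large by blast
    then show False using assms [of F] by simp
  qed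
  then show ?thesis using assms by blast
qed

theorem theorem4p1:
  fixes \<delta> :: real
  assumes "0 < \<delta>" and "\<delta> < 1 / (2 * sqrt 3)"
  shows "\<forall>T \<in> continuous_hull \<delta> {T. is_tiling \<delta> T \<and> R1 T \<and> R2 T}.
           nonperiodic T \<and> R1 T \<and>
           finite (components (R2_union T)) \<and> card (components (R2_union T)) \<le> 3 \<and>
           (\<forall>c \<in> components (R2_union T).
              infinite {t \<in> T. c \<inter> interior (support t) \<noteq> {}})"
proof
  fix S assume S: "S \<in> continuous_hull \<delta> {T. is_tiling \<delta> T \<and> R1 T \<and> R2 T}"
  have T: "is_tiling \<delta> S" by (rule hull_tiling [OF S])
  obtain w b where w: "norm w = 1" and base: "ptile \<delta> w b \<in> S" using tiling_nonempty [OF T] by blast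
  have w0: "w \<noteq> 0" using w by auto
  define s where "s = heading \<delta> S w b"
  have lim: "local_limit s" unfolding s_def by (rule hull_limit [OF assms S w base])
  then have val: "valid s" unfolding local_limit_def by blast
  note site = tile_at_in [OF T base w]
  have tile_at_s: "tile_at \<delta> S w b x = ptile \<delta> (w * zeta (s x - 4)) (b + w * pos x)" for x
    by (simp add: tile_at_def s_def)
  have nw: "norm (w * zeta k) = 1" for k by (simp add: norm_mult w)

  have "nonperiodic S" unfolding nonperiodic_def
  proof
    assume "\<exists>v. v \<noteq> 0 \<and> translate v S = S"
    then obtain v where v: "v \<noteq> 0" "translate v S = S" by blast
    have per: "shift v t \<in> S \<longleftrightarrow> t \<in> S" for t
      using translate_iff [of "shift v t" v S] v(2) by (simp add: shift_shift shift_0)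
    have "ptile \<delta> w (b + v) \<in> S" using per [of "ptile \<delta> w b"] base by (simp add: shift_ptile)
    then obtain a where a: "ptile \<delta> w (b + v) = tile_at \<delta> S w b a" using tile_is_site [OF T base w] by blast
    have "hex w (b + v) = hex (w * zeta (s a - 4)) (b + w * pos a)" using a unfolding tile_at_s by (metis support_ptile)
    then have va: "v = w * pos a" using hex_centre [OF w nw] by fastforce
    then have "a \<noteq> 0" using v(1) by auto
    moreover have "s (x + a) = s x" for x
    proof -
      have "ptile \<delta> (w * zeta r) (b + w * pos (x + a)) \<in> S \<longleftrightarrow> ptile \<delta> (w * zeta r) (b + w * pos x) \<in> S" for r
      proof -
        have "b + w * pos (x + a) = b + w * pos x + v" by (simp add: pos_add va algebra_simps)
        then show ?thesis using per [of "ptile \<delta> (w * zeta r) (b + w * pos x)"] by (simp only: shift_ptile)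
      qed
      then show ?thesis unfolding s_def heading_def by simp
    qed
    ultimately show False using local_limit_nonperiodic [OF lim] by metis
  qed
  moreover have "R1 S" by (rule hull_R1 [OF S])
  moreover
  define U where "U = R2_union S"
  have U: "U = (\<Union>x. tree w b s x)" unfolding U_def s_def by (rule R2_union_trees [OF T base w])
  define ctr where "ctr x = b + w * pos x" for x
  define comp where "comp x = connected_component_set U (ctr x)" for x
  have tc: "tree w b s x \<subseteq> comp x" for x unfolding comp_def ctr_def
    by (rule connected_component_maximal [OF centre_in_tree tree_connected]) (use U in blast)
  have cstep: "comp (step s x) = comp x" for x
  proof -
    obtain z where "z \<in> tree w b s x" "z \<in> tree w b s (step s x)" using trees_touch [OF val, of w b x] by blast
    then have "z \<in> comp x" "z \<in> comp (step s x)" using tc by blast+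
    then show ?thesis unfolding comp_def using connected_component_eq by metis
  qed
  have csteps: "comp ((step s ^^ i) x) = comp x" for i x by (induction i) (simp_all add: cstep)
  have clink: "comp x = comp y" if "link s x y" for x y using that csteps unfolding link_def by metis
  have cex: "\<exists>x. c = comp x" if c: "c \<in> components U" for c
  proof -
    obtain p where p: "p \<in> U" "c = connected_component_set U p" using c unfolding components_def by blast
    obtain x where "p \<in> tree w b s x" using p(1) U by blast
    then have "p \<in> comp x" using tc by blast
    then have "c = comp x" unfolding comp_def p(2) by (rule connected_component_eq)
    then show ?thesis by blast
  qed
  have "finite (components U) \<and> card (components U) \<le> 3"
  proof (rule finite_card_le_3)
    fix F assume F: "finite F" "F \<subseteq> components U"
    have "\<forall>c\<in>F. \<exists>x. c = comp x" using cex F(2) by blast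
    then obtain g where g: "\<And>c. c \<in> F \<Longrightarrow> c = comp (g c)" by metis
    define \<rho> where "\<rho> = Max (insert 0 ((hexnorm \<circ> g) ` F))"
    have fin: "finite (insert 0 ((hexnorm \<circ> g) ` F))" using F(1) by simp
    have r0: "0 \<le> \<rho>" unfolding \<rho>_def by (rule Max_ge [OF fin]) simp
    have rg: "g c \<in> hexball 0 \<rho>" if "c \<in> F" for c
      unfolding hexball_def \<rho>_def using Max_ge [OF fin, of "hexnorm (g c)"] that by simp
    obtain r1 r2 r3 where r: "\<And>x. x \<in> hexball 0 \<rho> \<Longrightarrow> link s x r1 \<or> link s x r2 \<or> link s x r3"
      using local_limit_three_classes [OF lim r0] unfolding three_classes_def by blast
    have "F \<subseteq> {comp r1, comp r2, comp r3}"
    proof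
      fix c assume c: "c \<in> F"
      have "comp (g c) = comp r1 \<or> comp (g c) = comp r2 \<or> comp (g c) = comp r3" using r [OF rg [OF c]] clink by blast
      then show "c \<in> {comp r1, comp r2, comp r3}" using g [OF c] by auto
    qed
    then have "card F \<le> card {comp r1, comp r2, comp r3}" by (intro card_mono) auto
    also have "\<dots> \<le> 3" by (simp add: card_insert_if)
    finally show "card F \<le> 3" .
  qed
  moreover have "infinite {t \<in> S. c \<inter> interior (support t) \<noteq> {}}" if c: "c \<in> components U" for c
  proof -
    obtain x where x: "c = comp x" using cex [OF c] by blast
    let ?st = "tile_at \<delta> S w b"
    have inj: "inj ?st"
    proof (rule injI)
      fix y z assume "?st y = ?st z"
      then have "hex (w * zeta (s y - 4)) (b + w * pos y) = hex (w * zeta (s z - 4)) (b + w * pos z)"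
        unfolding tile_at_s by (metis support_ptile)
      then have "b + w * pos y = b + w * pos z" by (rule hex_centre [OF nw nw])
      then show "y = z" using w0 pos_inj by simp
    qed
    have "?st ` {y. link s x y} \<subseteq> {t \<in> S. c \<inter> interior (support t) \<noteq> {}}"
    proof
      fix t assume "t \<in> ?st ` {y. link s x y}"
      then obtain y where y: "link s x y" "t = ?st y" by blast
      have "ctr y \<in> interior (support t)" unfolding y(2) tile_at_s support_ptile ctr_def
        by (rule hex_ball [OF nw]) simp
      moreover have "ctr y \<in> c" unfolding x clink [OF y(1)] using tc centre_in_tree [of b w y s] unfolding ctr_def by blast
      ultimately show "t \<in> {t \<in> S. c \<inter> interior (support t) \<noteq> {}}" using site y(2) by blast
    qed
    moreover have "infinite (?st ` {y. link s x y})"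
      using local_limit_infinite [OF lim, of x] finite_imageD inj_on_subset [OF inj] by blast
    ultimately show ?thesis using finite_subset by blast
  qed
  ultimately show "nonperiodic S \<and> R1 S \<and>
           finite (components (R2_union S)) \<and> card (components (R2_union S)) \<le> 3 \<and>
           (\<forall>c \<in> components (R2_union S).
              infinite {t \<in> S. c \<inter> interior (support t) \<noteq> {}})" unfolding U_def by blast
qed

end
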